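(* Let $X,Y\subset\mathbb{P}^n$ be irreducible varieties, neither of which is contained in $\Delta_{n-1}$. Denote by $H\subset(\mathbb{C}^* )^{n+1}/\mathbb{C}^*$ the largest subtorus acting on both $X$ and $Y$, and by $G\subset(\mathbb{C}^* )^{n+1}/\mathbb{C}^*$ the smallest subtorus having a coset containing $X$ and a coset containing $Y$. Then \[\dim(X\star Y)\;\le\;\min\{\dim(X)+\dim(Y)-\dim(H),\ \dim(G)\}.\]
   Context: The base field is $\mathbb{C}$. $\Delta_{n-1}\subset\mathbb{P}^n$ is the union of the coordinate hyperplanes, and $\mathbb{P}^n\setminus\Delta_{n-1}$ is identified with the torus $(\mathbb{C}^* )^{n+1}/\mathbb{C}^*$, which acts on $\mathbb{P}^n$ by scaling homogeneous coordinates. A subtorus is a connected closed algebraic subgroup. A subtorus $H$ acts on $X$ if $h\cdot X=X$ for all $h\in H$. A coset of $G$ "containing $X$" means a coset of $G$ in the torus containing $X\setminus\Delta_{n-1}$. For points $p=[a_0:\dots:a_n]$, $q=[b_0:\dots:b_n]$ of $\mathbb{P}^n$, the Hadamard product $p\star q=[a_0b_0:\dots:a_nb_n]$ is defined when some $a_ib_i\neq0$, and is not defined otherwise; $X\star Y$ is the Zariski closure of $\{p\star q: p\in X,\ q\in Y,\ p\star q \text{ is defined}\}$. *)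

theory Defs
  imports "HOL-Analysis.Analysis" "HOL-Library.Poly_Mapping" "HOL-Algebra.Coset"
begin

section \<open>Projective space\<close>

definition proj_rel :: "complex^'n \<Rightarrow> complex^'n \<Rightarrow> bool"
  where "proj_rel x y \<longleftrightarrow> x \<noteq> 0 \<and> y \<noteq> 0 \<and> (\<exists>c. c \<noteq> 0 \<and> y = c *s x)"

lemma part_equivp_proj_rel: "part_equivp (proj_rel :: complex^'n \<Rightarrow> complex^'n \<Rightarrow> bool)"
proof (rule part_equivpI)
  have "proj_rel (axis undefined 1) (axis undefined 1 :: complex^'n)"
    by (auto simp: proj_rel_def axis_eq_0_iff intro!: exI[of _ 1])
  thus "\<exists>x :: complex^'n. proj_rel x x" by blast
  show "symp (proj_rel :: complex^'n \<Rightarrow> complex^'n \<Rightarrow> bool)"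
  proof (rule sympI)
    fix x y :: "complex^'n" assume "proj_rel x y"
    then obtain c where "x \<noteq> 0" "y \<noteq> 0" "c \<noteq> 0" "y = c *s x"
      by (auto simp: proj_rel_def)
    thus "proj_rel y x"
      by (auto simp: proj_rel_def vector_smult_assoc intro!: exI[of _ "inverse c"])
  qed
  show "transp (proj_rel :: complex^'n \<Rightarrow> complex^'n \<Rightarrow> bool)"
  proof (rule transpI)
    fix x y z :: "complex^'n" assume "proj_rel x y" "proj_rel y z"
    then obtain c d where "x \<noteq> 0" "z \<noteq> 0" "c \<noteq> 0" "d \<noteq> 0" "y = c *s x" "z = d *s y"
      by (auto simp: proj_rel_def)
    thus "proj_rel x z"
      by (auto simp: proj_rel_def vector_smult_assoc intro!: exI[of _ "d * c"])
  qed
qed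

text \<open>For an index type \<^typ>\<open>'n\<close> with \<open>n + 1\<close> elements, \<open>'n proj\<close> is \<open>\<P>\<^sup>n\<close> over the
  complex numbers.  Arbitrary \<open>n \<ge> 0\<close> is covered.\<close>

quotient_type 'n proj = "complex^'n" / partial: proj_rel
  by (rule part_equivp_proj_rel)

abbreviation pt :: "complex^'n \<Rightarrow> 'n proj"
  where "pt \<equiv> abs_proj"

abbreviation coords :: "'n proj \<Rightarrow> complex^'n"
  where "coords \<equiv> rep_proj"

lemma coords_nonzero: "coords p \<noteq> 0"
  using Quotient3_rep_reflp[OF Quotient3_proj] by (auto simp: proj_rel_def)

lemma pt_coords [simp]: "pt (coords p) = p"
  by (rule Quotient3_abs_rep[OF Quotient3_proj])

lemma pt_eq_iff:
  assumes "a \<noteq> 0" "b \<noteq> 0"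
  shows "pt a = pt b \<longleftrightarrow> (\<exists>c. c \<noteq> 0 \<and> b = c *s a)"
proof -
  have refl: "proj_rel a a" "proj_rel b b"
    using assms by (auto simp: proj_rel_def intro!: exI[of _ 1])
  have "pt a = pt b \<longleftrightarrow> proj_rel a b"
    using Quotient3_rel[OF Quotient3_proj, of a b] refl by blast
  thus ?thesis using assms by (simp add: proj_rel_def)
qed

lemma coords_pt:
  assumes "a \<noteq> 0"
  obtains c where "c \<noteq> 0" "coords (pt a) = c *s a"
  using pt_eq_iff[OF assms coords_nonzero[of "pt a"]] by auto

section \<open>The Zariski topology\<close>

type_synonym 'n mpoly = "('n \<Rightarrow>\<^sub>0 nat) \<Rightarrow>\<^sub>0 complex"

definition peval :: "'n::finite mpoly \<Rightarrow> complex^'n \<Rightarrow> complex"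
  where "peval P x = (\<Sum>m\<in>Poly_Mapping.keys P. Poly_Mapping.lookup P m * (\<Prod>i\<in>UNIV. x $ i ^ Poly_Mapping.lookup m i))"

definition homogeneous :: "nat \<Rightarrow> 'n::finite mpoly \<Rightarrow> bool"
  where "homogeneous d P \<longleftrightarrow> (\<forall>m\<in>Poly_Mapping.keys P. (\<Sum>i\<in>UNIV. Poly_Mapping.lookup m i) = d)"

definition projective_zeros :: "'n::finite mpoly set \<Rightarrow> 'n proj set"
  where "projective_zeros F = {p. \<forall>P\<in>F. peval P (coords p) = 0}"

definition zariski_closed :: "'n::finite proj set \<Rightarrow> bool"
  where "zariski_closed S \<longleftrightarrow>
    (\<exists>F. (\<forall>P\<in>F. \<exists>d. homogeneous d P) \<and> S = projective_zeros F)"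

definition zariski :: "'n::finite proj topology"
  where "zariski = topology (\<lambda>U. zariski_closed (- U))"

lemma peval_superset:
  assumes "finite A" "Poly_Mapping.keys P \<subseteq> A"
  shows "peval P x = (\<Sum>m\<in>A. Poly_Mapping.lookup P m * (\<Prod>i\<in>UNIV. x $ i ^ Poly_Mapping.lookup m i))"
  unfolding peval_def using assms
  by (intro sum.mono_neutral_left) (auto simp: in_keys_iff)

lemma peval_add: "peval (P + Q) x = peval P x + peval Q x"
proof -
  let ?A = "Poly_Mapping.keys P \<union> Poly_Mapping.keys Q"
  have "Poly_Mapping.keys (P + Q) \<subseteq> ?A" by (rule keys_add)
  thus ?thesis
    by (subst (1 2 3) peval_superset[where A = ?A])
       (auto simp: lookup_add algebra_simps sum.distrib)
qed

lemma peval_zero [simp]: "peval 0 x = 0"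
  by (simp add: peval_def)

lemma peval_single: "peval (Poly_Mapping.single m c) x = c * (\<Prod>i\<in>UNIV. x $ i ^ Poly_Mapping.lookup m i)"
  by (subst peval_superset[where A = "{m}"]) auto

lemma peval_sum: "peval (sum f A) x = (\<Sum>a\<in>A. peval (f a) x)"
  by (induction A rule: infinite_finite_induct) (auto simp: peval_add)

lemma mpoly_sum_monomials: "P = (\<Sum>m\<in>Poly_Mapping.keys P. Poly_Mapping.single m (Poly_Mapping.lookup P m))"
  by (rule poly_mapping_eqI) (auto simp: lookup_sum lookup_single when_def in_keys_iff)

lemma peval_mult: "peval (P * Q) x = peval P x * peval Q x"
proof -
  have "P * Q = (\<Sum>m\<in>Poly_Mapping.keys P. Poly_Mapping.single m (Poly_Mapping.lookup P m)) *
                (\<Sum>m\<in>Poly_Mapping.keys Q. Poly_Mapping.single m (Poly_Mapping.lookup Q m))"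
    by (rule arg_cong2[of _ _ _ _ "(*)", OF mpoly_sum_monomials mpoly_sum_monomials])
  also have "\<dots> = (\<Sum>m\<in>Poly_Mapping.keys P. \<Sum>k\<in>Poly_Mapping.keys Q.
      Poly_Mapping.single (m + k) (Poly_Mapping.lookup P m * Poly_Mapping.lookup Q k))"
    by (simp add: sum_product mult_single)
  finally show ?thesis
    by (simp add: peval_sum peval_single lookup_add power_add prod.distrib
        peval_def[of P] peval_def[of Q] sum_product mult_ac)
qed

lemma homogeneous_mult:
  assumes "homogeneous d P" "homogeneous e Q"
  shows "homogeneous (d + e) (P * Q)"
  unfolding homogeneous_def
proof
  fix m assume "m \<in> Poly_Mapping.keys (P * Q)"
  then obtain a b where "a \<in> Poly_Mapping.keys P" "b \<in> Poly_Mapping.keys Q" "m = a + b"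
    using keys_mult[of P Q] by blast
  thus "(\<Sum>i\<in>UNIV. Poly_Mapping.lookup m i) = d + e"
    using assms by (auto simp: homogeneous_def lookup_add sum.distrib)
qed

lemma peval_scale:
  assumes "homogeneous d P"
  shows "peval P (c *s x) = c ^ d * peval P x"
proof -
  have "Poly_Mapping.lookup P m * (\<Prod>i\<in>UNIV. (c *s x) $ i ^ Poly_Mapping.lookup m i) =
        c ^ d * (Poly_Mapping.lookup P m * (\<Prod>i\<in>UNIV. x $ i ^ Poly_Mapping.lookup m i))" if "m \<in> Poly_Mapping.keys P" for m
    using assms that
    by (simp add: homogeneous_def power_mult_distrib prod.distrib flip: power_sum)
  thus ?thesis unfolding peval_def sum_distrib_left by (intro sum.cong refl)
qed

text \<open>Vanishing of a homogeneous polynomial at a point does not depend on the chosen coordinates.\<close>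

lemma peval_coords_pt_eq_0_iff:
  assumes "homogeneous d P" "a \<noteq> 0"
  shows "peval P (coords (pt a)) = 0 \<longleftrightarrow> peval P a = 0"
proof -
  obtain c where "c \<noteq> 0" "coords (pt a) = c *s a" using coords_pt[OF assms(2)] .
  thus ?thesis using peval_scale[OF assms(1), of c a] by simp
qed

lemma zariski_closed_Un:
  assumes "zariski_closed S" "zariski_closed T"
  shows "zariski_closed (S \<union> T)"
proof -
  obtain F where F: "\<forall>P\<in>F. \<exists>d. homogeneous d P" "S = projective_zeros F"
    using assms(1) unfolding zariski_closed_def by blast
  obtain G where G: "\<forall>P\<in>G. \<exists>d. homogeneous d P" "T = projective_zeros G"
    using assms(2) unfolding zariski_closed_def by blast
  let ?FG = "(\<lambda>(P, Q). P * Q) ` (F \<times> G)"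
  have "\<forall>P\<in>?FG. \<exists>d. homogeneous d P"
    using F(1) G(1) homogeneous_mult by fastforce
  moreover have "S \<union> T = projective_zeros ?FG"
    unfolding F(2) G(2) projective_zeros_def by (auto simp: peval_mult)
  ultimately show ?thesis unfolding zariski_closed_def by blast
qed

lemma zariski_closed_Inter:
  assumes "\<And>S. S \<in> \<S> \<Longrightarrow> zariski_closed S"
  shows "zariski_closed (\<Inter>\<S>)"
proof -
  obtain F where F: "\<And>S. S \<in> \<S> \<Longrightarrow> (\<forall>P\<in>F S. \<exists>d. homogeneous d P) \<and> S = projective_zeros (F S)"
    using assms unfolding zariski_closed_def by metis
  have "\<Inter>\<S> = projective_zeros (\<Union>(F ` \<S>))"
  proof -
    have "\<Inter>\<S> = (\<Inter>S\<in>\<S>. projective_zeros (F S))" using F by auto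
    thus ?thesis by (auto simp: projective_zeros_def)
  qed
  moreover have "\<forall>P\<in>\<Union>(F ` \<S>). \<exists>d. homogeneous d P" using F by blast
  ultimately show ?thesis unfolding zariski_closed_def by blast
qed

lemma istopology_zariski: "istopology (\<lambda>U. zariski_closed (- U))"
  unfolding istopology_def
proof (intro conjI allI impI)
  fix S T :: "'a proj set"
  assume "zariski_closed (- S)" "zariski_closed (- T)"
  thus "zariski_closed (- (S \<inter> T))" using zariski_closed_Un by (simp add: Compl_Int)
next
  fix \<K> :: "'a proj set set"
  assume "\<forall>K\<in>\<K>. zariski_closed (- K)"
  hence "zariski_closed (\<Inter>(uminus ` \<K>))" by (intro zariski_closed_Inter) auto
  moreover have "- \<Union>\<K> = \<Inter>(uminus ` \<K>)" by auto
  ultimately show "zariski_closed (- \<Union>\<K>)" by simp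
qed

lemma openin_zariski: "openin zariski U \<longleftrightarrow> zariski_closed (- U)"
  by (simp add: zariski_def topology_inverse'[OF istopology_zariski])

lemma topspace_zariski [simp]: "topspace zariski = UNIV"
proof -
  have "projective_zeros {1 :: 'a mpoly} = {}"
    by (auto simp: projective_zeros_def peval_single simp flip: single_one)
  moreover have "homogeneous 0 (1 :: 'a mpoly)"
    by (auto simp: homogeneous_def)
  ultimately have "zariski_closed ({} :: 'a proj set)"
    unfolding zariski_closed_def by (intro exI[of _ "{1}"]) auto
  hence "openin zariski (UNIV :: 'a proj set)" by (simp add: openin_zariski)
  thus ?thesis using openin_subset by blast
qed

lemma closedin_zariski: "closedin zariski S \<longleftrightarrow> zariski_closed S"
  by (simp add: closedin_def openin_zariski flip: Compl_eq_Diff_UNIV)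

section \<open>Irreducibility and dimension\<close>

definition irreducible_in :: "'a topology \<Rightarrow> 'a set \<Rightarrow> bool"
  where "irreducible_in T S \<longleftrightarrow> S \<subseteq> topspace T \<and> S \<noteq> {} \<and>
    (\<forall>A B. closedin T A \<longrightarrow> closedin T B \<longrightarrow> S \<subseteq> A \<union> B \<longrightarrow> S \<subseteq> A \<or> S \<subseteq> B)"

text \<open>The supremum is taken in \<^typ>\<open>nat\<close>; for subspaces of projective space the set of chain
  lengths is bounded.\<close>

definition krull_dim :: "'a topology \<Rightarrow> nat"
  where "krull_dim T = Sup {k. \<exists>Z :: nat \<Rightarrow> 'a set.
    (\<forall>i\<le>k. closedin T (Z i) \<and> irreducible_in T (Z i)) \<and> (\<forall>i<k. Z i \<subset> Z (Suc i))}"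

definition zariski_dim :: "'n::finite proj set \<Rightarrow> nat"
  where "zariski_dim S = krull_dim (subtopology zariski S)"

definition irreducible_variety :: "'n::finite proj set \<Rightarrow> bool"
  where "irreducible_variety X \<longleftrightarrow> closedin zariski X \<and> irreducible_in zariski X"

section \<open>Hadamard products\<close>

definition hadamard_defined :: "'n::finite proj \<Rightarrow> 'n proj \<Rightarrow> bool"
  where "hadamard_defined p q \<longleftrightarrow> (\<exists>i. coords p $ i * coords q $ i \<noteq> 0)"

text \<open>Only meaningful under \<^const>\<open>hadamard_defined\<close>.\<close>

definition hadamard :: "'n::finite proj \<Rightarrow> 'n proj \<Rightarrow> 'n proj"
  where "hadamard p q = pt (\<chi> i. coords p $ i * coords q $ i)"

definition hadamard_product :: "'n::finite proj set \<Rightarrow> 'n proj set \<Rightarrow> 'n proj set"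
    (infixl \<open>\<star>\<close> 70)
  where "X \<star> Y = zariski closure_of {hadamard p q | p q. p \<in> X \<and> q \<in> Y \<and> hadamard_defined p q}"

lemma hadamard_defined_pt:
  assumes "a \<noteq> 0" "b \<noteq> 0"
  shows "hadamard_defined (pt a) (pt b) \<longleftrightarrow> (\<exists>i. a $ i * b $ i \<noteq> 0)"
proof -
  obtain c where "c \<noteq> 0" "coords (pt a) = c *s a" using coords_pt[OF assms(1)] .
  moreover obtain d where "d \<noteq> 0" "coords (pt b) = d *s b" using coords_pt[OF assms(2)] .
  ultimately show ?thesis by (simp add: hadamard_defined_def)
qed

lemma hadamard_pt:
  assumes "\<exists>i. a $ i * b $ i \<noteq> 0"
  shows "hadamard (pt a) (pt b) = pt (\<chi> i. a $ i * b $ i)"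
proof -
  have nz: "a \<noteq> 0" "b \<noteq> 0" "(\<chi> i. a $ i * b $ i) \<noteq> 0"
    using assms by (auto simp: vec_eq_iff)
  obtain c where c: "c \<noteq> 0" "coords (pt a) = c *s a" using coords_pt[OF nz(1)] .
  obtain d where d: "d \<noteq> 0" "coords (pt b) = d *s b" using coords_pt[OF nz(2)] .
  have eq: "(\<chi> i. coords (pt a) $ i * coords (pt b) $ i) = (c * d) *s (\<chi> i. a $ i * b $ i)"
    by (simp add: c d vec_eq_iff)
  have "pt (\<chi> i. a $ i * b $ i) = pt ((c * d) *s (\<chi> i. a $ i * b $ i))"
    using nz(3) c d by (subst pt_eq_iff) (auto simp: vec_eq_iff intro!: exI[of _ "c * d"])
  thus ?thesis unfolding hadamard_def eq by simp
qed

section \<open>The torus and its subtori\<close>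

definition coordinate_hyperplanes :: "'n::finite proj set" (\<open>\<Delta>\<close>)
  where "\<Delta> = {p. \<exists>i. coords p $ i = 0}"

text \<open>The complement of the coordinate hyperplanes, identified with \<open>(\<complex>\<^sup>*)\<^sup>n\<^sup>+\<^sup>1/\<complex>\<^sup>*\<close>: the group law
  and the action on projective space are both given by \<^const>\<open>hadamard\<close>, which is always defined
  if one factor lies in the torus.\<close>

definition torus :: "'n::finite proj monoid"
  where "torus = \<lparr>carrier = - \<Delta>, mult = hadamard, one = pt (\<chi> i. 1)\<rparr>"

lemma mem_torus_pt:
  assumes "a \<noteq> 0"
  shows "pt a \<in> carrier torus \<longleftrightarrow> (\<forall>i. a $ i \<noteq> 0)"
proof -
  obtain c where "c \<noteq> 0" "coords (pt a) = c *s a" using coords_pt[OF assms] .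
  thus ?thesis by (simp add: torus_def coordinate_hyperplanes_def)
qed

lemma torus_cases:
  assumes "p \<in> carrier torus"
  obtains a where "\<And>i. a $ i \<noteq> 0" "p = pt a"
  using assms that[of "coords p"] by (auto simp: torus_def coordinate_hyperplanes_def)

lemma nonzero_vec: "(\<And>i. a $ i \<noteq> 0) \<Longrightarrow> a \<noteq> (0 :: complex^'n)"
  by auto

lemma pt_mult_torus:
  assumes "\<And>i. a $ i \<noteq> 0" "\<And>i. b $ i \<noteq> 0"
  shows "pt a \<otimes>\<^bsub>torus\<^esub> pt b = pt (\<chi> i. a $ i * b $ i)"
  using assms by (simp add: torus_def hadamard_pt)

lemma comm_group_torus: "comm_group (torus :: 'n::finite proj monoid)"
proof (rule comm_groupI)
  fix x y :: "'n proj" assume "x \<in> carrier torus" "y \<in> carrier torus"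
  then obtain a b where ab: "\<And>i. a $ i \<noteq> 0" "x = pt a" "\<And>i. b $ i \<noteq> 0" "y = pt b"
    by (elim torus_cases) blast
  show "x \<otimes>\<^bsub>torus\<^esub> y \<in> carrier torus"
    using ab by (simp add: pt_mult_torus mem_torus_pt nonzero_vec)
  show "x \<otimes>\<^bsub>torus\<^esub> y = y \<otimes>\<^bsub>torus\<^esub> x"
    using ab by (simp add: pt_mult_torus mult.commute)
next
  show "\<one>\<^bsub>torus\<^esub> \<in> carrier (torus :: 'n proj monoid)"
    using mem_torus_pt[of "(\<chi> i. 1) :: complex^'n"] by (simp add: torus_def nonzero_vec)
next
  fix x y z :: "'n proj"
  assume "x \<in> carrier torus" "y \<in> carrier torus" "z \<in> carrier torus"
  then obtain a b c where "\<And>i. a $ i \<noteq> 0" "x = pt a" "\<And>i. b $ i \<noteq> 0" "y = pt b"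
    "\<And>i. c $ i \<noteq> 0" "z = pt c"
    by (elim torus_cases) blast
  thus "x \<otimes>\<^bsub>torus\<^esub> y \<otimes>\<^bsub>torus\<^esub> z = x \<otimes>\<^bsub>torus\<^esub> (y \<otimes>\<^bsub>torus\<^esub> z)"
    by (simp add: pt_mult_torus mult.assoc)
next
  fix x :: "'n proj" assume "x \<in> carrier torus"
  then obtain a where a: "\<And>i. a $ i \<noteq> 0" "x = pt a"
    by (elim torus_cases) blast
  have one: "\<one>\<^bsub>torus\<^esub> = pt ((\<chi> i. 1) :: complex^'n)" by (simp add: torus_def)
  show "\<one>\<^bsub>torus\<^esub> \<otimes>\<^bsub>torus\<^esub> x = x"
    using a by (simp add: one pt_mult_torus)
  have "pt (\<chi> i. inverse (a $ i)) \<in> carrier torus"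
    using a by (simp add: mem_torus_pt nonzero_vec)
  moreover have "pt (\<chi> i. inverse (a $ i)) \<otimes>\<^bsub>torus\<^esub> x = \<one>\<^bsub>torus\<^esub>"
    using a by (simp add: one pt_mult_torus)
  ultimately show "\<exists>y\<in>carrier torus. y \<otimes>\<^bsub>torus\<^esub> x = \<one>\<^bsub>torus\<^esub>" by blast
qed

definition subtorus :: "'n::finite proj set \<Rightarrow> bool"
  where "subtorus H \<longleftrightarrow> subgroup H torus \<and>
    closedin (subtopology zariski (carrier torus)) H \<and> connectedin zariski H"

definition acts_on :: "'n::finite proj set \<Rightarrow> 'n proj set \<Rightarrow> bool"
  where "acts_on H X \<longleftrightarrow> (\<forall>h\<in>H. hadamard h ` X = X)"

definition has_coset_containing :: "'n::finite proj set \<Rightarrow> 'n proj set \<Rightarrow> bool"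
  where "has_coset_containing G X \<longleftrightarrow> (\<exists>t\<in>carrier torus. X - \<Delta> \<subseteq> t <#\<^bsub>torus\<^esub> G)"

end

theory Submission
  imports Defs "HOL-Library.Function_Algebras" "HOL-Computational_Algebra.Fundamental_Theorem_Algebra"
begin

text \<open>The proof measures a set \<open>V\<close> of vectors by its Hilbert function \<open>hilb V d\<close>, the dimension of the space
  of degree \<open>d\<close> forms restricted to \<open>V\<close>.  Multiplication by a form shows that a chain of \<open>k + 1\<close> irreducible
  sets forces growth at least \<open>d ^ k\<close>.  Conversely, a closed irreducible subset of the torus with \<open>k\<close>
  algebraically independent coordinates and no more has growth at most \<open>d ^ k\<close> and carries a chain of
  length \<open>k\<close>: by a Chevalley argument the fibre over a general value of one of these coordinates leaves
  the others independent.

  For the bound involving \<open>H\<close>, let \<open>h\<close> in \<open>H\<close> act on \<open>X \<times> Y\<close> by \<open>(h x, h\<inverse> y)\<close>.  Forms in \<open>x y\<close> are invariant and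
  monomials in \<open>x\<close> transform by characters of \<open>H\<close>, so products of independent ones remain independent; hence
  \<open>hilb (X \<star> Y) d * hilb H d \<le> hilb X (2 * d) * hilb Y d\<close>.  The bound by \<open>G\<close> holds because \<open>X \<star> Y\<close> is contained in
  the closure of a translate of \<open>G\<close>.\<close>

section \<open>Polynomial functions\<close>

text \<open>Dimensions are compared only through exponents of growth, so one-sided bounds on Hilbert
  functions suffice: growth at least \<open>d ^ dim\<close> is used for \<open>X \<star> Y\<close>
  and \<open>H\<close>, growth at most \<open>d ^ dim\<close> for \<open>X\<close>, \<open>Y\<close>
  and \<open>G\<close>. The argument \<open>2 * d\<close> only costs a constant factor. The lower
  bound holds for every nonempty set. The upper bound is harder, since it must exhibit a long chain
  of irreducible sets; for \<open>G\<close>, which is closed only in the torus, the members of the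
  chain must have a dense part in the torus. Hence the prime ideals of the chain must avoid the
  product of all coordinates, and the elimination of variables carries along a polynomial
  \<open>b\<close> that has to stay nonzero. A second obstacle: subtori are defined by
  connectedness, whereas the upper bound needs irreducibility. For \<open>H\<close> the lower bound
  suffices, so the identity component of the joint stabiliser serves. For \<open>G\<close>
  irreducibility is built in: the smallest closed subgroup containing translates of
  \<open>X - \<Delta>\<close> and \<open>Y - \<Delta>\<close> through the identity turns out to
  coincide with a maximal irreducible subset of itself.\<close>

text \<open>Polynomials are treated as functions, so that ideals of vanishing functions,
  substitution and evaluation are immediate. The parameter \<open>K\<close> records which
  coordinates may occur, which is what elimination of variables acts on.\<close>

inductive_set polyfun :: "'n set \<Rightarrow> (complex^'n \<Rightarrow> complex) set" for K where
  const: "(\<lambda>_. c) \<in> polyfun K"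
| coord: "k \<in> K \<Longrightarrow> (\<lambda>x. x $ k) \<in> polyfun K"
| add: "f \<in> polyfun K \<Longrightarrow> g \<in> polyfun K \<Longrightarrow> f + g \<in> polyfun K"
| mult: "f \<in> polyfun K \<Longrightarrow> g \<in> polyfun K \<Longrightarrow> f * g \<in> polyfun K"

lemma fun_power_apply: "(f ^ n) x = f x ^ n" for f :: "'a \<Rightarrow> 'b::comm_ring_1"
  by (induction n) simp_all

lemma polyfun_mono: "f \<in> polyfun K \<Longrightarrow> K \<subseteq> L \<Longrightarrow> f \<in> polyfun L"
  by (induction rule: polyfun.induct) (auto intro: polyfun.intros)

lemma polyfun_UNIV: "f \<in> polyfun K \<Longrightarrow> f \<in> polyfun UNIV"
  by (rule polyfun_mono) auto

lemma polyfun_0: "0 \<in> polyfun K" and polyfun_1: "1 \<in> polyfun K"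
  using polyfun.const[of 0 K] polyfun.const[of 1 K] by (simp_all add: zero_fun_def one_fun_def)

lemma polyfun_uminus: "f \<in> polyfun K \<Longrightarrow> - f \<in> polyfun K"
  using polyfun.mult[OF polyfun.const[of "-1"], of f K] by (simp add: times_fun_def fun_Compl_def)

lemma polyfun_diff: "f \<in> polyfun K \<Longrightarrow> g \<in> polyfun K \<Longrightarrow> f - g \<in> polyfun K"
  using polyfun.add[OF _ polyfun_uminus, of f K g] by simp

lemma polyfun_power: "f \<in> polyfun K \<Longrightarrow> f ^ n \<in> polyfun K"
  by (induction n) (auto intro: polyfun.mult polyfun_1)

lemma polyfun_sum: "(\<And>i. i \<in> I \<Longrightarrow> f i \<in> polyfun K) \<Longrightarrow> sum f I \<in> polyfun K"
  by (induction I rule: infinite_finite_induct) (auto intro: polyfun.add polyfun_0)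

lemma polyfun_prod: "(\<And>i. i \<in> I \<Longrightarrow> f i \<in> polyfun K) \<Longrightarrow> prod f I \<in> polyfun K"
  by (induction I rule: infinite_finite_induct) (auto intro: polyfun.mult polyfun_1)

lemmas polyfun_intros = polyfun.intros polyfun_0 polyfun_1 polyfun_uminus polyfun_diff
  polyfun_power polyfun_sum polyfun_prod

lemma polyfun_cong:
  assumes "f \<in> polyfun K" "\<And>k. k \<in> K \<Longrightarrow> v $ k = w $ k"
  shows "f v = f w"
  using assms by (induction rule: polyfun.induct) auto

lemma polyfun_empty:
  assumes "f \<in> polyfun {}"
  shows "\<exists>c. f = (\<lambda>_. c)"
  using polyfun_cong[OF assms, of _ undefined] by auto

lemma polyfun_subst:
  assumes "f \<in> polyfun K"
  shows "(\<lambda>x. f (\<chi> i. if i = j then c else x $ i)) \<in> polyfun (K - {j})"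
  using assms
proof (induction rule: polyfun.induct)
  case (coord k)
  thus ?case by (cases "k = j") (auto intro: polyfun.intros)
next
  case (add f g)
  show ?case using polyfun.add[OF add(3,4)] by (simp add: plus_fun_def)
next
  case (mult f g)
  show ?case using polyfun.mult[OF mult(3,4)] by (simp add: times_fun_def)
qed (auto intro: polyfun.intros)

lemma polyfun_on_line:
  assumes "f \<in> polyfun K"
  shows "\<exists>p. \<forall>t. f (a + t *s b) = poly p t"
  using assms
proof (induction rule: polyfun.induct)
  case (const c)
  thus ?case by (intro exI[of _ "[:c:]"]) simp
next
  case (coord k)
  thus ?case by (intro exI[of _ "[:a $ k, b $ k:]"]) simp
next
  case (add f g)
  then obtain p q where "\<forall>t. f (a + t *s b) = poly p t" "\<forall>t. g (a + t *s b) = poly q t" by blast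
  thus ?case by (intro exI[of _ "p + q"]) simp
next
  case (mult f g)
  then obtain p q where "\<forall>t. f (a + t *s b) = poly p t" "\<forall>t. g (a + t *s b) = poly q t" by blast
  thus ?case by (intro exI[of _ "p * q"]) simp
qed

text \<open>On the line through \<open>v\<close> and \<open>w\<close> both functions become nonzero
  univariate polynomials, whose product has only finitely many roots. This is the statement that
  polynomial functions form an integral domain.\<close>

lemma polyfun_domain:
  assumes "f \<in> polyfun UNIV" "g \<in> polyfun UNIV" "f v \<noteq> 0" "g w \<noteq> 0"
  obtains x where "f x \<noteq> 0" "g x \<noteq> 0"
proof -
  obtain p where p: "\<And>t. f (v + t *s (w - v)) = poly p t" using polyfun_on_line[OF assms(1)] by blast
  obtain q where q: "\<And>t. g (v + t *s (w - v)) = poly q t" using polyfun_on_line[OF assms(2)] by blast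
  have "poly p 0 \<noteq> 0" "poly q 1 \<noteq> 0" using p[of 0] q[of 1] assms by auto
  hence "p * q \<noteq> 0" by auto
  hence "finite {t. poly (p * q) t = 0}" by (rule poly_roots_finite)
  then obtain t where "poly (p * q) t \<noteq> 0"
    using infinite_UNIV_char_0[where 'a = complex] by (metis (mono_tags) UNIV_I ex_new_if_finite mem_Collect_eq)
  thus ?thesis using that[of "v + t *s (w - v)"] p q by auto
qed

text \<open>Used in two ways: with \<open>polyfun K\<close> it gives the polynomials in one further
  variable over the coordinates in \<open>K\<close>, with a prime ideal \<open>P\<close> it gives
  the polynomials that are zero modulo \<open>P\<close>.\<close>

definition coeffs_in :: "'a::zero set \<Rightarrow> 'a poly set"
  where "coeffs_in A = {p. \<forall>i. coeff p i \<in> A}"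

lemma poly_fun_apply: "poly p g v = poly (map_poly (\<lambda>q. q v) p) (g v)"
  for p :: "('a \<Rightarrow> 'b::comm_ring_1) poly"
  by (induction p) (auto simp: map_poly_pCons)

lemma coeffs_in_polyfun:
  shows coeffs_in_add: "p \<in> coeffs_in (polyfun K) \<Longrightarrow> q \<in> coeffs_in (polyfun K) \<Longrightarrow> p + q \<in> coeffs_in (polyfun K)"
    and coeffs_in_diff: "p \<in> coeffs_in (polyfun K) \<Longrightarrow> q \<in> coeffs_in (polyfun K) \<Longrightarrow> p - q \<in> coeffs_in (polyfun K)"
    and coeffs_in_mult: "p \<in> coeffs_in (polyfun K) \<Longrightarrow> q \<in> coeffs_in (polyfun K) \<Longrightarrow> p * q \<in> coeffs_in (polyfun K)"
    and coeffs_in_monom: "a \<in> polyfun K \<Longrightarrow> monom a n \<in> coeffs_in (polyfun K)"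
    and coeffs_in_const: "a \<in> polyfun K \<Longrightarrow> [:a:] \<in> coeffs_in (polyfun K)"
    and coeffs_in_smult: "a \<in> polyfun K \<Longrightarrow> p \<in> coeffs_in (polyfun K) \<Longrightarrow> smult a p \<in> coeffs_in (polyfun K)"
    and coeffs_in_0: "0 \<in> coeffs_in (polyfun K)"
  by (auto simp: coeffs_in_def coeff_mult coeff_monom coeff_pCons intro!: polyfun_intros split: nat.splits)

lemma polyfun_poly:
  assumes "p \<in> coeffs_in (polyfun K)" "g \<in> polyfun L" "K \<subseteq> L"
  shows "poly p g \<in> polyfun L"
  unfolding poly_altdef using assms polyfun_mono[OF _ assms(3)]
  by (intro polyfun_intros) (auto simp: coeffs_in_def)

lemma polyfun_insert_poly:
  assumes "f \<in> polyfun (insert k K)"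
  shows "\<exists>p\<in>coeffs_in (polyfun K). f = poly p (\<lambda>x. x $ k)"
  using assms
proof (induction rule: polyfun.induct)
  case (const c)
  show ?case by (rule bexI[of _ "[:\<lambda>_. c:]"]) (auto intro: coeffs_in_const polyfun.const)
next
  case (coord l)
  show ?case
  proof (cases "l = k")
    case True
    have "(\<lambda>x. x $ l) = poly (monom 1 1) (\<lambda>x :: complex^'a. x $ k)"
      using True by (simp add: poly_monom)
    thus ?thesis using coeffs_in_monom[OF polyfun_1] by blast
  next
    case False
    thus ?thesis using coord
      by (intro bexI[of _ "[:\<lambda>x. x $ l:]"]) (auto intro: coeffs_in_const polyfun.coord)
  qed
next
  case (add f g)
  then obtain p q where "p \<in> coeffs_in (polyfun K)" "q \<in> coeffs_in (polyfun K)"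
    "f = poly p (\<lambda>x. x $ k)" "g = poly q (\<lambda>x. x $ k)" by blast
  thus ?case by (intro bexI[of _ "p + q"] coeffs_in_add) (simp_all only: poly_add)
next
  case (mult f g)
  then obtain p q where "p \<in> coeffs_in (polyfun K)" "q \<in> coeffs_in (polyfun K)"
    "f = poly p (\<lambda>x. x $ k)" "g = poly q (\<lambda>x. x $ k)" by blast
  thus ?case by (intro bexI[of _ "p * q"] coeffs_in_mult) (simp_all only: poly_mult)
qed

text \<open>The coefficients do not see coordinate \<open>k\<close>, so moving only that coordinate
  turns \<open>p\<close> into an ordinary complex polynomial in \<open>t\<close>, to which facts
  about roots apply.\<close>

lemma poly_coord_upd:
  assumes "p \<in> coeffs_in (polyfun K)" "k \<notin> K"
  shows "poly p (\<lambda>x. x $ k) (\<chi> i. if i = k then t else v $ i) = poly (map_poly (\<lambda>q. q v) p) t"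
proof -
  let ?w = "\<chi> i. if i = k then t else v $ i"
  have "coeff p i ?w = coeff p i v" for i
    using assms by (intro polyfun_cong[where f = "coeff p i" and K = K]) (auto simp: coeffs_in_def)
  hence "map_poly (\<lambda>q. q ?w) p = map_poly (\<lambda>q. q v) p"
    by (intro poly_eqI) (simp add: coeff_map_poly)
  thus ?thesis by (simp add: poly_fun_apply)
qed

section \<open>Prime ideals of polynomial functions and division modulo them\<close>

locale prime_fun_ideal =
  fixes P :: "(complex^'n::finite \<Rightarrow> complex) set"
  assumes sub: "P \<subseteq> polyfun UNIV"
    and zero: "0 \<in> P"
    and add: "f \<in> P \<Longrightarrow> g \<in> P \<Longrightarrow> f + g \<in> P"
    and mult: "f \<in> P \<Longrightarrow> g \<in> polyfun UNIV \<Longrightarrow> g * f \<in> P"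
    and one: "1 \<notin> P"
    and prime: "f \<in> polyfun UNIV \<Longrightarrow> g \<in> polyfun UNIV \<Longrightarrow> f * g \<in> P \<Longrightarrow> f \<in> P \<or> g \<in> P"
begin

lemma mult': "f \<in> P \<Longrightarrow> g \<in> polyfun UNIV \<Longrightarrow> f * g \<in> P"
  using mult by (simp add: mult.commute)

lemma uminus: "f \<in> P \<Longrightarrow> - f \<in> P"
  using mult[of f "-1"] by (simp add: polyfun_intros)

lemma diff: "f \<in> P \<Longrightarrow> g \<in> P \<Longrightarrow> f - g \<in> P"
  using add[OF _ uminus, of f g] by simp

lemma sum: "(\<And>i. i \<in> I \<Longrightarrow> f i \<in> P) \<Longrightarrow> sum f I \<in> P"
  by (induction I rule: infinite_finite_induct) (auto intro: add zero)

lemma power_notin: "f \<in> polyfun UNIV \<Longrightarrow> f \<notin> P \<Longrightarrow> f ^ n \<notin> P"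
  by (induction n) (auto simp: one dest: prime[OF _ polyfun_power])

lemma prod_notin: "(\<And>i. i \<in> I \<Longrightarrow> f i \<in> polyfun UNIV) \<Longrightarrow> (\<And>i. i \<in> I \<Longrightarrow> f i \<notin> P) \<Longrightarrow> prod f I \<notin> P"
proof (induction I rule: infinite_finite_induct)
  case (insert i I)
  hence "f i \<notin> P" "prod f I \<notin> P" "f i \<in> polyfun UNIV" "prod f I \<in> polyfun UNIV"
    by (auto intro: polyfun_prod)
  hence "f i * prod f I \<notin> P" using prime by blast
  thus ?case by (simp only: prod.insert[OF insert.hyps] not_False_eq_True)
qed (auto simp: one)

lemma const_notin:
  assumes "c \<noteq> 0"
  shows "(\<lambda>_. c) \<notin> P"
proof
  assume "(\<lambda>_. c) \<in> P"
  hence "(\<lambda>_. inverse c) * (\<lambda>_. c) \<in> P" by (rule mult) (rule polyfun.const)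
  moreover have "(\<lambda>_. inverse c) * (\<lambda>_. c) = (1 :: complex^'n \<Rightarrow> complex)"
    using assms by (simp add: fun_eq_iff)
  ultimately show False using one by simp
qed

abbreviation null where "null \<equiv> coeffs_in P"

lemma null_add: "p \<in> null \<Longrightarrow> q \<in> null \<Longrightarrow> p + q \<in> null"
  and null_diff: "p \<in> null \<Longrightarrow> q \<in> null \<Longrightarrow> p - q \<in> null"
  and null_mult: "p \<in> null \<Longrightarrow> q \<in> coeffs_in (polyfun UNIV) \<Longrightarrow> q * p \<in> null"
  and null_monom: "a \<in> P \<Longrightarrow> monom a n \<in> null"
  and null_0: "0 \<in> null"
  by (auto simp: coeffs_in_def coeff_mult coeff_monom add zero diff intro!: sum mult)

lemma poly_null: "p \<in> null \<Longrightarrow> g \<in> polyfun UNIV \<Longrightarrow> poly p g \<in> P"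
  unfolding poly_altdef by (intro sum mult') (auto simp: coeffs_in_def intro: polyfun_power)

lemma coeffs_in_UNIV: "p \<in> coeffs_in (polyfun K) \<Longrightarrow> p \<in> coeffs_in (polyfun UNIV)"
  by (auto simp: coeffs_in_def intro: polyfun_UNIV)

text \<open>Modulo \<open>P\<close> the degree may be smaller than the formal degree. Leading terms
  with coefficient in \<open>P\<close> are moved to \<open>r\<close> one by one; this stops because
  \<open>p\<close> has some coefficient outside \<open>P\<close>.\<close>

lemma strip_null:
  assumes "p \<in> coeffs_in (polyfun K)" "p \<notin> null"
  obtains q r where "p = q + r" "q \<in> coeffs_in (polyfun K)" "r \<in> coeffs_in (polyfun K)" "r \<in> null"
    "lead_coeff q \<notin> P" "degree q \<le> degree p"
proof -
  have "\<exists>q r. p = q + r \<and> q \<in> coeffs_in (polyfun K) \<and> r \<in> coeffs_in (polyfun K) \<and> r \<in> null \<and>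
    lead_coeff q \<notin> P \<and> degree q \<le> degree p"
    using assms
  proof (induction "degree p" arbitrary: p rule: less_induct)
    case less
    show ?case
    proof (cases "lead_coeff p \<in> P")
      case False
      thus ?thesis using less.prems by (intro exI[of _ p] exI[of _ 0]) (auto simp: null_0 coeffs_in_0)
    next
      case True
      let ?m = "monom (lead_coeff p) (degree p)"
      have m: "?m \<in> null" "?m \<in> coeffs_in (polyfun K)"
        using True less.prems null_monom[OF True] coeffs_in_monom[of "lead_coeff p" K]
        by (auto simp: coeffs_in_def)
      have p': "p - ?m \<notin> null" "p - ?m \<in> coeffs_in (polyfun K)"
        using less.prems m null_add[of "p - ?m" ?m] by (auto intro: coeffs_in_diff)
      have "degree (p - ?m) \<le> degree p" by (intro degree_diff_le) (auto intro: degree_monom_le)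
      moreover have "coeff (p - ?m) (degree p) = 0" by simp
      moreover have "p - ?m \<noteq> 0" using p'(1) null_0 by metis
      ultimately have deg: "degree (p - ?m) < degree p"
        using leading_coeff_0_iff[of "p - ?m"] by (metis le_neq_implies_less)
      obtain q r where "p - ?m = q + r" "q \<in> coeffs_in (polyfun K)" "r \<in> coeffs_in (polyfun K)" "r \<in> null"
        "lead_coeff q \<notin> P" "degree q \<le> degree (p - ?m)"
        using less.hyps[OF deg p'(2,1)] by blast
      thus ?thesis using deg m
        by (intro exI[of _ q] exI[of _ "r + ?m"]) (auto simp: algebra_simps intro: null_add coeffs_in_add)
    qed
  qed
  thus ?thesis using that by blast
qed

text \<open>Over the fraction field of the coefficients modulo \<open>P\<close>, the ideal
  \<open>Q\<close> would be principal. Denominators are avoided by multiplying with powers of the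
  leading coefficient of the generator \<open>g\<close>, an element of least degree among those that
  are nonzero modulo \<open>P\<close>.\<close>

lemma pseudo_division:
  assumes Q: "Q \<subseteq> coeffs_in (polyfun K)"
    and Q_diff: "\<And>p q. p \<in> Q \<Longrightarrow> q \<in> Q \<Longrightarrow> p - q \<in> Q"
    and Q_mult: "\<And>p q. p \<in> Q \<Longrightarrow> q \<in> coeffs_in (polyfun K) \<Longrightarrow> q * p \<in> Q"
    and Q_null: "\<And>p. p \<in> coeffs_in (polyfun K) \<Longrightarrow> p \<in> null \<Longrightarrow> p \<in> Q"
    and ex: "\<exists>p\<in>Q. p \<notin> null"
  obtains g where "g \<in> Q" "lead_coeff g \<notin> P" "\<And>p. p \<in> Q \<Longrightarrow> degree p < degree g \<Longrightarrow> p \<in> null"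
    "\<And>p. p \<in> Q \<Longrightarrow> \<exists>N. \<exists>s\<in>coeffs_in (polyfun K). smult (lead_coeff g ^ N) p - g * s \<in> null"
proof -
  define e where "e = (LEAST e. \<exists>p\<in>Q. p \<notin> null \<and> degree p = e)"
  have "\<exists>e. \<exists>p\<in>Q. p \<notin> null \<and> degree p = e" using ex by blast
  from LeastI_ex[OF this] obtain p where p: "p \<in> Q" "p \<notin> null" "degree p = e"
    by (auto simp: e_def)
  have min: "p \<in> null" if "p \<in> Q" "degree p < e" for p
    using not_less_Least[of "degree p" "\<lambda>e. \<exists>p\<in>Q. p \<notin> null \<and> degree p = e"] that unfolding e_def by blast
  obtain g r where gr: "p = g + r" "g \<in> coeffs_in (polyfun K)" "r \<in> coeffs_in (polyfun K)" "r \<in> null"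
    "lead_coeff g \<notin> P" "degree g \<le> degree p"
    using strip_null[of p K] p Q by blast
  have gQ: "g \<in> Q" using Q_diff[OF p(1) Q_null[OF gr(3,4)]] gr(1) by simp
  have "g \<notin> null" using gr(5) by (auto simp: coeffs_in_def)
  hence deg: "degree g = e" using min[OF gQ] gr(6) p(3) by linarith
  have lc: "lead_coeff g \<in> polyfun K" using gr(2) by (simp add: coeffs_in_def)
  have "\<exists>N. \<exists>s\<in>coeffs_in (polyfun K). smult (lead_coeff g ^ N) p - g * s \<in> null" if "p \<in> Q" for p
    using that
  proof (induction "degree p" arbitrary: p rule: less_induct)
    case less
    show ?case
    proof (cases "degree p < e")
      case True
      thus ?thesis using min less.prems by (intro exI[of _ 0] bexI[of _ 0]) (auto intro: coeffs_in_0)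
    next
      case False
      let ?m = "monom (lead_coeff p) (degree p - e)"
      \<comment> \<open>One step of long division: both terms have the same coefficient at
        \<open>degree p\<close>, so it cancels and the induction hypothesis applies.\<close>
      let ?q = "smult (lead_coeff g) p - ?m * g"
      have m: "?m \<in> coeffs_in (polyfun K)"
        using less.prems Q by (intro coeffs_in_monom) (auto simp: coeffs_in_def)
      have "[:lead_coeff g:] * p \<in> Q" by (intro Q_mult less.prems coeffs_in_const lc)
      hence qQ: "?q \<in> Q" using Q_diff Q_mult[OF gQ m] by simp
      have "degree (?m * g) \<le> degree p"
        using degree_mult_le[of ?m g] degree_monom_le[of "lead_coeff p" "degree p - e"] deg False by linarith
      hence dle: "degree ?q \<le> degree p" by (intro degree_diff_le) (auto intro: degree_smult_le)
      have "coeff (?m * g) (degree p) = lead_coeff p * lead_coeff g"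
        using coeff_monom_mult[of "lead_coeff p" "degree p - e" g "degree p"] deg False by simp
      hence c0: "coeff ?q (degree p) = 0" by (simp add: mult.commute)
      have "\<exists>N. \<exists>s\<in>coeffs_in (polyfun K). smult (lead_coeff g ^ N) ?q - g * s \<in> null"
      proof (cases "?q = 0")
        case True
        thus ?thesis unfolding True by (intro exI[of _ 0] bexI[of _ 0]) (auto intro: coeffs_in_0 null_0)
      next
        case False
        hence "degree ?q < degree p" using dle c0 leading_coeff_0_iff[of ?q] by (metis le_neq_implies_less)
        thus ?thesis by (rule less.hyps[OF _ qQ])
      qed
      then obtain N s where s: "s \<in> coeffs_in (polyfun K)" "smult (lead_coeff g ^ N) ?q - g * s \<in> null" by blast
      have "smult (lead_coeff g ^ Suc N) p - g * (smult (lead_coeff g ^ N) ?m + s) = smult (lead_coeff g ^ N) ?q - g * s"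
        by (simp add: algebra_simps smult_diff_right)
      thus ?thesis using s m lc
        by (intro exI[of _ "Suc N"] bexI[of _ "smult (lead_coeff g ^ N) ?m + s"])
           (auto intro!: coeffs_in_add coeffs_in_smult polyfun_power)
    qed
  qed
  thus ?thesis using that[OF gQ gr(5)] min deg by blast
qed

end

context prime_fun_ideal
begin

text \<open>One variable of a Chevalley argument. If \<open>x_k\<close> is transcendental over
  \<open>K\<close> modulo \<open>P\<close>, almost every value of coordinate \<open>k\<close> works
  as soon as one coefficient of \<open>b\<close> is nonzero at \<open>v\<close>. If it is algebraic,
  coordinate \<open>k\<close> must be a root of a minimal polynomial \<open>p\<close>, and
  \<open>b\<close> is nonzero there because \<open>b\<close> and \<open>p\<close> generate an
  element free of \<open>x_k\<close>.\<close>

lemma lift_point_step: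
  assumes k: "k \<notin> K" and b: "b \<in> polyfun (insert k K)" "b \<notin> P"
  obtains b' where "b' \<in> polyfun K" "b' \<notin> P"
    "\<And>v. b' v \<noteq> 0 \<Longrightarrow> (\<forall>f\<in>P \<inter> polyfun K. f v = 0) \<Longrightarrow>
      \<exists>w. (\<forall>j\<in>K. w $ j = v $ j) \<and> (\<forall>f\<in>P \<inter> polyfun (insert k K). f w = 0) \<and> b w \<noteq> 0"
proof -
  define X :: "complex^'n \<Rightarrow> complex" where "X = (\<lambda>x. x $ k)"
  have X: "X \<in> polyfun (insert k K)" unfolding X_def by (rule polyfun.coord) simp
  have XU: "X \<in> polyfun UNIV" using X by (rule polyfun_UNIV)
  have ev: "poly p X \<in> polyfun UNIV" if "p \<in> coeffs_in (polyfun K)" for p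
    using that XU by (rule polyfun_poly) simp
  define up :: "complex^'n \<Rightarrow> complex \<Rightarrow> complex^'n" where "up v t = (\<chi> i. if i = k then t else v $ i)" for v t
  have up_same: "f (up v t) = f v" if "f \<in> polyfun K" for f v t
    using k by (intro polyfun_cong[OF that]) (auto simp: up_def)
  have up_K: "\<forall>j\<in>K. up v t $ j = v $ j" for v t using k by (auto simp: up_def)
  have ev_up: "poly p X (up v t) = poly (map_poly (\<lambda>q. q v) p) t" if "p \<in> coeffs_in (polyfun K)" for p v t
    unfolding X_def up_def using that k by (rule poly_coord_upd)
  have null_up: "poly p X (up v t) = 0"
    if "p \<in> coeffs_in (polyfun K)" "p \<in> null" "\<forall>f\<in>P \<inter> polyfun K. f v = 0" for p v t
  proof -
    have "map_poly (\<lambda>q. q v) p = 0"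
      using that by (intro poly_eqI) (auto simp: coeff_map_poly coeffs_in_def)
    thus ?thesis by (simp add: ev_up that)
  qed
  \<comment> \<open>The polynomials over \<open>K\<close> that become zero modulo \<open>P\<close>
    when \<open>x_k\<close> is substituted. Whether all of them are trivial decides whether
    \<open>x_k\<close> is transcendental or algebraic over \<open>K\<close>.\<close>
  define I where "I = {p \<in> coeffs_in (polyfun K). poly p X \<in> P}"
  have I_null: "p \<in> I" if "p \<in> coeffs_in (polyfun K)" "p \<in> null" for p
    using that poly_null[OF that(2) XU] by (simp add: I_def)
  have I_ex: "\<exists>p\<in>I. poly p X = f" if "f \<in> P \<inter> polyfun (insert k K)" for f
    using polyfun_insert_poly[of f k K] that by (auto simp: I_def X_def)
  obtain bp where bp: "bp \<in> coeffs_in (polyfun K)" "poly bp X = b"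
    using polyfun_insert_poly[OF b(1)] by (auto simp: X_def)
  show ?thesis
  proof (cases "\<forall>p\<in>I. p \<in> null")
    case True
    have "bp \<notin> null" using poly_null[OF _ XU, of bp] bp b by auto
    then obtain i where i: "coeff bp i \<notin> P" by (auto simp: coeffs_in_def)
    have "\<exists>w. (\<forall>j\<in>K. w $ j = v $ j) \<and> (\<forall>f\<in>P \<inter> polyfun (insert k K). f w = 0) \<and> b w \<noteq> 0"
      if v: "coeff bp i v \<noteq> 0" "\<forall>f\<in>P \<inter> polyfun K. f v = 0" for v
    proof -
      have "map_poly (\<lambda>q. q v) bp \<noteq> 0"
        using v(1) by (metis coeff_map_poly coeff_0 zero_fun_apply)
      hence "finite {t. poly (map_poly (\<lambda>q. q v) bp) t = 0}" by (rule poly_roots_finite)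
      then obtain t where t: "poly (map_poly (\<lambda>q. q v) bp) t \<noteq> 0"
        using infinite_UNIV_char_0[where 'a = complex] by (metis (mono_tags) UNIV_I ex_new_if_finite mem_Collect_eq)
      have "f (up v t) = 0" if f: "f \<in> P \<inter> polyfun (insert k K)" for f
      proof -
        obtain p where p: "p \<in> I" "poly p X = f" using I_ex[OF f] by blast
        thus ?thesis using null_up[of p v t] True v(2) by (auto simp: I_def)
      qed
      moreover have "b (up v t) \<noteq> 0" using ev_up[OF bp(1), of v t] t bp(2) by simp
      ultimately show ?thesis using up_K by blast
    qed
    thus ?thesis using that[of "coeff bp i"] bp(1) i by (auto simp: coeffs_in_def)
  next
    case False
    have I_sub: "I \<subseteq> coeffs_in (polyfun K)" by (auto simp: I_def)
    have I_diff: "p - q \<in> I" if "p \<in> I" "q \<in> I" for p q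
      using that by (auto simp: I_def coeffs_in_diff diff)
    have I_mult: "q * p \<in> I" if "p \<in> I" "q \<in> coeffs_in (polyfun K)" for p q
      using that ev[of q] by (auto simp: I_def coeffs_in_mult intro: mult)
    \<comment> \<open>This \<open>p\<close> plays the role of the minimal polynomial of
      \<open>x_k\<close>, with leading coefficient invertible wherever it does not vanish.\<close>
    obtain p where p: "p \<in> I" "lead_coeff p \<notin> P"
      and p_min: "\<And>q. q \<in> I \<Longrightarrow> degree q < degree p \<Longrightarrow> q \<in> null"
      and p_div: "\<And>q. q \<in> I \<Longrightarrow> \<exists>N. \<exists>s\<in>coeffs_in (polyfun K). smult (lead_coeff p ^ N) q - p * s \<in> null"
      using pseudo_division[of I K] I_sub I_diff I_mult I_null False by blast
    have pK: "p \<in> coeffs_in (polyfun K)" using p I_sub by blast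
    have lcp: "lead_coeff p \<in> polyfun K" using pK by (simp add: coeffs_in_def)
    have degp: "degree p > 0"
    proof (rule ccontr)
      assume "\<not> degree p > 0"
      then obtain a where "p = [:a:]" by (metis degree_eq_zeroE gr0I)
      thus False using p by (auto simp: I_def)
    qed

    txt \<open>The ideal generated by \<open>bp\<close> and \<open>p\<close> modulo \<open>P\<close> contains an element of degree \<open>0\<close>, because
      \<open>p\<close> is irreducible modulo \<open>P\<close> up to leading coefficients and does not divide \<open>bp\<close>.\<close>

    define Q where "Q = {q. \<exists>u w r. u \<in> coeffs_in (polyfun K) \<and> w \<in> coeffs_in (polyfun K) \<and>
      r \<in> coeffs_in (polyfun K) \<and> r \<in> null \<and> q = u * bp + w * p + r}"
    have Q_I: "u * bp + w * p + r \<in> Q"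
      if "u \<in> coeffs_in (polyfun K)" "w \<in> coeffs_in (polyfun K)" "r \<in> coeffs_in (polyfun K)" "r \<in> null" for u w r
      using that by (auto simp: Q_def)
    have one: "1 \<in> coeffs_in (polyfun K)"
      using coeffs_in_const[OF polyfun_1] by (simp add: one_pCons)
    have "bp \<in> Q" using Q_I[of 1 0 0] one by (simp add: coeffs_in_0 null_0)
    have "p \<in> Q" using Q_I[of 0 1 0] one by (simp add: coeffs_in_0 null_0)
    have Q_sub: "Q \<subseteq> coeffs_in (polyfun K)"
      using bp(1) pK by (auto simp: Q_def intro!: coeffs_in_add coeffs_in_mult)
    have Q_diff: "f - g \<in> Q" if "f \<in> Q" "g \<in> Q" for f g
    proof -
      obtain u w r u' w' r' where *: "u \<in> coeffs_in (polyfun K)" "w \<in> coeffs_in (polyfun K)"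
        "r \<in> coeffs_in (polyfun K)" "r \<in> null" "f = u * bp + w * p + r"
        "u' \<in> coeffs_in (polyfun K)" "w' \<in> coeffs_in (polyfun K)"
        "r' \<in> coeffs_in (polyfun K)" "r' \<in> null" "g = u' * bp + w' * p + r'"
        using \<open>f \<in> Q\<close> \<open>g \<in> Q\<close> unfolding Q_def by blast
      have "f - g = (u - u') * bp + (w - w') * p + (r - r')" unfolding * by (simp add: algebra_simps)
      moreover have "(u - u') * bp + (w - w') * p + (r - r') \<in> Q"
        using * by (intro Q_I coeffs_in_diff null_diff)
      ultimately show ?thesis by simp
    qed
    have Q_mult: "g * f \<in> Q" if "f \<in> Q" "g \<in> coeffs_in (polyfun K)" for f g
    proof -
      obtain u w r where *: "u \<in> coeffs_in (polyfun K)" "w \<in> coeffs_in (polyfun K)"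
        "r \<in> coeffs_in (polyfun K)" "r \<in> null" "f = u * bp + w * p + r"
        using \<open>f \<in> Q\<close> unfolding Q_def by blast
      have "g * f = (g * u) * bp + (g * w) * p + g * r" unfolding * by (simp add: algebra_simps)
      moreover have "(g * u) * bp + (g * w) * p + g * r \<in> Q"
        using * that coeffs_in_UNIV[of g K] by (intro Q_I coeffs_in_mult null_mult)
      ultimately show ?thesis by simp
    qed
    have Q_null: "f \<in> Q" if "f \<in> coeffs_in (polyfun K)" "f \<in> null" for f
      using Q_I[of 0 0 f] that by (simp add: coeffs_in_0)
    have Q_ex: "\<exists>q\<in>Q. q \<notin> null" using \<open>p \<in> Q\<close> p(2) by (auto simp: coeffs_in_def)
    obtain q where q: "q \<in> Q" "lead_coeff q \<notin> P"
      and "\<And>f. f \<in> Q \<Longrightarrow> degree f < degree q \<Longrightarrow> f \<in> null"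
      and q_div: "\<And>f. f \<in> Q \<Longrightarrow> \<exists>N. \<exists>s\<in>coeffs_in (polyfun K). smult (lead_coeff q ^ N) f - q * s \<in> null"
      using pseudo_division[OF Q_sub Q_diff Q_mult Q_null Q_ex] by blast
    have qK: "q \<in> coeffs_in (polyfun K)" using q Q_sub by blast
    have lcq: "lead_coeff q \<in> polyfun K" using qK by (simp add: coeffs_in_def)
    have qpow: "lead_coeff q ^ N \<in> polyfun UNIV" "lead_coeff q ^ N \<notin> P" for N
      using polyfun_UNIV[OF lcq] q(2) by (auto intro: polyfun_power dest: power_notin)
    have "degree q = 0"
    proof (rule ccontr)
      assume dq: "degree q \<noteq> 0"
      obtain N s where s: "s \<in> coeffs_in (polyfun K)" "smult (lead_coeff q ^ N) p - q * s \<in> null"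
        using q_div[OF \<open>p \<in> Q\<close>] by blast
      obtain M s' where s': "s' \<in> coeffs_in (polyfun K)" "smult (lead_coeff q ^ M) bp - q * s' \<in> null"
        using q_div[OF \<open>bp \<in> Q\<close>] by blast
      \<comment> \<open>\<open>q\<close> divides \<open>bp\<close> modulo \<open>P\<close> up to a
        power of its leading coefficient, so \<open>q\<close> vanishing at \<open>x_k\<close> would
        force \<open>b\<close> into \<open>P\<close>.\<close>
      have "poly q X \<notin> P"
      proof
        assume "poly q X \<in> P"
        hence "poly q X * poly s' X \<in> P" using ev[OF s'(1)] by (rule mult')
        moreover have "lead_coeff q ^ M * b - poly q X * poly s' X \<in> P"
          using poly_null[OF s'(2) XU] by (simp add: bp(2))
        ultimately have "lead_coeff q ^ M * b \<in> P" using add by (metis diff_add_cancel)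
        thus False using prime qpow b polyfun_UNIV by blast
      qed
      have "s \<notin> null"
      proof
        assume "s \<in> null"
        hence "q * s \<in> null" using coeffs_in_UNIV[OF qK] by (rule null_mult)
        hence "smult (lead_coeff q ^ N) p \<in> null" using null_add[OF s(2)] by fastforce
        hence "lead_coeff q ^ N * lead_coeff p \<in> P" by (auto simp: coeffs_in_def)
        thus False using prime qpow p(2) polyfun_UNIV[OF lcp] by blast
      qed
      then obtain s1 r where s1: "s = s1 + r" "s1 \<in> coeffs_in (polyfun K)" "r \<in> coeffs_in (polyfun K)" "r \<in> null"
        "lead_coeff s1 \<notin> P" using strip_null[OF s(1)] by metis
      have "q * r \<in> null" using s1(4) coeffs_in_UNIV[OF qK] by (rule null_mult)
      from null_add[OF s(2) this] have n: "smult (lead_coeff q ^ N) p - q * s1 \<in> null"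
        by (simp add: s1(1) algebra_simps)
      \<comment> \<open>The leading coefficient of \<open>q * s1\<close> survives modulo
        \<open>P\<close>, so \<open>p\<close> has a nonzero coefficient in that degree. As
        \<open>q\<close> is not of degree \<open>0\<close>, the cofactor \<open>s1\<close> has
        smaller degree than \<open>p\<close>; primality puts it in \<open>I\<close>, contradicting
        the minimality of \<open>p\<close>.\<close>
      have "lead_coeff q * lead_coeff s1 \<notin> P"
        using prime[of "lead_coeff q" "lead_coeff s1"] q(2) s1(2,5) polyfun_UNIV lcq by (auto simp: coeffs_in_def)
      moreover have "lead_coeff q ^ N * coeff p (degree q + degree s1) - lead_coeff q * lead_coeff s1 \<in> P"
        using n by (auto simp: coeffs_in_def coeff_mult_degree_sum dest!: spec[of _ "degree q + degree s1"])
      ultimately have "coeff p (degree q + degree s1) \<noteq> 0" using uminus by fastforce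
      hence "degree q + degree s1 \<le> degree p" by (rule le_degree)
      hence "degree s1 < degree p" using dq by simp
      moreover have "s1 \<in> I"
      proof -
        have "poly p X \<in> P" using p(1) by (simp add: I_def)
        hence "lead_coeff q ^ N * poly p X \<in> P" using qpow(1) by (rule mult)
        moreover have "lead_coeff q ^ N * poly p X - poly q X * poly s1 X \<in> P"
          using poly_null[OF n XU] by simp
        ultimately have "poly q X * poly s1 X \<in> P" using diff by fastforce
        thus ?thesis using prime[OF ev[OF qK] ev[OF s1(2)]] \<open>poly q X \<notin> P\<close> s1(2) by (auto simp: I_def)
      qed
      ultimately have "s1 \<in> null" by (rule p_min[rotated])
      thus False using s1(5) by (auto simp: coeffs_in_def)
    qed
    then obtain a where a: "q = [:a:]" by (rule degree_eq_zeroE)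
    have aK: "a \<in> polyfun K" "a \<notin> P" using lcq q(2) a by auto
    obtain u w r where uwr: "u \<in> coeffs_in (polyfun K)" "w \<in> coeffs_in (polyfun K)"
        "r \<in> coeffs_in (polyfun K)" "r \<in> null" "q = u * bp + w * p + r"
      using q(1) by (auto simp: Q_def)
    have eq: "a = poly u X * b + poly w X * poly p X + poly r X"
      using arg_cong[OF uwr(5), of "\<lambda>q. poly q X"] a bp(2) by simp
    have "\<exists>x. (\<forall>j\<in>K. x $ j = v $ j) \<and> (\<forall>f\<in>P \<inter> polyfun (insert k K). f x = 0) \<and> b x \<noteq> 0"
      if v: "(lead_coeff p * a) v \<noteq> 0" "\<forall>f\<in>P \<inter> polyfun K. f v = 0" for v
    proof -
      let ?p = "map_poly (\<lambda>q. q v) p"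
      \<comment> \<open>The leading coefficient is nonzero at \<open>v\<close>, so specialisation
        keeps the degree and a complex root exists.\<close>
      have "degree ?p = degree p" using v(1) by (intro map_poly_degree_eq) auto
      hence "\<not> constant (poly ?p)" using degp by (simp add: constant_degree)
      then obtain t where t: "poly ?p t = 0" using fundamental_theorem_of_algebra by blast
      hence p0: "poly p X (up v t) = 0" using ev_up[OF pK] by simp
      have "f (up v t) = 0" if f: "f \<in> P \<inter> polyfun (insert k K)" for f
      proof -
        obtain g where g: "g \<in> I" "poly g X = f" using I_ex[OF f] by blast
        \<comment> \<open>A power of the leading coefficient times \<open>g\<close> is a multiple of
          \<open>p\<close> up to terms vanishing at \<open>v\<close>, so the root of
          \<open>p\<close> is also a zero of \<open>f\<close>.\<close>
        then obtain N s where s: "s \<in> coeffs_in (polyfun K)" "smult (lead_coeff p ^ N) g - p * s \<in> null"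
          using p_div by blast
        have "smult (lead_coeff p ^ N) g - p * s \<in> coeffs_in (polyfun K)"
          using s g pK lcp I_sub by (intro coeffs_in_diff coeffs_in_mult coeffs_in_smult polyfun_power) auto
        from null_up[OF this s(2) v(2), of t] have "lead_coeff p (up v t) ^ N * f (up v t) = 0"
          using p0 g(2) by (simp add: fun_power_apply)
        thus ?thesis using v(1) up_same[OF lcp, of v t] by simp
      qed
      \<comment> \<open>In the identity for \<open>a\<close> the terms with \<open>p\<close> and
        \<open>r\<close> vanish at this point, so \<open>b\<close> vanishing there would make
        \<open>a\<close> vanish, and \<open>a\<close> has the same value as at
        \<open>v\<close>.\<close>
      moreover have "b (up v t) \<noteq> 0"
      proof
        assume "b (up v t) = 0"
        hence "a (up v t) = 0"
          using null_up[OF uwr(3,4) v(2), of t] p0 by (subst eq) simp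
        thus False using v(1) up_same[OF aK(1), of v t] by simp
      qed
      ultimately show ?thesis using up_K by blast
    qed
    moreover have "lead_coeff p * a \<in> polyfun K" using lcp aK by (intro polyfun.mult)
    moreover have "lead_coeff p * a \<notin> P"
      using prime[of "lead_coeff p" a] p(2) aK polyfun_UNIV lcp by blast
    ultimately show ?thesis using that by blast
  qed
qed

end

section \<open>Generic lifting of points and chains of prime ideals\<close>

context prime_fun_ideal
begin

text \<open>Eliminates the variables in \<open>L\<close> one at a time: each step converts the
  condition \<open>b \<noteq> 0\<close> upstairs into a condition with one variable less. In
  geometric terms, the projection of the zeros of \<open>P\<close> with \<open>b \<noteq> 0\<close>
  contains a nonempty open part of its closure.\<close>

lemma lift_point:
  assumes "finite L" "b \<in> polyfun (J \<union> L)" "b \<notin> P"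
  shows "\<exists>g\<in>polyfun J - P. \<forall>v. g v \<noteq> 0 \<longrightarrow> (\<forall>f\<in>P \<inter> polyfun J. f v = 0) \<longrightarrow>
    (\<exists>w. (\<forall>j\<in>J. w $ j = v $ j) \<and> (\<forall>f\<in>P \<inter> polyfun (J \<union> L). f w = 0) \<and> b w \<noteq> 0)"
  using assms
proof (induction L arbitrary: b rule: finite_induct)
  case empty
  thus ?case by (intro bexI[of _ b]) auto
next
  case (insert k L)
  show ?case
  proof (cases "k \<in> J \<union> L")
    case True
    hence "J \<union> insert k L = J \<union> L" by blast
    thus ?thesis using insert.IH insert.prems by metis
  next
    case False
    have eq: "J \<union> insert k L = insert k (J \<union> L)" by blast
    obtain b' where b': "b' \<in> polyfun (J \<union> L)" "b' \<notin> P"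
      and lift: "\<And>v. b' v \<noteq> 0 \<Longrightarrow> (\<forall>f\<in>P \<inter> polyfun (J \<union> L). f v = 0) \<Longrightarrow>
      \<exists>w. (\<forall>j\<in>J \<union> L. w $ j = v $ j) \<and> (\<forall>f\<in>P \<inter> polyfun (insert k (J \<union> L)). f w = 0) \<and> b w \<noteq> 0"
      using lift_point_step[OF False] insert.prems unfolding eq by metis
    obtain g where g: "g \<in> polyfun J - P" "\<forall>v. g v \<noteq> 0 \<longrightarrow> (\<forall>f\<in>P \<inter> polyfun J. f v = 0) \<longrightarrow>
      (\<exists>w. (\<forall>j\<in>J. w $ j = v $ j) \<and> (\<forall>f\<in>P \<inter> polyfun (J \<union> L). f w = 0) \<and> b' w \<noteq> 0)"
      using insert.IH[OF b'] by blast
    have "\<exists>w. (\<forall>j\<in>J. w $ j = v $ j) \<and> (\<forall>f\<in>P \<inter> polyfun (insert k (J \<union> L)). f w = 0) \<and> b w \<noteq> 0"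
      if v: "g v \<noteq> 0" "\<forall>f\<in>P \<inter> polyfun J. f v = 0" for v
    proof -
      obtain w where w: "\<forall>j\<in>J. w $ j = v $ j" "\<forall>f\<in>P \<inter> polyfun (J \<union> L). f w = 0" "b' w \<noteq> 0"
        using g(2) v by blast
      obtain x where "\<forall>j\<in>J \<union> L. x $ j = w $ j" "\<forall>f\<in>P \<inter> polyfun (insert k (J \<union> L)). f x = 0" "b x \<noteq> 0"
        using lift[OF w(3,2)] by blast
      thus ?thesis using w(1) by (intro exI[of _ x]) auto
    qed
    thus ?thesis using g(1) unfolding eq by blast
  qed
qed

definition zeros :: "(complex^'n) set"
  where "zeros = {v. \<forall>f\<in>P. f v = 0}"

text \<open>The case \<open>J = {}\<close> of lifting: the condition to be met is then a nonzero
  constant, and constants in \<open>P\<close> are zero, so any starting point can be lifted.\<close>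

lemma nullstellensatz:
  assumes "b \<in> polyfun UNIV" "b \<notin> P"
  obtains v where "v \<in> zeros" "b v \<noteq> 0"
proof -
  obtain g where g: "g \<in> polyfun {}" "g \<notin> P"
    "\<And>v. g v \<noteq> 0 \<Longrightarrow> (\<forall>f\<in>P \<inter> polyfun {}. f v = 0) \<Longrightarrow> (\<exists>w. (\<forall>f\<in>P \<inter> polyfun UNIV. f w = 0) \<and> b w \<noteq> 0)"
    using lift_point[of UNIV b "{}"] assms by auto
  obtain c where c: "g = (\<lambda>_. c)" using polyfun_empty[OF g(1)] by blast
  have "f v = 0" if "f \<in> P \<inter> polyfun {}" for f v
    using that polyfun_empty[of f] const_notin by auto
  moreover have "g 0 \<noteq> 0" using g(2) zero c by (auto simp: zero_fun_def)
  ultimately obtain w where "\<forall>f\<in>P \<inter> polyfun UNIV. f w = 0" "b w \<noteq> 0" using g(3)[of 0] by blast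
  moreover from this sub have "w \<in> zeros" unfolding zeros_def by blast
  ultimately show ?thesis using that by blast
qed

definition alg_indep :: "'n set \<Rightarrow> bool"
  where "alg_indep J \<longleftrightarrow> P \<inter> polyfun J \<subseteq> {0}"

end

text \<open>An ideal that is maximal among those containing \<open>I\<close> and disjoint from a
  multiplicative set is prime: otherwise adjoining either factor would reach \<open>M\<close>, and
  the product of the two elements of \<open>M\<close> so obtained would lie in
  \<open>P\<close>.\<close>

lemma ex_prime_fun_ideal:
  fixes I M :: "(complex^'n::finite \<Rightarrow> complex) set"
  assumes I: "I \<subseteq> polyfun UNIV" "0 \<in> I"
    and I_add: "\<And>f g. f \<in> I \<Longrightarrow> g \<in> I \<Longrightarrow> f + g \<in> I"
    and I_mult: "\<And>f g. f \<in> I \<Longrightarrow> g \<in> polyfun UNIV \<Longrightarrow> g * f \<in> I"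
    and M: "1 \<in> M" "\<And>f g. f \<in> M \<Longrightarrow> g \<in> M \<Longrightarrow> f * g \<in> M" and IM: "I \<inter> M = {}"
  obtains P where "prime_fun_ideal P" "I \<subseteq> P" "P \<inter> M = {}"
proof -
  define ideals where "ideals = {A. I \<subseteq> A \<and> A \<subseteq> polyfun UNIV \<and> (\<forall>f\<in>A. \<forall>g\<in>A. f + g \<in> A) \<and>
    (\<forall>f\<in>A. \<forall>g\<in>polyfun UNIV. g * f \<in> A) \<and> A \<inter> M = {}}"
  have "\<exists>P\<in>ideals. \<forall>A\<in>ideals. P \<subseteq> A \<longrightarrow> A = P"
  proof (rule subset_Zorn_nonempty)
    have "I \<in> ideals" unfolding ideals_def using I I_add I_mult IM by blast
    thus "ideals \<noteq> {}" by blast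
    fix \<C> assume C: "\<C> \<noteq> {}" "subset.chain ideals \<C>"
    have "f + g \<in> \<Union>\<C>" if "f \<in> A" "g \<in> B" "A \<in> \<C>" "B \<in> \<C>" for f g A B
    proof -
      have "A \<subseteq> B \<or> B \<subseteq> A" using C that by (auto simp: subset_chain_def)
      hence "\<exists>D\<in>\<C>. f \<in> D \<and> g \<in> D" using that by blast
      then obtain D where "D \<in> \<C>" "f \<in> D" "g \<in> D" by blast
      moreover have "D \<in> ideals" using C \<open>D \<in> \<C>\<close> by (auto simp: subset_chain_def)
      hence "\<forall>f\<in>D. \<forall>g\<in>D. f + g \<in> D" unfolding ideals_def by blast
      ultimately show ?thesis by blast
    qed
    hence "\<forall>f\<in>\<Union>\<C>. \<forall>g\<in>\<Union>\<C>. f + g \<in> \<Union>\<C>" by blast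
    moreover have *: "I \<subseteq> A" "A \<subseteq> polyfun UNIV" "\<forall>f\<in>A. \<forall>g\<in>polyfun UNIV. g * f \<in> A" "A \<inter> M = {}"
      if "A \<in> \<C>" for A
    proof -
      have "A \<in> ideals" using C that by (auto simp: subset_chain_def)
      thus "I \<subseteq> A" "A \<subseteq> polyfun UNIV" "\<forall>f\<in>A. \<forall>g\<in>polyfun UNIV. g * f \<in> A" "A \<inter> M = {}"
        unfolding ideals_def by blast+
    qed
    moreover have "\<forall>f\<in>\<Union>\<C>. \<forall>g\<in>polyfun UNIV. g * f \<in> \<Union>\<C>" using *(3) by blast
    moreover have "I \<subseteq> \<Union>\<C>" using *(1) C(1) by blast
    moreover have "\<Union>\<C> \<subseteq> polyfun UNIV" using *(2) by blast
    moreover have "\<Union>\<C> \<inter> M = {}" using *(4) by blast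
    ultimately show "\<Union>\<C> \<in> ideals" unfolding ideals_def by blast
  qed
  then obtain P where P: "P \<in> ideals" and max: "\<And>A. A \<in> ideals \<Longrightarrow> P \<subseteq> A \<Longrightarrow> A = P" by blast
  have P_simps: "I \<subseteq> P" "P \<subseteq> polyfun UNIV" "P \<inter> M = {}" "0 \<in> P"
    and P_add: "\<And>f g. f \<in> P \<Longrightarrow> g \<in> P \<Longrightarrow> f + g \<in> P"
    and P_mult: "\<And>f g. f \<in> P \<Longrightarrow> g \<in> polyfun UNIV \<Longrightarrow> g * f \<in> P"
    using P I(2) unfolding ideals_def by blast+
  have ext: "\<exists>p\<in>P. \<exists>r\<in>polyfun UNIV. p + r * f \<in> M" if f: "f \<in> polyfun UNIV" "f \<notin> P" for f
  proof (rule ccontr)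
    assume *: "\<not> ?thesis"
    define A where "A = {p + r * f | p r. p \<in> P \<and> r \<in> polyfun UNIV}"
    have A_I: "p + r * f \<in> A" if "p \<in> P" "r \<in> polyfun UNIV" for p r using that by (auto simp: A_def)
    have "P \<subseteq> A" using A_I[OF _ polyfun_0] by fastforce
    moreover have "A \<subseteq> polyfun UNIV"
      using P_simps(2) f(1) unfolding A_def by (blast intro: polyfun.add polyfun.mult)
    moreover have "g + h \<in> A" if gh: "g \<in> A" "h \<in> A" for g h
    proof -
      obtain p r p' r' where "p \<in> P" "r \<in> polyfun UNIV" "g = p + r * f" "p' \<in> P" "r' \<in> polyfun UNIV" "h = p' + r' * f"
        using gh by (auto simp: A_def)
      moreover from this have "g + h = (p + p') + (r + r') * f" by (simp add: algebra_simps)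
      ultimately show ?thesis using A_I[of "p + p'" "r + r'"] P_add polyfun.add by metis
    qed
    moreover have "h * g \<in> A" if gh: "g \<in> A" "h \<in> polyfun UNIV" for g h
    proof -
      obtain p r where "p \<in> P" "r \<in> polyfun UNIV" "g = p + r * f"
        using gh by (auto simp: A_def)
      moreover from this have "h * g = h * p + (h * r) * f" by (simp add: algebra_simps)
      ultimately show ?thesis using A_I[of "h * p" "h * r"] P_mult polyfun.mult gh(2) by metis
    qed
    moreover have "A \<inter> M = {}" using * unfolding A_def by blast
    moreover have "I \<subseteq> A" using P_simps(1) \<open>P \<subseteq> A\<close> by blast
    ultimately have "A \<in> ideals" unfolding ideals_def by blast
    hence "A = P" using max \<open>P \<subseteq> A\<close> by blast
    moreover have "f \<in> A" using A_I[OF P_simps(4) polyfun_1] by simp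
    ultimately show False using f by blast
  qed
  have "prime_fun_ideal P"
  proof
    show "1 \<notin> P" using P_simps M by blast
    fix f g assume fg: "f \<in> polyfun UNIV" "g \<in> polyfun UNIV" "f * g \<in> P"
    show "f \<in> P \<or> g \<in> P"
    proof (rule ccontr)
      assume "\<not> ?thesis"
      then obtain p r p' r' where *: "p \<in> P" "r \<in> polyfun UNIV" "p + r * f \<in> M"
        "p' \<in> P" "r' \<in> polyfun UNIV" "p' + r' * g \<in> M" using ext fg by meson
      have "(p + r * f) * (p' + r' * g) = (p' + r' * g) * p + ((r * f) * p' + (r * r') * (f * g))"
        by (simp add: algebra_simps)
      moreover have "(p' + r' * g) * p \<in> P" "(r * f) * p' \<in> P" "(r * r') * (f * g) \<in> P"
        using * fg P_simps(2) by (blast intro: P_mult polyfun.add polyfun.mult)+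
      hence "(p' + r' * g) * p + ((r * f) * p' + (r * r') * (f * g)) \<in> P" by (intro P_add)
      ultimately show False using M(2)[OF *(3,6)] P_simps(3) by (metis disjoint_iff)
    qed
  qed (fact P_simps P_add P_mult)+
  thus ?thesis using that P_simps by blast
qed

context prime_fun_ideal
begin

text \<open>Cuts the zero set by a hyperplane \<open>x_j = c\<close> and takes a prime over the
  resulting ideal. For general \<open>c\<close> the fibre still projects densely to the coordinates
  in \<open>J - {j}\<close> and still meets \<open>b \<noteq> 0\<close>; both facts are encoded in a
  multiplicative set to be avoided. The prime grows while its zero set and the independent set
  shrink.\<close>

lemma ex_smaller_prime:
  assumes J: "alg_indep J" "j \<in> J" and b: "b \<in> polyfun UNIV" "b \<notin> P"
  obtains P' where "prime_fun_ideal P'" "P \<subset> P'" "prime_fun_ideal.alg_indep P' (J - {j})" "b \<notin> P'"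
proof -
  obtain g where g: "g \<in> polyfun J" "g \<notin> P"
    and lift: "\<And>v. g v \<noteq> 0 \<Longrightarrow> (\<forall>f\<in>P \<inter> polyfun J. f v = 0) \<Longrightarrow>
    (\<exists>w. (\<forall>j\<in>J. w $ j = v $ j) \<and> (\<forall>f\<in>P \<inter> polyfun UNIV. f w = 0) \<and> b w \<noteq> 0)"
    using lift_point[of UNIV b J] b by auto
  obtain v0 where v0: "g v0 \<noteq> 0" using g(2) zero by (metis ext zero_fun_apply)
  \<comment> \<open>Taken from a point where \<open>g\<close> is nonzero, so that \<open>g\<close>
    restricted to the hyperplane \<open>x_j = c\<close> is not identically zero.\<close>
  define c where "c = v0 $ j"
  define l :: "complex^'n \<Rightarrow> complex" where "l = (\<lambda>x. x $ j) - (\<lambda>_. c)"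
  have l: "l \<in> polyfun J" unfolding l_def using J(2) by (intro polyfun_diff polyfun.intros)
  have lU: "l \<in> polyfun UNIV" using l by (rule polyfun_UNIV)
  define I where "I = {p + r * l | p r. p \<in> P \<and> r \<in> polyfun UNIV}"
  \<comment> \<open>Avoiding \<open>M\<close> gives both remaining conclusions at once: the choice
    \<open>n = 0\<close> yields independence of \<open>J - {j}\<close>, and \<open>n = 1\<close>,
    \<open>f = 1\<close> excludes \<open>b\<close>.\<close>
  define M where "M = {b ^ n * f | n f. f \<in> polyfun (J - {j}) \<and> f \<noteq> 0}"
  have I_I: "p + r * l \<in> I" if "p \<in> P" "r \<in> polyfun UNIV" for p r using that by (auto simp: I_def)
  have M_I: "b ^ n * f \<in> M" if "f \<in> polyfun (J - {j})" "f \<noteq> 0" for n f using that by (auto simp: M_def)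
  define g' where "g' = (\<lambda>x. g (\<chi> i. if i = j then c else x $ i))"
  have g': "g' \<in> polyfun (J - {j})" unfolding g'_def by (rule polyfun_subst[OF g(1)])
  have "(\<chi> i. if i = j then c else v0 $ i) = v0" by (simp add: vec_eq_iff c_def)
  hence g'0: "g' v0 \<noteq> 0" using v0 by (simp add: g'_def)
  have IM: "I \<inter> M = {}"
  proof (rule ccontr)
    assume "I \<inter> M \<noteq> {}"
    then obtain p r n f where *: "p \<in> P" "r \<in> polyfun UNIV" "f \<in> polyfun (J - {j})" "f \<noteq> 0"
      "p + r * l = b ^ n * f" unfolding I_def M_def by blast
    obtain u where u: "f u \<noteq> 0" using *(4) by (metis ext zero_fun_apply)
    obtain y where y: "f y \<noteq> 0" "g' y \<noteq> 0"
      using polyfun_domain[OF polyfun_UNIV[OF *(3)] polyfun_UNIV[OF g'] u g'0] by blast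
    \<comment> \<open>A point of the hyperplane where neither \<open>f\<close> nor \<open>g\<close>
      vanishes. Independence of \<open>J\<close> makes the vanishing condition for lifting trivial,
      and the lifted point is a zero of \<open>P\<close> and of \<open>l\<close> at which
      \<open>b\<close> and \<open>f\<close> are nonzero, contrary to the equation.\<close>
    define y' where "y' = (\<chi> i. if i = j then c else y $ i)"
    have "g y' \<noteq> 0" using y(2) by (simp add: g'_def y'_def)
    moreover have "f y' = 0" if "f \<in> P \<inter> polyfun J" for f using J(1) that by (auto simp: alg_indep_def)
    ultimately obtain w where w: "\<forall>j\<in>J. w $ j = y' $ j" "\<forall>f\<in>P \<inter> polyfun UNIV. f w = 0" "b w \<noteq> 0"
      using lift by blast
    have "f w = f y" using w(1) by (intro polyfun_cong[OF *(3)]) (auto simp: y'_def)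
    moreover have "p w = 0" using w(2) *(1) sub by blast
    moreover have "l w = 0" using w(1) J(2) by (simp add: l_def y'_def)
    moreover have "p w + r w * l w = b w ^ n * f w" using fun_cong[OF *(5), of w] by (simp add: fun_power_apply)
    ultimately show False using y(1) w(3) by simp
  qed
  have "I \<subseteq> polyfun UNIV" using sub lU by (auto simp: I_def intro!: polyfun.add polyfun.mult)
  moreover have "0 \<in> I" using I_I[OF zero polyfun_0] by simp
  moreover have "f + h \<in> I" if fh: "f \<in> I" "h \<in> I" for f h
  proof -
    obtain p r p' r' where "p \<in> P" "r \<in> polyfun UNIV" "f = p + r * l" "p' \<in> P" "r' \<in> polyfun UNIV" "h = p' + r' * l"
      using fh by (auto simp: I_def)
    moreover from this have "f + h = (p + p') + (r + r') * l" by (simp add: algebra_simps)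
    ultimately show ?thesis using I_I[of "p + p'" "r + r'"] add polyfun.add by metis
  qed
  moreover have "h * f \<in> I" if fh: "f \<in> I" "h \<in> polyfun UNIV" for f h
  proof -
    obtain p r where "p \<in> P" "r \<in> polyfun UNIV" "f = p + r * l" using fh by (auto simp: I_def)
    moreover from this have "h * f = h * p + (h * r) * l" by (simp add: algebra_simps)
    ultimately show ?thesis using I_I[of "h * p" "h * r"] mult polyfun.mult fh(2) by metis
  qed
  moreover have "1 \<in> M" using M_I[OF polyfun_1, of 0] by simp
  moreover have "f * h \<in> M" if fh: "f \<in> M" "h \<in> M" for f h
  proof -
    obtain n f' m h' where *: "f = b ^ n * f'" "h = b ^ m * h'" "f' \<in> polyfun (J - {j})" "f' \<noteq> 0"
      "h' \<in> polyfun (J - {j})" "h' \<noteq> 0" using fh by (auto simp: M_def)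
    \<comment> \<open>Closure under products rests on the integral domain property of polynomial
      functions.\<close>
    obtain u v where "f' u \<noteq> 0" "h' v \<noteq> 0" using *(4,6) by (metis ext zero_fun_apply)
    then obtain x where "f' x \<noteq> 0" "h' x \<noteq> 0"
      using polyfun_domain[OF polyfun_UNIV[OF *(3)] polyfun_UNIV[OF *(5)]] by blast
    hence "(f' * h') x \<noteq> 0" by simp
    hence "f' * h' \<noteq> 0" by (metis zero_fun_apply)
    moreover have "f * h = b ^ (n + m) * (f' * h')" using * by (simp add: algebra_simps power_add)
    ultimately show ?thesis using M_I polyfun.mult *(3,5) by metis
  qed
  ultimately obtain P' where P': "prime_fun_ideal P'" "I \<subseteq> P'" "P' \<inter> M = {}"
    using ex_prime_fun_ideal[of I M] IM by blast
  interpret P': prime_fun_ideal P' by fact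
  have "P \<subseteq> I" using I_I[OF _ polyfun_0] by fastforce
  moreover have "l \<in> I" using I_I[OF zero polyfun_1] by simp
  moreover have "l \<notin> P"
  proof
    assume "l \<in> P"
    hence "l = 0" using l J(1) by (auto simp: alg_indep_def)
    hence "l (\<chi> i. c + 1) = 0" by simp
    thus False by (simp add: l_def)
  qed
  ultimately have "P \<subset> P'" using P'(2) by blast
  moreover have "P'.alg_indep (J - {j})"
    using M_I[of _ 0] P'(3) by (auto simp: P'.alg_indep_def)
  moreover have "b \<notin> P'" using M_I[OF polyfun_1, of 1] P'(3) by auto
  ultimately show ?thesis using that P'(1) by blast
qed

end

text \<open>One independent coordinate is given up per step. The numbering is downward, with the
  largest ideal at index \<open>0\<close>, so that the zero sets increase with the index as in a
  chain for the Krull dimension.\<close>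

lemma prime_chain:
  assumes "finite J" "prime_fun_ideal P" "prime_fun_ideal.alg_indep P J" "b \<in> polyfun UNIV" "b \<notin> P"
  shows "\<exists>Q. (\<forall>i\<le>card J. prime_fun_ideal (Q i) \<and> P \<subseteq> Q i \<and> b \<notin> Q i) \<and> (\<forall>i<card J. Q (Suc i) \<subset> Q i)"
  using assms
proof (induction "card J" arbitrary: J P)
  case 0
  thus ?case by (intro exI[of _ "\<lambda>_. P"]) auto
next
  case (Suc n)
  then obtain j where j: "j \<in> J" by fastforce
  obtain P' where P': "prime_fun_ideal P'" "P \<subset> P'" "prime_fun_ideal.alg_indep P' (J - {j})" "b \<notin> P'"
    using prime_fun_ideal.ex_smaller_prime[OF Suc.prems(2,3) j Suc.prems(4,5)] by blast
  have c: "n = card (J - {j})" using Suc.hyps(2) j Suc.prems(1) by simp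
  obtain Q where Q: "\<forall>i\<le>n. prime_fun_ideal (Q i) \<and> P' \<subseteq> Q i \<and> b \<notin> Q i" "\<forall>i<n. Q (Suc i) \<subset> Q i"
    using Suc.hyps(1)[OF c _ P'(1,3) Suc.prems(4) P'(4)] Suc.prems(1) c by auto
  show ?case unfolding Suc.hyps(2)[symmetric]
    using Q Suc.prems P'(2) order.strict_trans2[OF P'(2)] psubset_imp_subset[OF order.strict_trans2[OF P'(2)]]
    by (intro exI[of _ "\<lambda>i. if i \<le> n then Q i else P"]) (auto simp: le_Suc_eq less_Suc_eq)
qed

section \<open>Linear independence of functions and Hilbert functions\<close>

text \<open>Families instead of sets of functions: only the restrictions to \<open>V\<close> matter,
  and distinct members may have equal restrictions.\<close>

definition indep_on :: "'a set \<Rightarrow> ('i \<Rightarrow> 'a \<Rightarrow> complex) \<Rightarrow> 'i set \<Rightarrow> bool"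
  where "indep_on V f I \<longleftrightarrow> (\<forall>c. (\<forall>x\<in>V. (\<Sum>i\<in>I. c i * f i x) = 0) \<longrightarrow> (\<forall>i\<in>I. c i = 0))"

definition spanned_on :: "'a set \<Rightarrow> ('i \<Rightarrow> 'a \<Rightarrow> complex) \<Rightarrow> 'i set \<Rightarrow> ('a \<Rightarrow> complex) \<Rightarrow> bool"
  where "spanned_on V f I g \<longleftrightarrow> (\<exists>c. \<forall>x\<in>V. g x = (\<Sum>i\<in>I. c i * f i x))"

lemma indep_onD: "indep_on V f I \<Longrightarrow> (\<And>x. x \<in> V \<Longrightarrow> (\<Sum>i\<in>I. c i * f i x) = 0) \<Longrightarrow> i \<in> I \<Longrightarrow> c i = 0"
  unfolding indep_on_def by blast

lemma spanned_on_base: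
  assumes "finite I" "i \<in> I"
  shows "spanned_on V f I (f i)"
proof -
  have "(\<Sum>j\<in>I. (if j = i then 1 else 0) * f j x) = f i x" for x
    using assms by (subst sum.remove[OF assms]) auto
  thus ?thesis unfolding spanned_on_def by (intro exI[of _ "\<lambda>j. if j = i then 1 else 0"]) auto
qed

lemma spanned_on_cong: "spanned_on V f I g \<Longrightarrow> (\<And>x. x \<in> V \<Longrightarrow> g x = h x) \<Longrightarrow> spanned_on V f I h"
  unfolding spanned_on_def by metis

lemma spanned_on_0: "spanned_on V f I (\<lambda>_. 0)"
  unfolding spanned_on_def by (intro exI[of _ "\<lambda>_. 0"]) auto

lemma spanned_on_add:
  assumes "spanned_on V f I g" "spanned_on V f I h"
  shows "spanned_on V f I (\<lambda>x. g x + h x)"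
proof -
  obtain c d where "\<forall>x\<in>V. g x = (\<Sum>i\<in>I. c i * f i x)" "\<forall>x\<in>V. h x = (\<Sum>i\<in>I. d i * f i x)"
    using assms unfolding spanned_on_def by blast
  thus ?thesis unfolding spanned_on_def
    by (intro exI[of _ "\<lambda>i. c i + d i"]) (auto simp: sum.distrib algebra_simps)
qed

lemma spanned_on_scale:
  assumes "spanned_on V f I g"
  shows "spanned_on V f I (\<lambda>x. k * g x)"
proof -
  obtain c where "\<forall>x\<in>V. g x = (\<Sum>i\<in>I. c i * f i x)"
    using assms unfolding spanned_on_def by blast
  thus ?thesis unfolding spanned_on_def
    by (intro exI[of _ "\<lambda>i. k * c i"]) (auto simp: sum_distrib_left algebra_simps)
qed

lemma spanned_on_sum:
  "(\<And>j. j \<in> J \<Longrightarrow> spanned_on V f I (g j)) \<Longrightarrow> spanned_on V f I (\<lambda>x. \<Sum>j\<in>J. g j x)"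
  by (induction J rule: infinite_finite_induct) (auto intro: spanned_on_0 spanned_on_add)

lemma spanned_on_mult:
  assumes "spanned_on V f I g" "\<And>i. i \<in> I \<Longrightarrow> spanned_on V f' I' (\<lambda>x. h x * f i x)"
  shows "spanned_on V f' I' (\<lambda>x. h x * g x)"
proof -
  obtain c where c: "\<forall>x\<in>V. g x = (\<Sum>i\<in>I. c i * f i x)"
    using assms(1) unfolding spanned_on_def by blast
  have "spanned_on V f' I' (\<lambda>x. \<Sum>i\<in>I. c i * (h x * f i x))"
    using assms(2) by (intro spanned_on_sum spanned_on_scale)
  thus ?thesis by (rule spanned_on_cong) (simp add: c sum_distrib_left mult_ac)
qed

lemma spanned_on_trans:
  assumes "spanned_on V f I g" "\<And>i. i \<in> I \<Longrightarrow> spanned_on V f' I' (f i)"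
  shows "spanned_on V f' I' g"
  using spanned_on_mult[of V f I g f' I' "\<lambda>_. 1"] assms by simp

lemma spanned_on_mono:
  assumes "spanned_on V f I g" "I \<subseteq> I'" "finite I'"
  shows "spanned_on V f I' g"
  using assms by (auto intro: spanned_on_trans spanned_on_base)

text \<open>Gaussian elimination: a function \<open>f k\<close> that involves the generator
  \<open>g j\<close> serves as pivot; subtracting multiples of it removes one generator and one
  function.\<close>

lemma indep_on_card_le:
  assumes "finite J" "finite I" "indep_on V f I" "\<And>i. i \<in> I \<Longrightarrow> spanned_on V g J (f i)"
  shows "card I \<le> card J"
  using assms
proof (induction J arbitrary: I f rule: finite_induct)
  case empty
  have False if "i \<in> I" for i
  proof -
    have "f j x = 0" if "j \<in> I" "x \<in> V" for j x
      using empty(3)[OF that(1)] that(2) by (auto simp: spanned_on_def)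
    hence "(\<Sum>i\<in>I. 1 * f i x) = 0" if "x \<in> V" for x using that by simp
    from indep_onD[OF empty(2) this \<open>i \<in> I\<close>] show False by simp
  qed
  thus ?case by fastforce
next
  case (insert j J)
  have "\<exists>c. \<forall>x\<in>V. f i x = (\<Sum>l\<in>insert j J. c l * g l x)" if "i \<in> I" for i
    using insert.prems(3)[OF that] by (simp add: spanned_on_def)
  then obtain c where c: "\<And>i x. i \<in> I \<Longrightarrow> x \<in> V \<Longrightarrow> f i x = (\<Sum>l\<in>insert j J. c i l * g l x)" by metis
  hence c: "\<And>i x. i \<in> I \<Longrightarrow> x \<in> V \<Longrightarrow> f i x = c i j * g j x + (\<Sum>l\<in>J. c i l * g l x)"
    using insert.hyps by simp
  show ?case
  proof (cases "\<forall>i\<in>I. c i j = 0")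
    case True
    have "card I \<le> card J"
      using c True by (intro insert.IH[of I f] insert.prems) (auto simp: spanned_on_def)
    thus ?thesis using insert.hyps by simp
  next
    case False
    then obtain k where k: "k \<in> I" "c k j \<noteq> 0" by blast
    define h where "h i x = f i x - c i j / c k j * f k x" for i x
    have "spanned_on V g J (h i)" if "i \<in> I" for i
      unfolding spanned_on_def
    proof (intro exI ballI)
      fix x assume "x \<in> V"
      show "h i x = (\<Sum>l\<in>J. (c i l - c i j / c k j * c k l) * g l x)"
        unfolding h_def c[OF that \<open>x \<in> V\<close>] c[OF k(1) \<open>x \<in> V\<close>] using k(2)
        by (simp add: algebra_simps sum_subtractf sum_distrib_left)
    qed
    moreover have "indep_on V h (I - {k})" unfolding indep_on_def
    proof (intro allI impI ballI)
      fix a i assume a: "\<forall>x\<in>V. (\<Sum>i\<in>I - {k}. a i * h i x) = 0" and i: "i \<in> I - {k}"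
      \<comment> \<open>The coefficient at the pivot collects the multiples of \<open>f k\<close>
        that were subtracted from the other functions.\<close>
      define b where "b i = (if i = k then - (\<Sum>i\<in>I - {k}. a i * (c i j / c k j)) else a i)" for i
      have "(\<Sum>i\<in>I. b i * f i x) = 0" if "x \<in> V" for x
      proof -
        have "(\<Sum>i\<in>I. b i * f i x) = b k * f k x + (\<Sum>i\<in>I - {k}. b i * f i x)"
          using insert.prems k by (simp add: sum.remove)
        also have "(\<Sum>i\<in>I - {k}. b i * f i x) = (\<Sum>i\<in>I - {k}. a i * f i x)"
          by (intro sum.cong) (auto simp: b_def)
        also have "b k * f k x + \<dots> = (\<Sum>i\<in>I - {k}. a i * h i x)"
          by (simp add: b_def h_def algebra_simps sum_subtractf sum_distrib_left)
        finally show ?thesis using a that by simp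
      qed
      from indep_onD[OF insert.prems(2) this, of i] show "a i = 0" using i by (simp add: b_def)
    qed
    ultimately have "card (I - {k}) \<le> card J"
      using insert.prems by (intro insert.IH) auto
    thus ?thesis using insert.hyps insert.prems k by simp
  qed
qed

lemma ex_basis_on:
  assumes "finite I"
  obtains B where "B \<subseteq> I" "indep_on V f B" "\<And>i. i \<in> I \<Longrightarrow> spanned_on V f B (f i)"
proof -
  have "\<exists>B\<subseteq>I. indep_on V f B \<and> (\<forall>i\<in>I. spanned_on V f B (f i))"
    using assms
  proof (induction I rule: finite_induct)
    case empty
    thus ?case by (auto simp: indep_on_def)
  next
    case (insert i I)
    then obtain B where B: "B \<subseteq> I" "indep_on V f B" "\<forall>i\<in>I. spanned_on V f B (f i)" by blast
    have fin: "finite B" "i \<notin> B" using B(1) insert.hyps finite_subset by auto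
    show ?case
    proof (cases "spanned_on V f B (f i)")
      case True
      thus ?thesis using B by blast
    next
      case False
      have "indep_on V f (insert i B)" unfolding indep_on_def
      proof (intro allI impI)
        fix c assume "\<forall>x\<in>V. (\<Sum>j\<in>insert i B. c j * f j x) = 0"
        hence *: "c i * f i x + (\<Sum>j\<in>B. c j * f j x) = 0" if "x \<in> V" for x
          using fin that by simp
        have "c i = 0"
        proof (rule ccontr)
          assume "c i \<noteq> 0"
          have "f i x = (\<Sum>j\<in>B. (- c j / c i) * f j x)" if "x \<in> V" for x
          proof -
            have "f i x = - (\<Sum>j\<in>B. c j * f j x) / c i"
              using *[OF that] \<open>c i \<noteq> 0\<close> by (metis eq_neg_iff_add_eq_0 nonzero_mult_div_cancel_left)
            also have "\<dots> = (\<Sum>j\<in>B. (- c j / c i) * f j x)"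
              by (simp add: sum_negf sum_divide_distrib)
            finally show ?thesis .
          qed
          hence "spanned_on V f B (f i)"
            unfolding spanned_on_def by (intro exI[of _ "\<lambda>j. - c j / c i"]) blast
          thus False using False by blast
        qed
        thus "\<forall>j\<in>insert i B. c j = 0" using * B(2) unfolding indep_on_def by simp
      qed
      moreover have "spanned_on V f (insert i B) (f j)" if "j \<in> insert i I" for j
        using that B(3) fin by (auto intro: spanned_on_base spanned_on_mono)
      ultimately show ?thesis using B(1) by blast
    qed
  qed
  thus ?thesis using that by blast
qed

section \<open>Monomials, forms and the Hilbert function\<close>

definition monom_fun :: "('n \<Rightarrow> nat) \<Rightarrow> complex^'n::finite \<Rightarrow> complex"
  where "monom_fun m x = (\<Prod>i\<in>UNIV. x $ i ^ m i)"

definition mons :: "nat \<Rightarrow> ('n::finite \<Rightarrow> nat) set"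
  where "mons d = {m. sum m UNIV = d}"

definition form :: "nat \<Rightarrow> (complex^'n::finite \<Rightarrow> complex) set"
  where "form d = {f. spanned_on UNIV monom_fun (mons d) f}"

text \<open>The monomials of degree \<open>d\<close> span the forms, and a spanning family contains
  a basis, so counting independent monomials computes the dimension of the space of
  restrictions.\<close>

definition hilb :: "(complex^'n::finite) set \<Rightarrow> nat \<Rightarrow> nat"
  where "hilb V d = Max (card ` {B. B \<subseteq> mons d \<and> indep_on V monom_fun B})"

lemma mons_subset: "mons d \<subseteq> PiE UNIV (\<lambda>_. {..d})"
  by (auto simp: mons_def intro!: member_le_sum)

lemma finite_mons: "finite (mons d)"
  by (rule finite_subset[OF mons_subset]) (intro finite_PiE, auto)

lemma card_mons_le: "card (mons d :: ('n::finite \<Rightarrow> nat) set) \<le> (d + 1) ^ CARD('n)"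
proof -
  have "card (mons d :: ('n \<Rightarrow> nat) set) \<le> card (PiE (UNIV :: 'n set) (\<lambda>_. {..d}))"
    by (rule card_mono[OF _ mons_subset]) (intro finite_PiE, auto)
  thus ?thesis by (simp add: card_PiE)
qed

lemma monom_fun_add: "monom_fun (\<lambda>i. m i + k i) x = monom_fun m x * monom_fun k x"
  by (simp add: monom_fun_def power_add prod.distrib)

lemma monom_fun_times: "monom_fun m (\<chi> i. x $ i * y $ i) = monom_fun m x * monom_fun m y"
  by (simp add: monom_fun_def power_mult_distrib prod.distrib)

lemma monom_fun_zero [simp]: "monom_fun (\<lambda>_. 0) x = 1" by (simp add: monom_fun_def)

lemma monom_fun_upd: "monom_fun (m(k := j)) x = x $ k ^ j * monom_fun (m(k := 0)) x"
  unfolding monom_fun_def by (subst (1 2) prod.remove[of _ k]) auto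

lemma monom_fun_nz: "(\<And>i. x $ i \<noteq> 0) \<Longrightarrow> monom_fun m x \<noteq> 0"
  by (simp add: monom_fun_def)

lemma monom_fun_form: "m \<in> mons d \<Longrightarrow> monom_fun m \<in> form d"
  unfolding form_def by (simp add: spanned_on_base finite_mons)

lemma formE:
  assumes "f \<in> form d"
  obtains c where "f = (\<lambda>x. \<Sum>m\<in>mons d. c m * monom_fun m x)"
  using assms by (auto simp: form_def spanned_on_def)

lemma finite_subset_mons: "B \<subseteq> mons d \<Longrightarrow> finite B"
  using finite_mons finite_subset by blast

lemma finite_indep_cards: "finite (card ` {B. B \<subseteq> mons d \<and> indep_on V monom_fun B})"
  using finite_mons[of d] by (intro finite_imageI) (auto intro: finite_subset[of _ "Pow (mons d)"])

lemma hilb_basis: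
  obtains B where "B \<subseteq> mons d" "indep_on V monom_fun B" "card B = hilb V d"
proof -
  have "{} \<in> {B. B \<subseteq> mons d \<and> indep_on V monom_fun B}" by (auto simp: indep_on_def)
  hence "hilb V d \<in> card ` {B. B \<subseteq> mons d \<and> indep_on V monom_fun B}"
    unfolding hilb_def by (intro Max_in[OF finite_indep_cards]) blast
  thus ?thesis using that by auto
qed

lemma hilb_geI: "B \<subseteq> mons d \<Longrightarrow> indep_on V monom_fun B \<Longrightarrow> card B \<le> hilb V d"
  unfolding hilb_def by (intro Max_ge[OF finite_indep_cards]) auto

lemma form_spanned:
  assumes "\<And>m. m \<in> mons d \<Longrightarrow> spanned_on V g J (monom_fun m)" "f \<in> form d"
  shows "spanned_on V g J f"
proof -
  have "spanned_on V monom_fun (mons d) f" using assms(2) by (auto simp: form_def spanned_on_def)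
  thus ?thesis using assms(1) by (rule spanned_on_trans)
qed

lemma hilb_ge:
  assumes "finite I" "indep_on V f I" "\<And>i. i \<in> I \<Longrightarrow> f i \<in> form d"
  shows "card I \<le> hilb V d"
proof -
  obtain B where B: "B \<subseteq> mons d" "indep_on V monom_fun B" "\<And>m. m \<in> mons d \<Longrightarrow> spanned_on V monom_fun B (monom_fun m)"
    using ex_basis_on[OF finite_mons] by blast
  have "card I \<le> card B"
    using form_spanned[OF B(3) assms(3)] finite_subset_mons[OF B(1)] assms(1,2)
    by (intro indep_on_card_le[of B I V f monom_fun])
  also have "\<dots> \<le> hilb V d" using B by (intro hilb_geI)
  finally show ?thesis .
qed

lemma hilb_spanning:
  obtains B where "B \<subseteq> mons d" "card B \<le> hilb V d" "\<And>f. f \<in> form d \<Longrightarrow> spanned_on V monom_fun B f"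
proof -
  obtain B where B: "B \<subseteq> mons d" "indep_on V monom_fun B" "\<And>m. m \<in> mons d \<Longrightarrow> spanned_on V monom_fun B (monom_fun m)"
    using ex_basis_on[OF finite_mons] by blast
  thus ?thesis using that[OF B(1) hilb_geI] form_spanned[OF B(3)] by blast
qed

text \<open>A linear relation between monomials on \<open>W\<close> is a form vanishing on
  \<open>W\<close>, hence a relation on \<open>V\<close>. This is how Hilbert functions of sets with
  the same closure are compared.\<close>

lemma hilb_le_if_vanishing:
  assumes "\<And>f. f \<in> form d \<Longrightarrow> (\<forall>x\<in>W. f x = 0) \<Longrightarrow> (\<forall>x\<in>V. f x = 0)"
  shows "hilb V d \<le> hilb W d"
proof -
  obtain B where B: "B \<subseteq> mons d" "indep_on V monom_fun B" "card B = hilb V d" using hilb_basis .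
  have "indep_on W monom_fun B" unfolding indep_on_def
  proof (intro allI impI)
    fix c assume c: "\<forall>x\<in>W. (\<Sum>m\<in>B. c m * monom_fun m x) = 0"
    have "(\<lambda>x. \<Sum>m\<in>B. c m * monom_fun m x) \<in> form d" unfolding form_def
      using B(1) finite_mons by (auto intro!: spanned_on_sum spanned_on_scale spanned_on_base)
    from assms[OF this] c show "\<forall>m\<in>B. c m = 0" using B(2) unfolding indep_on_def by blast
  qed
  thus ?thesis using hilb_geI[OF B(1)] B(3) by metis
qed

lemma hilb_le: "hilb V d \<le> (d + 1) ^ CARD('n)" for V :: "(complex^'n::finite) set"
proof -
  obtain B where B: "B \<subseteq> mons d" "indep_on V monom_fun B" "card B = hilb V d" using hilb_basis .
  thus ?thesis using card_mono[OF finite_mons B(1)] card_mons_le[of d, where 'n = 'n] by linarith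
qed

section \<open>Growth and algebraic independence\<close>

lemma monom_fun_upd_Suc: "x $ k * monom_fun w x = monom_fun (w(k := Suc (w k))) x"
  using monom_fun_upd[of w k "w k" x] monom_fun_upd[of w k "Suc (w k)" x] by simp

lemma monom_fun_prod: "monom_fun m = (\<Prod>i\<in>UNIV. (\<lambda>x. x $ i) ^ m i)"
proof
  fix x :: "complex^'a"
  have "(\<Prod>i\<in>I. (\<lambda>x. x $ i) ^ m i) x = (\<Prod>i\<in>I. x $ i ^ m i)" for I :: "'a set"
    by (induction I rule: infinite_finite_induct) (simp_all add: fun_power_apply)
  thus "monom_fun m x = (\<Prod>i\<in>UNIV. (\<lambda>x. x $ i) ^ m i) x" by (simp add: monom_fun_def)
qed

lemma monom_fun_polyfun: "monom_fun m \<in> polyfun UNIV"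
  unfolding monom_fun_prod by (intro polyfun_intros) auto

lemma polyfun_lincomb:
  assumes "\<And>i. i \<in> I \<Longrightarrow> f i \<in> polyfun K"
  shows "(\<lambda>x. \<Sum>i\<in>I. c i * f i x) \<in> polyfun K"
  using assms
proof (induction I rule: infinite_finite_induct)
  case (insert i I)
  have "(\<lambda>x. \<Sum>i\<in>insert i I. c i * f i x) = (\<lambda>_. c i) * f i + (\<lambda>x. \<Sum>i\<in>I. c i * f i x)"
    using insert by (simp add: fun_eq_iff)
  thus ?case using insert by (simp add: polyfun_intros)
qed (simp_all add: polyfun.const)

lemma form_polyfun: "f \<in> form d \<Longrightarrow> f \<in> polyfun UNIV"
  by (erule formE) (auto intro: polyfun_lincomb monom_fun_polyfun)

context prime_fun_ideal
begin

text \<open>A nonzero element of \<open>P\<close> in the coordinates \<open>J\<close> and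
  \<open>k\<close>, read as a polynomial in \<open>x_k\<close>, has a nonzero leading coefficient,
  which lies outside \<open>P\<close> by independence of \<open>J\<close>. Separating the leading
  term gives the relation.\<close>

lemma algebraic_relation:
  assumes J: "alg_indep J" and k: "k \<notin> J" "\<not> alg_indep (insert k J)"
  obtains a e r where "a \<in> polyfun J" "a \<notin> P" "r \<in> coeffs_in (polyfun J)" "degree r < e"
    "a * (\<lambda>x. x $ k) ^ e - poly r (\<lambda>x. x $ k) \<in> P"
proof -
  let ?X = "\<lambda>x :: complex^'n. x $ k"
  obtain f where f: "f \<in> P" "f \<in> polyfun (insert k J)" "f \<noteq> 0"
    using k(2) by (auto simp: alg_indep_def)
  obtain p where p: "p \<in> coeffs_in (polyfun J)" "f = poly p ?X"
    using polyfun_insert_poly[OF f(2)] by blast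
  have "lead_coeff p \<noteq> 0" using f(3) p(2) by auto
  hence lc: "lead_coeff p \<in> polyfun J" "lead_coeff p \<notin> P"
    using p(1) J by (auto simp: coeffs_in_def alg_indep_def)
  have deg: "degree p > 0"
  proof (rule ccontr)
    assume "\<not> degree p > 0"
    then obtain a where a: "p = [:a:]" by (metis degree_eq_zeroE gr0I)
    thus False using f(1) p(2) lc(2) by simp
  qed
  define r where "r = monom (lead_coeff p) (degree p) - p"
  have "degree r \<le> degree p" unfolding r_def by (intro degree_diff_le) (auto intro: degree_monom_le)
  moreover have "coeff r (degree p) = 0" by (simp add: r_def)
  ultimately have "degree r < degree p" using deg leading_coeff_0_iff[of r] by (metis degree_0 le_neq_implies_less)
  moreover have "r \<in> coeffs_in (polyfun J)"
    unfolding r_def using p(1) lc(1) by (intro coeffs_in_diff coeffs_in_monom)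
  moreover have "lead_coeff p * ?X ^ degree p - poly r ?X = f"
    by (simp add: r_def poly_monom p(2))
  ultimately show ?thesis using that lc f(1) by metis
qed

text \<open>Common multiplier and common exponent for all dependent coordinates: each relation is
  multiplied by the leading coefficients of the others and by a power of \<open>x_k\<close>.\<close>

lemma uniform_algebraic_relation:
  assumes J: "alg_indep J" and max: "\<And>k. k \<notin> J \<Longrightarrow> \<not> alg_indep (insert k J)"
  obtains a e r where "a \<in> polyfun J" "a \<notin> P" "e > 0"
    "\<And>k. k \<notin> J \<Longrightarrow> r k \<in> coeffs_in (polyfun J) \<and> degree (r k) < e \<and> a * (\<lambda>x. x $ k) ^ e - poly (r k) (\<lambda>x. x $ k) \<in> P"
proof -
  have "\<exists>a e r. a \<in> polyfun J \<and> a \<notin> P \<and> r \<in> coeffs_in (polyfun J) \<and> degree r < e \<and>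
    a * (\<lambda>x. x $ k) ^ e - poly r (\<lambda>x. x $ k) \<in> P" if "k \<notin> J" for k
    using algebraic_relation[OF J that max[OF that]] by metis
  then obtain a e r where aer: "\<And>k. k \<notin> J \<Longrightarrow> a k \<in> polyfun J \<and> a k \<notin> P \<and> r k \<in> coeffs_in (polyfun J) \<and>
    degree (r k) < e k \<and> a k * (\<lambda>x. x $ k) ^ e k - poly (r k) (\<lambda>x. x $ k) \<in> P" by metis
  define A where "A = prod a (- J)"
  \<comment> \<open>The sum dominates every single exponent, and the successor keeps
    \<open>E\<close> positive even if there is no dependent coordinate.\<close>
  define E where "E = Suc (sum e (- J))"
  have A: "A \<in> polyfun J" "A \<notin> P"
    unfolding A_def by (intro polyfun_prod prod_notin; use aer polyfun_UNIV in blast)+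
  have "\<exists>r'. r' \<in> coeffs_in (polyfun J) \<and> degree r' < E \<and> A * (\<lambda>x. x $ k) ^ E - poly r' (\<lambda>x. x $ k) \<in> P"
    if "k \<notin> J" for k
  proof -
    let ?X = "\<lambda>x :: complex^'n. x $ k"
    define A' where "A' = prod a (- J - {k})"
    have A': "A' \<in> polyfun J" unfolding A'_def using aer by (intro polyfun_prod) auto
    have AA': "A = A' * a k" unfolding A_def A'_def using that
      by (subst prod.remove[of "- J" k]) (auto simp: mult.commute)
    have "e k \<le> sum e (- J)" using that by (intro member_le_sum) auto
    hence e: "e k \<le> E" by (simp add: E_def)
    let ?r = "smult A' (r k) * monom 1 (E - e k)"
    have "degree ?r \<le> degree (r k) + (E - e k)"
      using degree_mult_le[of "smult A' (r k)" "monom 1 (E - e k)"] degree_smult_le[of A' "r k"]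
        degree_monom_le[of "1 :: complex^'n \<Rightarrow> complex" "E - e k"] by linarith
    moreover have "degree (r k) < e k" using aer that by blast
    ultimately have "degree ?r < E" using e by linarith
    moreover have "?r \<in> coeffs_in (polyfun J)"
      using aer[OF that] A' by (intro coeffs_in_mult coeffs_in_smult coeffs_in_monom polyfun_1) auto
    moreover have "?X ^ E = ?X ^ (E - e k) * ?X ^ e k" using e by (simp flip: power_add)
    hence "A * ?X ^ E - poly ?r ?X = (A' * ?X ^ (E - e k)) * (a k * ?X ^ e k - poly (r k) ?X)"
      by (simp add: AA' poly_monom algebra_simps)
    moreover have "\<dots> \<in> P" using aer[OF that] polyfun_UNIV[OF A']
      by (intro mult polyfun.mult polyfun_power polyfun.coord) auto
    ultimately show ?thesis by (intro exI[of _ ?r]) auto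
  qed
  thus ?thesis using that[OF A, of E] by (metis E_def zero_less_Suc)
qed

text \<open>Modulo \<open>P\<close>, a monomial of degree \<open>d\<close> times \<open>a ^ d\<close> can be rewritten so that the variables outside
  \<open>J\<close> only occur with exponents below a fixed bound.\<close>

lemma indep_card_bound:
  assumes S: "\<And>f. f \<in> polyfun UNIV \<Longrightarrow> f \<in> P \<longleftrightarrow> (\<forall>x\<in>S. f x = 0)"
    and J: "alg_indep J" and max: "\<And>k. k \<notin> J \<Longrightarrow> \<not> alg_indep (insert k J)"
  obtains C where "\<And>d B. B \<subseteq> mons d \<Longrightarrow> indep_on S monom_fun B \<Longrightarrow> card B \<le> C * (d + 1) ^ card J"
proof -
  obtain a e r where a: "a \<in> polyfun J" "a \<notin> P" and e: "e > 0"
    and r: "\<And>k. k \<notin> J \<Longrightarrow> r k \<in> coeffs_in (polyfun J) \<and> degree (r k) < e \<and> a * (\<lambda>x. x $ k) ^ e - poly (r k) (\<lambda>x. x $ k) \<in> P"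
    using uniform_algebraic_relation[OF J max] by metis
  \<comment> \<open>Exponents of reduced monomials. Only the exponents on \<open>J\<close> may grow
    with \<open>E\<close>, which is why the final count has order \<open>E ^ card J\<close>.\<close>
  define ME where "ME E = PiE UNIV (\<lambda>i. if i \<in> J then {..E} else {..<e})" for E :: nat
  define Sp where "Sp E = spanned_on S monom_fun (ME E)" for E
  have finME: "finite (ME E)" for E unfolding ME_def by (intro finite_PiE) auto
  have ME_mem: "w \<in> ME E \<longleftrightarrow> (\<forall>j\<in>J. w j \<le> E) \<and> (\<forall>k. k \<notin> J \<longrightarrow> w k < e)" for w E
    by (auto simp: ME_def PiE_def Pi_def)
  have ME_mono: "w \<in> ME E \<Longrightarrow> E \<le> E' \<Longrightarrow> w \<in> ME E'" for w E E' by (auto simp: ME_mem)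
  have Sp_mon: "Sp E (monom_fun w)" if "w \<in> ME E" for w E
    unfolding Sp_def using finME that by (rule spanned_on_base)
  have Sp_mono: "Sp E g \<Longrightarrow> E \<le> E' \<Longrightarrow> Sp E' g" for E E' g
    unfolding Sp_def using ME_mono finME by (metis spanned_on_mono subsetI)
  have polyJ: "\<exists>D. \<forall>E g. Sp E g \<longrightarrow> Sp (E + D) (\<lambda>x. f x * g x)" if "f \<in> polyfun J" for f
    using that
  proof (induction rule: polyfun.induct)
    case (const c)
    show ?case by (rule exI[of _ 0]) (auto simp: Sp_def intro: spanned_on_scale)
  next
    case (coord j)
    have "Sp (E + 1) (\<lambda>x. x $ j * g x)" if "Sp E g" for E g
      unfolding Sp_def
    proof (rule spanned_on_mult[OF that[unfolded Sp_def]])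
      fix w assume w: "w \<in> ME E"
      have "w(j := Suc (w j)) \<in> ME (E + 1)" using w coord by (auto simp: ME_mem)
      from Sp_mon[OF this] show "spanned_on S monom_fun (ME (E + 1)) (\<lambda>x. x $ j * monom_fun w x)"
        unfolding monom_fun_upd_Suc Sp_def .
    qed
    thus ?case by blast
  next
    case (add f g)
    then obtain D D' where D: "\<forall>E h. Sp E h \<longrightarrow> Sp (E + D) (\<lambda>x. f x * h x)"
      "\<forall>E h. Sp E h \<longrightarrow> Sp (E + D') (\<lambda>x. g x * h x)" by blast
    have "Sp (E + max D D') (\<lambda>x. (f + g) x * h x)" if "Sp E h" for E h
    proof -
      have "Sp (E + max D D') (\<lambda>x. f x * h x)" "Sp (E + max D D') (\<lambda>x. g x * h x)"
        using D that Sp_mono by (meson add_left_mono max.cobounded1 max.cobounded2)+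
      thus ?thesis unfolding Sp_def by (simp add: spanned_on_add distrib_right)
    qed
    thus ?case by blast
  next
    case (mult f g)
    then obtain D D' where D: "\<forall>E h. Sp E h \<longrightarrow> Sp (E + D) (\<lambda>x. f x * h x)"
      "\<forall>E h. Sp E h \<longrightarrow> Sp (E + D') (\<lambda>x. g x * h x)" by blast
    have "Sp (E + (D' + D)) (\<lambda>x. (f * g) x * h x)" if "Sp E h" for E h
      using D(1)[rule_format, OF D(2)[rule_format, OF that]] by (simp add: mult.assoc add.assoc)
    thus ?case by blast
  qed
  \<comment> \<open>For \<open>k\<close> outside \<open>J\<close>, raising the exponent of
    \<open>x_k\<close> may lead to \<open>x_k ^ e\<close>. The factor \<open>a\<close> is there to
    allow replacing \<open>a * x_k ^ e\<close> by \<open>r k\<close> evaluated at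
    \<open>x_k\<close>, at the price of a bounded increase of the exponents on
    \<open>J\<close>.\<close>
  have step: "\<exists>D. \<forall>E g. Sp E g \<longrightarrow> Sp (E + D) (\<lambda>x. a x * (x $ k * g x))" for k
  proof (cases "k \<in> J")
    case True
    have "a * (\<lambda>x. x $ k) \<in> polyfun J" using a(1) True by (intro polyfun.intros)
    from polyJ[OF this] show ?thesis by (simp add: mult.assoc)
  next
    case False
    have cr: "coeff (r k) i \<in> polyfun J" for i using r[OF False] by (auto simp: coeffs_in_def)
    obtain D where D: "\<And>i E g. Sp E g \<Longrightarrow> Sp (E + D i) (\<lambda>x. coeff (r k) i x * g x)"
      using polyJ[OF cr] by metis
    obtain Da where Da: "\<And>E g. Sp E g \<Longrightarrow> Sp (E + Da) (\<lambda>x. a x * g x)" using polyJ[OF a(1)] by blast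
    define D0 where "D0 = Da + sum D {..<e}"
    have "Sp (E + D0) (\<lambda>x. a x * (x $ k * g x))" if "Sp E g" for E g
    proof -
      have "Sp (E + D0) (\<lambda>x. (a x * x $ k) * g x)" unfolding Sp_def
      proof (rule spanned_on_mult[OF that[unfolded Sp_def]])
        fix w assume w: "w \<in> ME E"
        have "Sp (E + D0) (\<lambda>x. (a x * x $ k) * monom_fun w x)"
        proof (cases "Suc (w k) < e")
          case True
          hence "w(k := Suc (w k)) \<in> ME E" using w False by (auto simp: ME_mem)
          from Da[OF Sp_mon[OF this]] show ?thesis
            unfolding monom_fun_upd_Suc[symmetric] by (auto simp: D0_def mult.assoc elim: Sp_mono)
        next
          case wk: False
          hence "Suc (w k) = e" using w False by (auto simp: ME_mem intro: antisym Suc_leI)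
          hence eq: "x $ k * monom_fun w x = x $ k ^ e * monom_fun (w(k := 0)) x" for x
            unfolding monom_fun_upd_Suc using monom_fun_upd[of w k e x] by simp
          have w0: "w(k := i) \<in> ME E" if "i < e" for i using w False that by (auto simp: ME_mem)
          have "Sp (E + D0) (\<lambda>x. coeff (r k) i x * monom_fun (w(k := i)) x)" if "i < e" for i
          proof -
            have "D i \<le> sum D {..<e}" using that by (intro member_le_sum) auto
            thus ?thesis using D[OF Sp_mon[OF w0[OF that]], of i] by (auto simp: D0_def elim: Sp_mono)
          qed
          hence "Sp (E + D0) (\<lambda>x. \<Sum>i<e. coeff (r k) i x * monom_fun (w(k := i)) x)"
            unfolding Sp_def by (intro spanned_on_sum) auto
          thus ?thesis unfolding Sp_def
          proof (rule spanned_on_cong)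
            fix x assume x: "x \<in> S"
            have "a * (\<lambda>x. x $ k) ^ e - poly (r k) (\<lambda>x. x $ k) \<in> P" using r[OF False] by blast
            hence "(a * (\<lambda>x. x $ k) ^ e - poly (r k) (\<lambda>x. x $ k)) x = 0" using S sub x by blast
            hence "a x * x $ k ^ e = poly (map_poly (\<lambda>q. q x) (r k)) (x $ k)"
              by (simp add: fun_power_apply poly_fun_apply)
            also have "\<dots> = (\<Sum>i\<le>degree (map_poly (\<lambda>q. q x) (r k)). coeff (r k) i x * x $ k ^ i)"
              by (simp add: poly_altdef coeff_map_poly)
            also have "\<dots> = (\<Sum>i<e. coeff (r k) i x * x $ k ^ i)"
            proof (rule sum.mono_neutral_left)
              show "{..degree (map_poly (\<lambda>q. q x) (r k))} \<subseteq> {..<e}"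
                using r[OF False] map_poly_degree_leq[of "\<lambda>q. q x" "r k"] by auto
            next
              show "\<forall>i\<in>{..<e} - {..degree (map_poly (\<lambda>q. q x) (r k))}. coeff (r k) i x * x $ k ^ i = 0"
              proof
                fix i assume "i \<in> {..<e} - {..degree (map_poly (\<lambda>q. q x) (r k))}"
                hence "coeff (map_poly (\<lambda>q. q x) (r k)) i = 0" by (intro coeff_eq_0) auto
                thus "coeff (r k) i x * x $ k ^ i = 0" by (simp add: coeff_map_poly)
              qed
            qed simp
            finally have "a x * x $ k ^ e * monom_fun (w(k := 0)) x = (\<Sum>i<e. coeff (r k) i x * x $ k ^ i * monom_fun (w(k := 0)) x)"
              by (simp only: sum_distrib_right)
            also have "\<dots> = (\<Sum>i<e. coeff (r k) i x * monom_fun (w(k := i)) x)"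
            proof (rule sum.cong[OF refl])
              fix i
              show "coeff (r k) i x * x $ k ^ i * monom_fun (w(k := 0)) x = coeff (r k) i x * monom_fun (w(k := i)) x"
                by (simp only: mult.assoc monom_fun_upd[of w k i x])
            qed
            finally show "(\<Sum>i<e. coeff (r k) i x * monom_fun (w(k := i)) x) = a x * x $ k * monom_fun w x"
              by (simp only: mult.assoc eq[of x])
          qed
        qed
        thus "spanned_on S monom_fun (ME (E + D0)) (\<lambda>x. (a x * x $ k) * monom_fun w x)" by (simp add: Sp_def)
      qed
      thus ?thesis by (simp add: mult.assoc)
    qed
    thus ?thesis by blast
  qed
  then obtain D where D: "\<And>k E g. Sp E g \<Longrightarrow> Sp (E + D k) (\<lambda>x. a x * (x $ k * g x))" by metis
  define D0 where "D0 = sum D UNIV"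
  have D0: "Sp (E + D0) (\<lambda>x. a x * (x $ k * g x))" if "Sp E g" for k E g
  proof -
    have "D k \<le> D0" unfolding D0_def by (intro member_le_sum) auto
    thus ?thesis using D[OF that, of k] by (auto elim: Sp_mono)
  qed
  \<comment> \<open>Each of the \<open>d\<close> variables in the monomial is paired with one factor
    \<open>a\<close> and raises the exponent bound by \<open>D0\<close>, hence the linear bound
    \<open>D0 * d\<close>.\<close>
  have Sp_all: "Sp (D0 * d) (\<lambda>x. a x ^ d * monom_fun m x)" if "m \<in> mons d" for d m
    using that
  proof (induction d arbitrary: m)
    case 0
    hence "m = (\<lambda>_. 0)" by (auto simp: mons_def)
    moreover have "Sp 0 (monom_fun (\<lambda>_. 0))" using e by (intro Sp_mon) (auto simp: ME_mem)
    hence "Sp 0 (\<lambda>x. 1)" unfolding Sp_def by (rule spanned_on_cong) simp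
    ultimately show ?case by simp
  next
    case (Suc d)
    obtain k where k: "m k > 0"
    proof (rule ccontr)
      assume "\<not> thesis"
      hence "m = (\<lambda>_. 0)" using that by (auto simp: fun_eq_iff)
      thus False using Suc.prems by (simp add: mons_def)
    qed
    let ?m = "m(k := m k - 1)"
    have "sum m UNIV = m k + sum m (UNIV - {k})" by (intro sum.remove) auto
    moreover have "sum ?m UNIV = ?m k + sum ?m (UNIV - {k})" by (intro sum.remove) auto
    moreover have "sum ?m (UNIV - {k}) = sum m (UNIV - {k})" by (intro sum.cong) auto
    ultimately have "?m \<in> mons d" using Suc.prems k by (simp add: mons_def)
    from D0[OF Suc.IH[OF this], of k]
    have "Sp (D0 * d + D0) (\<lambda>x. a x * (x $ k * (a x ^ d * monom_fun ?m x)))" .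
    moreover have "x $ k * monom_fun ?m x = monom_fun m x" for x
      using k unfolding monom_fun_upd_Suc by simp
    hence "(\<lambda>x. a x * (x $ k * (a x ^ d * monom_fun ?m x))) = (\<lambda>x. a x ^ Suc d * monom_fun m x)"
      by (metis mult.assoc mult.left_commute power_Suc)
    ultimately show ?case by (simp only: mult_Suc_right add.commute)
  qed
  \<comment> \<open>The number of reduced monomials is
    \<open>(D0 * d + 1) ^ card J * e ^ card (- J)\<close>, and \<open>D0 * d + 1\<close> is at most
    \<open>(D0 + 1) * (d + 1)\<close>.\<close>
  define C where "C = (D0 + 1) ^ card J * e ^ card (- J)"
  have "card B \<le> C * (d + 1) ^ card J" if B: "B \<subseteq> mons d" "indep_on S monom_fun B" for d B
  proof -
    \<comment> \<open>Multiplication by a power of \<open>a\<close> is injective modulo the prime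
      \<open>P\<close>, so it preserves independence on \<open>S\<close>.\<close>
    have "indep_on S (\<lambda>m x. a x ^ d * monom_fun m x) B" unfolding indep_on_def
    proof (intro allI impI)
      fix c assume c: "\<forall>x\<in>S. (\<Sum>m\<in>B. c m * (a x ^ d * monom_fun m x)) = 0"
      define f where "f = (\<lambda>x. \<Sum>m\<in>B. c m * monom_fun m x)"
      have f: "f \<in> polyfun UNIV" unfolding f_def by (intro polyfun_lincomb monom_fun_polyfun)
      have aU: "a \<in> polyfun UNIV" using a(1) by (rule polyfun_UNIV)
      have "(a ^ d * f) x = (\<Sum>m\<in>B. c m * (a x ^ d * monom_fun m x))" for x
        by (simp add: fun_power_apply f_def sum_distrib_left mult_ac)
      hence "a ^ d * f \<in> P" using S[of "a ^ d * f"] c f aU by (simp add: polyfun_intros)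
      hence "f \<in> P" using prime power_notin[OF aU a(2)] f polyfun_power[OF aU] by blast
      hence "\<forall>x\<in>S. f x = 0" using S f by blast
      thus "\<forall>m\<in>B. c m = 0" using B(2) unfolding indep_on_def f_def by blast
    qed
    hence "card B \<le> card (ME (D0 * d))"
      using Sp_all B(1) finite_subset_mons[OF B(1)] finME unfolding Sp_def
      by (intro indep_on_card_le[of _ _ S "\<lambda>m x. a x ^ d * monom_fun m x" monom_fun]) auto
    also have "\<dots> = (\<Prod>i\<in>UNIV. if i \<in> J then D0 * d + 1 else e)"
      unfolding ME_def by (subst card_PiE) (auto intro!: prod.cong)
    also have "\<dots> = (D0 * d + 1) ^ card J * e ^ card (- J)"
      by (simp add: prod.If_cases Compl_eq)
    also have "\<dots> \<le> ((D0 + 1) * (d + 1)) ^ card J * e ^ card (- J)"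
      by (intro mult_right_mono power_mono) auto
    also have "\<dots> = C * (d + 1) ^ card J" unfolding C_def power_mult_distrib by (simp add: mult_ac)
    finally show ?thesis .
  qed
  thus ?thesis using that by blast
qed

end

section \<open>Zariski closed sets and Krull dimension\<close>

lemma form_add: "f \<in> form d \<Longrightarrow> g \<in> form d \<Longrightarrow> f + g \<in> form d"
  unfolding plus_fun_def by (simp add: form_def spanned_on_add)

lemma form_scale: "f \<in> form d \<Longrightarrow> (\<lambda>x. c * f x) \<in> form d"
  by (simp add: form_def spanned_on_scale)

lemma form_sum: "(\<And>i. i \<in> I \<Longrightarrow> f i \<in> form d) \<Longrightarrow> (\<lambda>x. \<Sum>i\<in>I. f i x) \<in> form d"
  by (simp add: form_def spanned_on_sum)

lemma form_mult:
  assumes "f \<in> form d" "g \<in> form e"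
  shows "(\<lambda>x. f x * g x) \<in> form (d + e)"
proof -
  have mm: "(\<lambda>x. monom_fun m x * monom_fun k x) \<in> form (d + e)" if "m \<in> mons d" "k \<in> mons e" for m k :: "'a \<Rightarrow> nat"
    using monom_fun_form[of "\<lambda>i. m i + k i" "d + e"] that by (simp add: mons_def sum.distrib monom_fun_add[abs_def])
  have f: "spanned_on UNIV monom_fun (mons d) f" and g: "spanned_on UNIV monom_fun (mons e) g"
    using assms by (auto simp: form_def)
  have "(\<lambda>x. monom_fun m x * g x) \<in> form (d + e)" if "m \<in> mons d" for m :: "'a \<Rightarrow> nat"
    unfolding form_def mem_Collect_eq using mm[OF that]
    by (intro spanned_on_mult[OF g]) (simp add: form_def)
  hence "spanned_on UNIV monom_fun (mons (d + e)) (\<lambda>x. g x * f x)"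
    by (intro spanned_on_mult[OF f]) (simp add: form_def mult.commute)
  thus ?thesis by (simp add: form_def mult.commute)
qed

lemma form_const: "(\<lambda>_. c) \<in> form 0"
  using form_scale[OF monom_fun_form[of "\<lambda>_. 0" 0], of c] by (simp add: mons_def)

lemma mons_single: "(\<lambda>i. if i = k then d else 0) \<in> mons d"
  by (simp add: mons_def)

lemma monom_fun_single: "monom_fun (\<lambda>i. if i = k then d else 0) x = x $ k ^ d"
  unfolding monom_fun_def by (subst prod.remove[of _ k]) (auto intro!: prod.neutral)

lemma form_coord_power: "(\<lambda>x. x $ k ^ d) \<in> form d"
  using monom_fun_form[OF mons_single[of k d]] by (simp add: monom_fun_single[abs_def])

lemma form_coord: "(\<lambda>x. x $ k) \<in> form 1"
  using form_coord_power[of k 1] by simp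

lemma form_prod_coords: "(\<lambda>x :: complex^'n::finite. \<Prod>i\<in>UNIV. x $ i) \<in> form CARD('n)"
  using monom_fun_form[of "\<lambda>_ :: 'n. 1" "CARD('n)"] by (simp add: mons_def monom_fun_def[abs_def])

lemma monom_fun_scale: "m \<in> mons d \<Longrightarrow> monom_fun m (c *s x) = c ^ d * monom_fun m x"
  by (simp add: mons_def monom_fun_def power_mult_distrib prod.distrib flip: power_sum)

lemma form_homog: "f \<in> form d \<Longrightarrow> f (c *s x) = c ^ d * f x"
  by (erule formE) (simp add: monom_fun_scale sum_distrib_left mult_ac)

lemma form_peval: "homogeneous d P \<Longrightarrow> peval P \<in> form d"
proof -
  assume "homogeneous d P"
  hence "(\<lambda>x. \<Sum>m\<in>Poly_Mapping.keys P. Poly_Mapping.lookup P m * monom_fun (Poly_Mapping.lookup m) x) \<in> form d"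
    by (intro form_sum form_scale monom_fun_form) (simp add: homogeneous_def mons_def)
  thus ?thesis by (simp add: peval_def[abs_def] monom_fun_def)
qed

lemma ex_peval_form:
  fixes f :: "complex^'n::finite \<Rightarrow> complex"
  assumes "f \<in> form d"
  shows "\<exists>P. homogeneous d P \<and> peval P = f"
proof -
  obtain c where c: "f = (\<lambda>x. \<Sum>m\<in>mons d. c m * monom_fun m x)" using assms by (rule formE)
  have lk: "Poly_Mapping.lookup (Abs_poly_mapping m) = m" for m :: "'n \<Rightarrow> nat"
    by (rule lookup_Abs_poly_mapping) simp
  define P where "P = (\<Sum>m\<in>mons d. Poly_Mapping.single (Abs_poly_mapping m) (c m) :: 'n mpoly)"
  have "peval P = f" by (rule ext) (simp add: P_def peval_sum peval_single lk c monom_fun_def)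
  moreover have "homogeneous d P" unfolding homogeneous_def
  proof
    fix k assume "k \<in> Poly_Mapping.keys P"
    hence "(\<Sum>m\<in>mons d. Poly_Mapping.lookup (Poly_Mapping.single (Abs_poly_mapping m) (c m)) k) \<noteq> 0"
      by (simp add: P_def lookup_sum in_keys_iff)
    then obtain m where "m \<in> mons d" "Poly_Mapping.lookup (Poly_Mapping.single (Abs_poly_mapping m) (c m)) k \<noteq> 0"
      by (rule sum.not_neutral_contains_not_neutral)
    thus "(\<Sum>i\<in>UNIV. Poly_Mapping.lookup k i) = d"
      by (auto simp: lookup_single when_def lk mons_def split: if_splits)
  qed
  ultimately show ?thesis by blast
qed

lemma closedin_zariski_forms:
  "closedin zariski S \<longleftrightarrow> (\<exists>\<F>. (\<forall>f\<in>\<F>. \<exists>d. f \<in> form d) \<and> S = {p. \<forall>f\<in>\<F>. f (coords p) = 0})"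
proof
  assume "closedin zariski S"
  then obtain F where F: "\<forall>P\<in>F. \<exists>d. homogeneous d P" "S = projective_zeros F"
    unfolding closedin_zariski zariski_closed_def by blast
  thus "\<exists>\<F>. (\<forall>f\<in>\<F>. \<exists>d. f \<in> form d) \<and> S = {p. \<forall>f\<in>\<F>. f (coords p) = 0}"
    by (intro exI[of _ "peval ` F"]) (use form_peval in \<open>fastforce simp: projective_zeros_def\<close>)
next
  assume "\<exists>\<F>. (\<forall>f\<in>\<F>. \<exists>d. f \<in> form d) \<and> S = {p. \<forall>f\<in>\<F>. f (coords p) = 0}"
  then obtain \<F> where F: "\<forall>f\<in>\<F>. \<exists>d. f \<in> form d" "S = {p. \<forall>f\<in>\<F>. f (coords p) = 0}" by blast
  hence "\<forall>f\<in>\<F>. \<exists>P d. homogeneous d P \<and> peval P = f" using ex_peval_form by blast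
  then obtain Q where Q: "\<And>f. f \<in> \<F> \<Longrightarrow> (\<exists>d. homogeneous d (Q f)) \<and> peval (Q f) = f" by metis
  have "S = projective_zeros (Q ` \<F>)" using F(2) Q by (auto simp: projective_zeros_def)
  thus "closedin zariski S" unfolding closedin_zariski zariski_closed_def using Q by blast
qed

section \<open>Cones over projective sets, vanishing and irreducibility\<close>

text \<open>The affine cone without its vertex, since \<open>pt\<close> has no meaning at the zero
  vector.\<close>

definition proj_cone :: "'n::finite proj set \<Rightarrow> (complex^'n) set"
  where "proj_cone A = {x. x \<noteq> 0 \<and> pt x \<in> A}"

lemma coords_in_cone: "p \<in> A \<Longrightarrow> coords p \<in> proj_cone A"
  by (simp add: proj_cone_def coords_nonzero)

lemma pt_scale:
  assumes "c \<noteq> 0" "x \<noteq> 0"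
  shows "pt (c *s x) = pt x"
proof -
  have "c *s x \<noteq> 0" using assms by (auto simp: vec_eq_iff)
  thus ?thesis using assms pt_eq_iff[of x "c *s x"] by (metis (no_types))
qed

lemma proj_cone_scale: "x \<in> proj_cone A \<Longrightarrow> c \<noteq> 0 \<Longrightarrow> c *s x \<in> proj_cone A"
  by (auto simp: proj_cone_def pt_scale vec_eq_iff)

lemma form_coords_pt: "f \<in> form d \<Longrightarrow> x \<noteq> 0 \<Longrightarrow> f (coords (pt x)) = 0 \<longleftrightarrow> f x = 0"
  using coords_pt[of x] by (metis form_homog mult_eq_0_iff power_eq_0_iff)

lemma form_vanishes_cone:
  assumes "f \<in> form d"
  shows "(\<forall>x\<in>proj_cone A. f x = 0) \<longleftrightarrow> (\<forall>p\<in>A. f (coords p) = 0)"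
proof (intro iffI ballI)
  fix p assume "\<forall>x\<in>proj_cone A. f x = 0" "p \<in> A"
  thus "f (coords p) = 0" using coords_in_cone by blast
next
  fix x assume "\<forall>p\<in>A. f (coords p) = 0" "x \<in> proj_cone A"
  thus "f x = 0" using form_coords_pt[OF assms, of x] by (simp add: proj_cone_def)
qed

lemma closedin_form: "f \<in> form d \<Longrightarrow> closedin zariski {p. f (coords p) = 0}"
  unfolding closedin_zariski_forms by (intro exI[of _ "{f}"]) auto

lemma closedin_separation:
  assumes "closedin zariski C" "p \<notin> C"
  obtains d f where "f \<in> form d" "\<And>x. x \<in> proj_cone C \<Longrightarrow> f x = 0" "f (coords p) \<noteq> 0"
proof -
  obtain \<F> where F: "\<forall>f\<in>\<F>. \<exists>d. f \<in> form d" "C = {p. \<forall>f\<in>\<F>. f (coords p) = 0}"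
    using assms(1) by (auto simp: closedin_zariski_forms)
  then obtain f d where f: "f \<in> \<F>" "f \<in> form d" "f (coords p) \<noteq> 0" using assms(2) by blast
  have "\<forall>x\<in>proj_cone C. f x = 0" using F(2) f by (subst form_vanishes_cone[OF f(2)]) blast
  thus ?thesis using that f by blast
qed

lemma form_vanishes_closure:
  assumes "f \<in> form d" "\<And>x. x \<in> proj_cone A \<Longrightarrow> f x = 0" "x \<in> proj_cone (zariski closure_of A)"
  shows "f x = 0"
proof -
  have "A \<subseteq> {p. f (coords p) = 0}" using form_vanishes_cone[OF assms(1), of A] assms(2) by blast
  hence "zariski closure_of A \<subseteq> {p. f (coords p) = 0}"
    using closedin_form[OF assms(1)] by (rule closure_of_minimal)
  hence "\<forall>x\<in>proj_cone (zariski closure_of A). f x = 0" using form_vanishes_cone[OF assms(1)] by blast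
  thus ?thesis using assms(3) by blast
qed

text \<open>Irreducibility tested by forms alone. The set need be neither a cone nor closed, so the
  notion also applies to affine charts and to dense subsets.\<close>

definition form_irred :: "(complex^'n::finite) set \<Rightarrow> bool"
  where "form_irred V \<longleftrightarrow> V \<noteq> {} \<and> 0 \<notin> V \<and> (\<forall>d e. \<forall>f\<in>form d. \<forall>g\<in>form e.
    (\<forall>x\<in>V. f x * g x = 0) \<longrightarrow> (\<forall>x\<in>V. f x = 0) \<or> (\<forall>x\<in>V. g x = 0))"

lemma form_irredD:
  assumes "form_irred V" "f \<in> form d" "g \<in> form e" "\<And>x. x \<in> V \<Longrightarrow> f x * g x = 0"
  shows "(\<forall>x\<in>V. f x = 0) \<or> (\<forall>x\<in>V. g x = 0)"
  using assms unfolding form_irred_def by blast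

lemma zero_notin_proj_cone [simp]: "0 \<notin> proj_cone A" by (simp add: proj_cone_def)

lemma irreducible_in_cone:
  assumes "irreducible_in (subtopology zariski W) Z"
  shows "form_irred (proj_cone Z)"
  unfolding form_irred_def
proof (intro conjI allI ballI impI)
  show "proj_cone Z \<noteq> {}" using assms coords_in_cone by (fastforce simp: irreducible_in_def)
  fix d e f g assume f: "f \<in> form d" and g: "g \<in> form e" and fg: "\<forall>x\<in>proj_cone Z. f x * g x = 0"
  have ZW: "Z \<subseteq> W" using assms by (auto simp: irreducible_in_def)
  let ?A = "W \<inter> {p. f (coords p) = 0}" and ?B = "W \<inter> {p. g (coords p) = 0}"
  have "closedin (subtopology zariski W) ?A" "closedin (subtopology zariski W) ?B"
    using closedin_form[OF f] closedin_form[OF g] by (auto intro: closedin_subtopology_Int_closed)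
  moreover have "Z \<subseteq> ?A \<union> ?B" using fg ZW coords_in_cone by fastforce
  ultimately have "Z \<subseteq> ?A \<or> Z \<subseteq> ?B" using assms unfolding irreducible_in_def by blast
  thus "(\<forall>x\<in>proj_cone Z. f x = 0) \<or> (\<forall>x\<in>proj_cone Z. g x = 0)"
    using form_vanishes_cone[OF f, of Z] form_vanishes_cone[OF g, of Z] by blast
qed simp

lemma irreducible_in_if_cone:
  assumes "form_irred (proj_cone Z)" "Z \<subseteq> W"
  shows "irreducible_in (subtopology zariski W) Z"
  unfolding irreducible_in_def
proof (intro conjI allI impI)
  show "Z \<noteq> {}" using assms(1) by (auto simp: form_irred_def proj_cone_def)
  fix A B assume "closedin (subtopology zariski W) A" "closedin (subtopology zariski W) B" and ZAB: "Z \<subseteq> A \<union> B"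
  then obtain A' B' where A': "closedin zariski A'" "A = A' \<inter> W" and B': "closedin zariski B'" "B = B' \<inter> W"
    by (auto simp: closedin_subtopology)
  show "Z \<subseteq> A \<or> Z \<subseteq> B"
  proof (rule ccontr)
    assume "\<not> ?thesis"
    then obtain p q where p: "p \<in> Z" "p \<notin> A'" and q: "q \<in> Z" "q \<notin> B'"
      using A' B' assms(2) by blast
    obtain d f where f: "f \<in> form d" "\<And>x. x \<in> proj_cone A' \<Longrightarrow> f x = 0" "f (coords p) \<noteq> 0"
      using closedin_separation[OF A'(1) p(2)] by blast
    obtain e g where g: "g \<in> form e" "\<And>x. x \<in> proj_cone B' \<Longrightarrow> g x = 0" "g (coords q) \<noteq> 0"
      using closedin_separation[OF B'(1) q(2)] by blast
    have "x \<in> proj_cone A' \<or> x \<in> proj_cone B'" if "x \<in> proj_cone Z" for x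
      using that ZAB A'(2) B'(2) by (auto simp: proj_cone_def)
    hence "f x * g x = 0" if "x \<in> proj_cone Z" for x using f(2) g(2) that by fastforce
    from form_irredD[OF assms(1) f(1) g(1) this] show False
      using coords_in_cone p(1) q(1) f(3) g(3) by blast
  qed
qed (use assms(2) in auto)

lemma hilb_mono: "V \<subseteq> W \<Longrightarrow> hilb V d \<le> hilb W d"
  by (rule hilb_le_if_vanishing) blast

lemma hilb_pos:
  assumes "V \<noteq> {}" "0 \<notin> V"
  shows "hilb V d \<ge> 1"
proof -
  obtain x where "x \<in> V" "x \<noteq> 0" using assms by blast
  then obtain k where k: "x $ k \<noteq> 0" by (auto simp: vec_eq_iff)
  have "indep_on V monom_fun {\<lambda>i. if i = k then d else 0}"
    unfolding indep_on_def using \<open>x \<in> V\<close> k by (auto simp: monom_fun_single)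
  from hilb_geI[OF _ this, of d] show ?thesis using mons_single[of k d] by simp
qed

text \<open>A basis for \<open>V\<close> in degree \<open>d\<close>, multiplied by \<open>F\<close>,
  and a basis for \<open>U\<close> in degree \<open>d + e\<close> are jointly independent on
  \<open>V\<close>: restriction to \<open>U\<close>, where \<open>F\<close> vanishes, kills the
  second group of coefficients, and then irreducibility cancels \<open>F\<close>.\<close>

lemma hilb_strict:
  assumes "form_irred V" "U \<subseteq> V" "F \<in> form e" "\<And>x. x \<in> U \<Longrightarrow> F x = 0" "y \<in> V" "F y \<noteq> 0"
  shows "hilb V d + hilb U (d + e) \<le> hilb V (d + e)"
proof -
  obtain B where B: "B \<subseteq> mons d" "indep_on V monom_fun B" "card B = hilb V d" using hilb_basis .
  obtain B' where B': "B' \<subseteq> mons (d + e)" "indep_on U monom_fun B'" "card B' = hilb U (d + e)" using hilb_basis .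
  have fin: "finite B" "finite B'" using B(1) B'(1) finite_subset_mons by blast+
  define f where "f = case_sum (\<lambda>m x. F x * monom_fun m x) monom_fun"
  have "indep_on V f (B <+> B')" unfolding indep_on_def
  proof (intro allI impI)
    fix c assume "\<forall>x\<in>V. (\<Sum>i\<in>B <+> B'. c i * f i x) = 0"
    hence c: "F x * (\<Sum>m\<in>B. c (Inl m) * monom_fun m x) + (\<Sum>m\<in>B'. c (Inr m) * monom_fun m x) = 0" if "x \<in> V" for x
      using that fin by (simp add: sum.Plus f_def sum_distrib_left mult_ac)
    have "(\<Sum>m\<in>B'. c (Inr m) * monom_fun m x) = 0" if "x \<in> U" for x
      using c[of x] that assms(2,4) by auto
    from indep_onD[OF B'(2) this] have c0: "c (Inr m) = 0" if "m \<in> B'" for m using that by blast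
    have "(\<lambda>x. \<Sum>m\<in>B. c (Inl m) * monom_fun m x) \<in> form d"
      using B(1) by (intro form_sum form_scale monom_fun_form) auto
    from form_irredD[OF assms(1,3) this] have "\<forall>x\<in>V. (\<Sum>m\<in>B. c (Inl m) * monom_fun m x) = 0"
      using c c0 assms(5,6) by auto
    hence "\<forall>m\<in>B. c (Inl m) = 0"
      using B(2)[unfolded indep_on_def, rule_format, of "\<lambda>m. c (Inl m)"] by blast
    thus "\<forall>i\<in>B <+> B'. c i = 0" using c0 by auto
  qed
  moreover have "f i \<in> form (d + e)" if "i \<in> B <+> B'" for i
  proof (cases i)
    case (Inl m)
    thus ?thesis using that B(1) form_mult[OF monom_fun_form[of m d] assms(3)]
      by (auto simp: f_def mult.commute)
  next
    case (Inr m)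
    thus ?thesis using that B'(1) monom_fun_form[of m "d + e"] by (auto simp: f_def)
  qed
  ultimately have "card (B <+> B') \<le> hilb V (d + e)" using fin by (intro hilb_ge) auto
  thus ?thesis using fin B(3) B'(3) by (simp add: card_Plus)
qed

section \<open>Growth forced by chains of irreducible sets\<close>

lemma power_Suc_diff_le:
  fixes x y :: real
  assumes "0 \<le> y" "y \<le> x"
  shows "x ^ Suc n - y ^ Suc n \<le> real (Suc n) * (x - y) * x ^ n"
proof (induction n)
  case (Suc n)
  have "x ^ Suc (Suc n) - y ^ Suc (Suc n) = x * (x ^ Suc n - y ^ Suc n) + (x - y) * y ^ Suc n"
    by (simp add: algebra_simps)
  also have "\<dots> \<le> x * (real (Suc n) * (x - y) * x ^ n) + (x - y) * x ^ Suc n"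
    using Suc assms by (intro add_mono mult_left_mono power_mono) auto
  also have "\<dots> = real (Suc (Suc n)) * (x - y) * x ^ Suc n" by (simp add: algebra_simps)
  finally show ?case .
qed simp

text \<open>Summing increments of order \<open>d ^ k\<close> along steps of length \<open>e\<close>
  gives order \<open>d ^ (k + 1)\<close>.\<close>

lemma growth_step:
  fixes a b :: "nat \<Rightarrow> nat" and c :: real
  assumes c: "c > 0" "\<And>d. c * d ^ k \<le> b d" and a: "\<And>d. a d \<ge> 1" and ab: "\<And>d. a d + b (d + e) \<le> a (d + e)"
    and e: "e > 0"
  shows "\<exists>c'>0. \<forall>d. c' * real d ^ Suc k \<le> a d"
proof -
  \<comment> \<open>The first bound makes the increment of \<open>c' * d ^ (k + 1)\<close> over a
    step of length \<open>e\<close> at most \<open>c * d ^ k\<close>; the second starts the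
    induction, keeping the value below \<open>1\<close> for \<open>d < e\<close>.\<close>
  define c' where "c' = min (c / (real (Suc k) * e)) (1 / real e ^ Suc k)"
  have c': "c' > 0" "c' \<le> c / (real (Suc k) * e)" "c' \<le> 1 / real e ^ Suc k"
    using c(1) e by (auto simp: c'_def intro!: divide_pos_pos mult_pos_pos simp del: of_nat_Suc of_nat_add)
  have "c' * real d ^ Suc k \<le> a d" for d
  proof (induction d rule: less_induct)
    case (less d)
    show ?case
    proof (cases "d < e")
      case True
      have "c' * real d ^ Suc k \<le> c' * real e ^ Suc k"
        using True c'(1) by (intro mult_left_mono power_mono) auto
      also have "\<dots> \<le> 1" using c'(3) e by (simp add: pos_le_divide_eq)
      finally show ?thesis using a[of d] by linarith
    next
      case False
      define y where "y = d - e"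
      have d: "d = y + e" using False by (simp add: y_def)
      have "real d ^ Suc k - real y ^ Suc k \<le> real (Suc k) * (real d - real y) * real d ^ k"
        by (rule power_Suc_diff_le) (simp_all add: d)
      hence "c' * (real d ^ Suc k - real y ^ Suc k) \<le> c' * (real (Suc k) * e * real d ^ k)"
        using c'(1) by (intro mult_left_mono) (auto simp: d)
      also have "\<dots> = (c' * (real (Suc k) * e)) * real d ^ k" by (simp add: mult_ac)
      also have "\<dots> \<le> c * real d ^ k"
        using c'(2) e by (intro mult_right_mono) (auto simp: pos_le_divide_eq)
      also have "\<dots> \<le> b d" by (rule c)
      finally have "c' * real d ^ Suc k \<le> c' * real y ^ Suc k + b d" by (simp add: right_diff_distrib)
      also have "c' * real y ^ Suc k \<le> a y" using less[of y] e by (simp add: d)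
      also have "real (a y) + real (b d) \<le> a d" using ab[of y] d by (metis of_nat_add of_nat_le_iff)
      finally show ?thesis by simp
    qed
  qed
  thus ?thesis using c'(1) by blast
qed

definition irred_chain :: "'n::finite proj set \<Rightarrow> nat \<Rightarrow> (nat \<Rightarrow> 'n proj set) \<Rightarrow> bool"
  where "irred_chain W k Z \<longleftrightarrow> (\<forall>i\<le>k. closedin (subtopology zariski W) (Z i) \<and> irreducible_in (subtopology zariski W) (Z i)) \<and>
    (\<forall>i<k. Z i \<subset> Z (Suc i))"

lemma zariski_dim_eq: "zariski_dim W = Sup {k. \<exists>Z. irred_chain W k Z}"
  by (simp add: zariski_dim_def krull_dim_def irred_chain_def)

lemma irred_chain_growth:
  assumes "irred_chain W k Z"
  shows "\<exists>c>0. \<forall>d. c * real d ^ k \<le> hilb (proj_cone (Z k)) d"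
  using assms
proof (induction k)
  case 0
  hence "form_irred (proj_cone (Z 0))" by (auto simp: irred_chain_def intro: irreducible_in_cone)
  hence "1 \<le> hilb (proj_cone (Z 0)) d" for d by (intro hilb_pos) (auto simp: form_irred_def)
  thus ?case by (intro exI[of _ 1]) auto
next
  case (Suc k)
  have "irred_chain W k Z" using Suc.prems by (auto simp: irred_chain_def)
  then obtain c where c: "c > 0" "\<And>d. c * real d ^ k \<le> hilb (proj_cone (Z k)) d" using Suc.IH by blast
  have cl: "closedin (subtopology zariski W) (Z k)" and sub: "Z k \<subset> Z (Suc k)"
    and irr: "form_irred (proj_cone (Z k))" "form_irred (proj_cone (Z (Suc k)))"
    using Suc.prems irreducible_in_cone[of W] by (simp_all add: irred_chain_def)
  have "Z (Suc k) \<subseteq> W" using Suc.prems by (auto simp: irred_chain_def irreducible_in_def)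
  moreover obtain C where C: "closedin zariski C" "Z k = C \<inter> W" using cl by (auto simp: closedin_subtopology)
  moreover obtain p where p: "p \<in> Z (Suc k)" "p \<notin> Z k" using sub by blast
  ultimately have "p \<notin> C" by blast
  then obtain e F where F: "F \<in> form e" "\<And>x. x \<in> proj_cone C \<Longrightarrow> F x = 0" "F (coords p) \<noteq> 0"
    using closedin_separation[OF C(1)] by metis
  have F0: "F x = 0" if "x \<in> proj_cone (Z k)" for x using F(2) that C(2) by (simp add: proj_cone_def)
  \<comment> \<open>A form of degree \<open>0\<close> is constant, so it could not vanish on the
    nonempty smaller set and be nonzero at \<open>p\<close>.\<close>
  have e: "e > 0"
  proof (rule ccontr)
    assume "\<not> e > 0"
    then have "F \<in> form 0" using F(1) by simp
    then obtain b where "F = (\<lambda>x. \<Sum>m\<in>mons 0. b m * monom_fun m x)" by (rule formE)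
    moreover have "mons 0 = {\<lambda>_ :: 'a. 0}" by (auto simp: mons_def)
    ultimately have "F x = b (\<lambda>_. 0)" for x by simp
    moreover obtain x where "x \<in> proj_cone (Z k)" using irr by (auto simp: form_irred_def)
    ultimately show False using F0[of x] F(3) by simp
  qed
  have "proj_cone (Z k) \<subseteq> proj_cone (Z (Suc k))" using sub by (auto simp: proj_cone_def)
  hence "hilb (proj_cone (Z (Suc k))) d + hilb (proj_cone (Z k)) (d + e) \<le> hilb (proj_cone (Z (Suc k))) (d + e)" for d
    using irr(2) F(1,3) F0 coords_in_cone[OF p(1)] by (intro hilb_strict) auto
  moreover have "1 \<le> hilb (proj_cone (Z (Suc k))) d" for d
    using irr(2) by (intro hilb_pos) (auto simp: form_irred_def)
  ultimately show ?case using growth_step[OF c] e by blast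
qed

text \<open>The constants are absorbed by one large \<open>d\<close>: from
  \<open>d + 1 \<le> 2 * d\<close> a larger left exponent would give
  \<open>c * d \<le> C * 2 ^ q\<close>, which fails for \<open>d\<close> beyond
  \<open>C * 2 ^ q / c\<close>.\<close>

lemma power_growth_le:
  fixes c C :: real
  assumes "c > 0" "\<And>d. c * real d ^ p \<le> C * real (d + 1) ^ q"
  shows "p \<le> q"
proof (rule ccontr)
  assume "\<not> p \<le> q"
  obtain N :: nat where N: "C * 2 ^ q / c < N" using reals_Archimedean2 by blast
  define d where "d = Suc N"
  have d: "real d > 0" by (simp add: d_def)
  have C: "C \<ge> 0"
  proof -
    have "0 \<le> C * real (1 + 1) ^ q" by (rule order.trans[OF _ assms(2)]) (use assms(1) in auto)
    moreover have "real (1 + 1) ^ q > 0" by (intro zero_less_power) simp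
    ultimately show ?thesis by (meson zero_le_mult_iff not_le)
  qed
  have "real d * real d ^ q \<le> real d ^ p"
    using power_increasing[of "Suc q" p "real d"] \<open>\<not> p \<le> q\<close> by (simp add: d_def)
  hence "c * (real d * real d ^ q) \<le> c * real d ^ p" using assms(1) by simp
  also have "\<dots> \<le> C * real (d + 1) ^ q" by (rule assms(2))
  also have "\<dots> \<le> C * (2 * real d) ^ q" using C by (intro mult_left_mono power_mono) (auto simp: d_def)
  finally have "(c * real d) * real d ^ q \<le> (C * 2 ^ q) * real d ^ q" by (simp add: power_mult_distrib mult_ac)
  hence "c * real d \<le> C * 2 ^ q" using d by (simp add: mult_le_cancel_right)
  hence "real d \<le> C * 2 ^ q / c" using assms(1) by (simp add: pos_le_divide_eq mult.commute)
  thus False using N by (simp add: d_def)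
qed

lemma irred_chain_sub: "irred_chain W k Z \<Longrightarrow> Z k \<subseteq> W"
  by (auto simp: irred_chain_def irreducible_in_def)

lemma proj_cone_mono: "A \<subseteq> B \<Longrightarrow> proj_cone A \<subseteq> proj_cone B"
  by (auto simp: proj_cone_def)

text \<open>Chain length is bounded because growth cannot exceed the number of all monomials.
  Boundedness is what gives the supremum in the natural numbers its intended meaning.\<close>

lemma finite_chain_lengths: "finite {k. \<exists>Z. irred_chain (W :: 'n::finite proj set) k Z}"
proof (rule finite_subset)
  show "{k. \<exists>Z. irred_chain W k Z} \<subseteq> {..CARD('n)}"
  proof clarify
    fix k Z assume "irred_chain W k Z"
    then obtain c where c: "c > 0" "\<And>d. c * real d ^ k \<le> hilb (proj_cone (Z k)) d" using irred_chain_growth by blast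
    have "c * real d ^ k \<le> 1 * real (d + 1) ^ CARD('n)" for d
      using c(2)[of d] hilb_le[of "proj_cone (Z k)" d] of_nat_mono[of "hilb (proj_cone (Z k)) d" "(d + 1) ^ CARD('n)", where 'a = real]
      by simp
    thus "k \<le> CARD('n)" by (rule power_growth_le[OF c(1)])
  qed
qed simp

lemma zariski_dim_ge: "irred_chain W k Z \<Longrightarrow> k \<le> zariski_dim W"
  unfolding zariski_dim_eq by (intro cSup_upper bdd_above_finite finite_chain_lengths) blast

lemma zariski_dim_growth:
  assumes "W \<noteq> {}"
  shows "\<exists>c>0. \<forall>d. c * real d ^ zariski_dim W \<le> hilb (proj_cone W) d"
proof (cases "{k. \<exists>Z. irred_chain W k Z} = {}")
  case True
  \<comment> \<open>The supremum of the empty set of naturals is \<open>0\<close>, and growth of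
    order \<open>d ^ 0\<close> holds for any nonempty cone.\<close>
  hence "zariski_dim W = 0" by (simp add: zariski_dim_eq Sup_nat_def)
  moreover have "proj_cone W \<noteq> {}" using assms coords_in_cone by blast
  hence "1 \<le> hilb (proj_cone W) d" for d by (intro hilb_pos) auto
  ultimately show ?thesis by (intro exI[of _ 1]) auto
next
  case False
  hence "Max {k. \<exists>Z. irred_chain W k Z} \<in> {k. \<exists>Z. irred_chain W k Z}"
    using finite_chain_lengths[of W] by (rule Max_in[rotated])
  hence "zariski_dim W \<in> {k. \<exists>Z. irred_chain W k Z}"
    unfolding zariski_dim_eq Sup_nat_def by (simp only: False if_False)
  then obtain Z where Z: "irred_chain W (zariski_dim W) Z" by blast
  obtain c where c: "c > 0" "\<And>d. c * real d ^ zariski_dim W \<le> hilb (proj_cone (Z (zariski_dim W))) d"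
    using irred_chain_growth[OF Z] by blast
  have "c * real d ^ zariski_dim W \<le> hilb (proj_cone W) d" for d
    using c(2)[of d] hilb_mono[OF proj_cone_mono[OF irred_chain_sub[OF Z]], of d] by linarith
  thus ?thesis using c(1) by blast
qed

section \<open>Upper bounds for Hilbert functions from an affine chart\<close>

lemma form_vanishes_pt_image:
  assumes "f \<in> form d" "0 \<notin> S"
  shows "(\<forall>x\<in>proj_cone (pt ` S). f x = 0) \<longleftrightarrow> (\<forall>x\<in>S. f x = 0)"
proof -
  have "f (coords (pt x)) = 0 \<longleftrightarrow> f x = 0" if "x \<in> S" for x
    using form_coords_pt[OF assms(1), of x] assms(2) that by metis
  thus ?thesis by (simp add: form_vanishes_cone[OF assms(1)])
qed

text \<open>Irreducibility depends only on which forms vanish, so it passes between a cone, a chart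
  of it and a closure.\<close>

lemma form_irred_cong:
  assumes "form_irred U" "V \<noteq> {}" "0 \<notin> V"
    and "\<And>d f. f \<in> form d \<Longrightarrow> (\<forall>x\<in>U. f x = 0) \<longleftrightarrow> (\<forall>x\<in>V. f x = 0)"
  shows "form_irred V"
  unfolding form_irred_def
proof (intro conjI allI ballI impI assms(2,3))
  fix d e f g assume fg: "f \<in> form d" "g \<in> form e" "\<forall>x\<in>V. f x * g x = 0"
  hence "\<forall>x\<in>U. f x * g x = 0" using assms(4)[OF form_mult[OF fg(1,2)]] by blast
  from form_irredD[OF assms(1) fg(1,2)] this
  show "(\<forall>x\<in>V. f x = 0) \<or> (\<forall>x\<in>V. g x = 0)"
    using assms(4)[OF fg(1)] assms(4)[OF fg(2)] by blast
qed

text \<open>On the chart \<open>x_k = 1\<close>, powers of \<open>x_k\<close> are invisible and can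
  be used to equalise the degrees of summands.\<close>

lemma homogenize:
  assumes "f \<in> polyfun UNIV"
  shows "\<exists>d. \<exists>g\<in>form d. \<forall>x. x $ k = 1 \<longrightarrow> g x = f x"
  using assms
proof (induction rule: polyfun.induct)
  case (const c)
  show ?case by (intro exI[of _ 0] bexI[OF _ form_const[of c]]) simp
next
  case (coord i)
  show ?case by (intro exI[of _ 1] bexI[OF _ form_coord[of i]]) simp
next
  case (add f g)
  then obtain d f' e g' where *: "f' \<in> form d" "\<forall>x. x $ k = 1 \<longrightarrow> f' x = f x"
    "g' \<in> form e" "\<forall>x. x $ k = 1 \<longrightarrow> g' x = g x" by blast
  have "(\<lambda>x. f' x * x $ k ^ e) + (\<lambda>x. x $ k ^ d * g' x) \<in> form (d + e)"
    by (intro form_add form_mult form_coord_power *)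
  thus ?case using * by (intro exI[of _ "d + e"], elim bexI[rotated]) simp
next
  case (mult f g)
  then obtain d f' e g' where *: "f' \<in> form d" "\<forall>x. x $ k = 1 \<longrightarrow> f' x = f x"
    "g' \<in> form e" "\<forall>x. x $ k = 1 \<longrightarrow> g' x = g x" by blast
  have "(\<lambda>x. f' x * g' x) \<in> form (d + e)" by (intro form_mult *)
  thus ?case using * by (intro exI[of _ "d + e"], elim bexI[rotated]) simp
qed

lemma torus_coord_nz: "x \<noteq> 0 \<Longrightarrow> pt x \<in> carrier torus \<Longrightarrow> x $ i \<noteq> 0"
  using mem_torus_pt by blast

text \<open>No coordinate vanishes on the torus, so a single chart, for any \<open>k\<close>, covers
  a subset of it.\<close>

lemma torus_chart:
  assumes "A \<subseteq> carrier torus"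
  shows "A = pt ` {x \<in> proj_cone A. x $ k = 1}"
proof
  show "A \<subseteq> pt ` {x \<in> proj_cone A. x $ k = 1}"
  proof
    fix p assume p: "p \<in> A"
    have "coords p $ k \<noteq> 0"
      using torus_coord_nz[OF coords_nonzero, of p] p assms by auto
    moreover from this have "inverse (coords p $ k) *s coords p \<in> proj_cone A"
      by (intro proj_cone_scale coords_in_cone p) simp
    moreover from calculation have "pt (inverse (coords p $ k) *s coords p) = p"
      by (subst pt_scale) (auto simp: coords_nonzero)
    ultimately show "p \<in> pt ` {x \<in> proj_cone A. x $ k = 1}"
      by (intro image_eqI[of _ _ "inverse (coords p $ k) *s coords p"]) auto
  qed
qed (auto simp: proj_cone_def)

text \<open>Homogenisation replaces arbitrary polynomials by forms with the same values on the
  chart, and for forms irreducibility is available.\<close>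

lemma prime_fun_ideal_of_irred:
  fixes S :: "(complex^'n::finite) set"
  assumes irr: "form_irred S" and S: "\<And>x. x \<in> S \<Longrightarrow> x $ k = 1"
  shows "prime_fun_ideal {f \<in> polyfun UNIV. \<forall>x\<in>S. f x = 0}"
proof
  show "1 \<notin> {f \<in> polyfun UNIV. \<forall>x\<in>S. f x = 0}" using irr by (auto simp: form_irred_def)
  fix f g :: "complex^'n \<Rightarrow> complex"
  assume fg: "f \<in> polyfun UNIV" "g \<in> polyfun UNIV" "f * g \<in> {f \<in> polyfun UNIV. \<forall>x\<in>S. f x = 0}"
  obtain d f' where f': "f' \<in> form d" "\<And>x. x $ k = 1 \<Longrightarrow> f' x = f x" using homogenize[OF fg(1)] by blast
  obtain e g' where g': "g' \<in> form e" "\<And>x. x $ k = 1 \<Longrightarrow> g' x = g x" using homogenize[OF fg(2)] by blast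
  have "f' x * g' x = 0" if "x \<in> S" for x using f'(2) g'(2) fg(3) S[OF that] that by auto
  from form_irredD[OF irr f'(1) g'(1) this]
  show "f \<in> {f \<in> polyfun UNIV. \<forall>x\<in>S. f x = 0} \<or> g \<in> {f \<in> polyfun UNIV. \<forall>x\<in>S. f x = 0}"
    using fg(1,2) f'(2) g'(2) S by auto
qed (auto intro: polyfun_intros)

text \<open>A maximal independent set \<open>J\<close> of coordinates on a chart of \<open>A\<close>
  bounds the growth by its cardinality and also yields a chain of that length. The chain is closed
  up inside a possibly larger \<open>W\<close>, which covers both a subtorus (\<open>W = A\<close>)
  and a variety whose torus part is \<open>A\<close>.\<close>

lemma hilb_upper_bound:
  fixes A W :: "'n::finite proj set"
  assumes A: "A = C \<inter> carrier torus" "closedin zariski C" and irr: "form_irred (proj_cone A)" and AW: "A \<subseteq> W"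
  obtains K where "\<And>d. hilb (proj_cone A) d \<le> K * (d + 1) ^ zariski_dim W"
proof -
  define k :: 'n where "k = undefined"
  define S where "S = {x \<in> proj_cone A. x $ k = 1}"
  have AS: "A = pt ` S" unfolding S_def using A(1) by (intro torus_chart) blast
  have S0: "0 \<notin> S" and S1: "\<And>x. x \<in> S \<Longrightarrow> x $ k = 1" by (auto simp: S_def)
  have van: "(\<forall>x\<in>proj_cone A. f x = 0) \<longleftrightarrow> (\<forall>x\<in>S. f x = 0)" if "f \<in> form d" for d f
    unfolding AS by (rule form_vanishes_pt_image[OF that S0])
  have "S \<noteq> {}" using irr AS by (auto simp: form_irred_def proj_cone_def)
  hence irrS: "form_irred S" using S0 van by (intro form_irred_cong[OF irr]) auto
  define P where "P = {f \<in> polyfun UNIV. \<forall>x\<in>S. f x = 0}"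
  interpret P: prime_fun_ideal P unfolding P_def by (rule prime_fun_ideal_of_irred[OF irrS S1])
  have "P.alg_indep {}" unfolding P.alg_indep_def
  proof
    fix f assume f: "f \<in> P \<inter> polyfun {}"
    then obtain c where c: "f = (\<lambda>_. c)" using polyfun_empty by blast
    hence "c = 0" using f P.const_notin by auto
    thus "f \<in> {0}" using c by (simp add: zero_fun_def)
  qed
  hence "\<exists>J\<in>{J. P.alg_indep J}. \<forall>J'\<in>{J. P.alg_indep J}. J \<subseteq> J' \<longrightarrow> J = J'"
    by (intro finite_has_maximal) auto
  then obtain J where J: "P.alg_indep J" "\<And>J'. P.alg_indep J' \<Longrightarrow> J \<subseteq> J' \<Longrightarrow> J = J'" by blast
  have P_iff: "f \<in> P \<longleftrightarrow> (\<forall>x\<in>S. f x = 0)" if "f \<in> polyfun UNIV" for f using that by (simp add: P_def)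
  have max: "\<not> P.alg_indep (insert j J)" if "j \<notin> J" for j using J(2)[of "insert j J"] that by blast
  obtain K where K: "\<And>d B. B \<subseteq> mons d \<Longrightarrow> indep_on S monom_fun B \<Longrightarrow> card B \<le> K * (d + 1) ^ card J"
    using P.indep_card_bound[OF P_iff J(1) max] by blast
  have hilb: "hilb (proj_cone A) d \<le> K * (d + 1) ^ card J" for d
  proof -
    have "hilb (proj_cone A) d \<le> hilb S d" using van by (intro hilb_le_if_vanishing) blast
    also obtain B where B: "B \<subseteq> mons d" "indep_on S monom_fun B" "card B = hilb S d" using hilb_basis .
    have "hilb S d \<le> K * (d + 1) ^ card J" using K[OF B(1,2)] B(3) by simp
    finally show ?thesis .
  qed

  \<comment> \<open>Its nonvanishing locus is the set of vectors representing points of the torus;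
    primes avoiding \<open>b\<close> have zeros there.\<close>
  define b :: "complex^'n \<Rightarrow> complex" where "b = (\<lambda>x. \<Prod>i\<in>UNIV. x $ i)"
  have bU: "b \<in> polyfun UNIV" unfolding b_def by (rule form_polyfun[OF form_prod_coords])
  have b_nz: "b x \<noteq> 0 \<longleftrightarrow> (\<forall>i. x $ i \<noteq> 0)" for x by (simp add: b_def)
  obtain x where x: "x \<in> S" using \<open>S \<noteq> {}\<close> by blast
  hence "b x \<noteq> 0" using A(1) torus_coord_nz[of x] unfolding b_nz by (auto simp: S_def proj_cone_def)
  hence bP: "b \<notin> P" using x by (auto simp: P_def)
  obtain Q where Q: "\<And>i. i \<le> card J \<Longrightarrow> prime_fun_ideal (Q i) \<and> P \<subseteq> Q i \<and> b \<notin> Q i"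
    "\<And>i. i < card J \<Longrightarrow> Q (Suc i) \<subset> Q i"
    using prime_chain[OF _ P.prime_fun_ideal_axioms J(1) bU bP] by auto
  \<comment> \<open>The zeros of \<open>Q i\<close> on the chart that lie over the torus. The next
    definition takes their closure within \<open>W\<close>.\<close>
  define T where "T i = {x. x $ k = 1 \<and> b x \<noteq> 0 \<and> (\<forall>f\<in>Q i. f x = 0)}" for i
  define Z where "Z i = zariski closure_of (pt ` T i) \<inter> W" for i
  have T0: "0 \<notin> T i" and T1: "\<And>x. x \<in> T i \<Longrightarrow> x $ k = 1" for i by (auto simp: T_def)
  have TA: "pt ` T i \<subseteq> A" if i: "i \<le> card J" for i
  proof
    fix p assume "p \<in> pt ` T i"
    then obtain y where y: "y \<in> T i" "p = pt y" by blast
    hence y0: "y \<noteq> 0" using T0 by metis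
    have "p \<in> C"
    proof (rule ccontr)
      assume "p \<notin> C"
      then obtain d F where F: "F \<in> form d" "\<And>x. x \<in> proj_cone C \<Longrightarrow> F x = 0" "F (coords p) \<noteq> 0"
        using closedin_separation[OF A(2)] by metis
      \<comment> \<open>Forms vanishing on \<open>C\<close> vanish on \<open>S\<close>, hence belong
        to every \<open>Q i\<close>. So the smaller zero sets remain inside
        \<open>C\<close>.\<close>
      have "F \<in> P" using F(2) A(1) form_polyfun[OF F(1)] by (auto simp: P_def S_def proj_cone_def)
      hence "F y = 0" using Q(1)[OF i] y(1) by (auto simp: T_def)
      thus False using F(3) form_coords_pt[OF F(1) y0] y(2) by simp
    qed
    moreover have "p \<in> carrier torus" using mem_torus_pt[OF y0] y by (auto simp: T_def b_nz)
    ultimately show "p \<in> A" using A(1) by blast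
  qed
  have Q_eq: "Q i = {f \<in> polyfun UNIV. \<forall>x\<in>T i. f x = 0}" if i: "i \<le> card J" for i
  proof -
    interpret Q: prime_fun_ideal "Q i" using Q(1)[OF i] by blast
    have "f \<in> Q i" if f: "f \<in> polyfun UNIV" "\<forall>x\<in>T i. f x = 0" for f
    proof (rule ccontr)
      assume "f \<notin> Q i"
      \<comment> \<open>Multiplying by \<open>b\<close> makes the zero supplied by the
        Nullstellensatz lie over the torus. Thus the part of the zero set over the torus already
        determines \<open>Q i\<close>.\<close>
      hence "f * b \<notin> Q i" using Q.prime[OF f(1) bU] Q(1)[OF i] by blast
      then obtain v where v: "v \<in> Q.zeros" "(f * b) v \<noteq> 0"
        using Q.nullstellensatz[OF polyfun.mult[OF f(1) bU]] by blast
      have "(\<lambda>x. x $ k) - 1 \<in> P" using S1 by (auto simp: P_def intro!: polyfun_intros)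
      hence "v $ k = 1" using v(1) Q(1)[OF i] by (fastforce simp: Q.zeros_def)
      hence "v \<in> T i" using v by (auto simp: T_def Q.zeros_def)
      thus False using f(2) v(2) by simp
    qed
    thus ?thesis using Q.sub by (auto simp: T_def)
  qed
  have T_irr: "form_irred (T i)" if i: "i \<le> card J" for i
    unfolding form_irred_def
  proof (intro conjI allI ballI impI T0)
    interpret Q: prime_fun_ideal "Q i" using Q(1)[OF i] by blast
    show "T i \<noteq> {}" using Q.one Q_eq[OF i] polyfun_1 by auto
    fix d e f g assume fg: "f \<in> form d" "g \<in> form e" "\<forall>x\<in>T i. f x * g x = 0"
    hence U: "f \<in> polyfun UNIV" "g \<in> polyfun UNIV" by (auto intro: form_polyfun)
    have "f * g \<in> Q i" unfolding Q_eq[OF i] using fg(3) polyfun.mult[OF U] by simp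
    hence "f \<in> Q i \<or> g \<in> Q i" using Q.prime U by blast
    thus "(\<forall>x\<in>T i. f x = 0) \<or> (\<forall>x\<in>T i. g x = 0)" unfolding Q_eq[OF i] by blast
  qed
  have ZT: "(\<forall>x\<in>T i. f x = 0) \<longleftrightarrow> (\<forall>x\<in>proj_cone (Z i). f x = 0)" if "i \<le> card J" "f \<in> form d" for i d f
  proof -
    have "pt ` T i \<subseteq> Z i"
      using TA[OF that(1)] AW closure_of_subset[of "pt ` T i" zariski] by (auto simp: Z_def)
    moreover have "\<forall>x\<in>proj_cone (Z i). f x = 0" if "\<forall>x\<in>proj_cone (pt ` T i). f x = 0"
      using form_vanishes_closure[OF \<open>f \<in> form d\<close>] that by (auto simp: Z_def proj_cone_def)
    ultimately show ?thesis
      using form_vanishes_pt_image[OF that(2) T0, of i] proj_cone_mono[of "pt ` T i" "Z i"] by blast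
  qed
  have Z_irr: "form_irred (proj_cone (Z i))" if i: "i \<le> card J" for i
  proof (rule form_irred_cong[OF T_irr[OF i]])
    have "pt ` T i \<subseteq> Z i"
      using TA[OF i] AW closure_of_subset[of "pt ` T i" zariski] by (auto simp: Z_def)
    moreover obtain y where "y \<in> T i" using T_irr[OF i] by (auto simp: form_irred_def)
    ultimately have "pt y \<in> Z i" by blast
    thus "proj_cone (Z i) \<noteq> {}" using coords_in_cone by blast
  qed (simp, rule ZT[OF i])
  have "irred_chain W (card J) Z" unfolding irred_chain_def
  proof (intro conjI allI impI)
    fix i assume i: "i \<le> card J"
    show "closedin (subtopology zariski W) (Z i)"
      unfolding Z_def closedin_subtopology using closedin_closure_of by blast
    show "irreducible_in (subtopology zariski W) (Z i)"
      using Z_irr[OF i] by (rule irreducible_in_if_cone) (auto simp: Z_def)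
  next
    fix i assume i: "i < card J"
    have "T i \<subseteq> T (Suc i)" using Q(2)[OF i] by (auto simp: T_def)
    hence "Z i \<subseteq> Z (Suc i)" unfolding Z_def by (intro Int_mono closure_of_mono image_mono) auto
    moreover have "Z i \<noteq> Z (Suc i)"
    proof
      assume eq: "Z i = Z (Suc i)"
      obtain f where f: "f \<in> Q i" "f \<notin> Q (Suc i)" using Q(2)[OF i] by blast
      hence fU: "f \<in> polyfun UNIV" using Q_eq[of i] i by auto
      \<comment> \<open>Closed projective sets only see forms, so the function separating two
        consecutive ideals is homogenised before the sets are compared.\<close>
      obtain d g where g: "g \<in> form d" "\<And>x. x $ k = 1 \<Longrightarrow> g x = f x" using homogenize[OF fU] by blast
      have gf: "g x = f x" if "x \<in> T j" for x j using g(2) T1 that by blast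
      have "\<forall>x\<in>T i. f x = 0" using f(1) by (simp add: T_def)
      hence "\<forall>x\<in>T i. g x = 0" using gf by simp
      hence "\<forall>x\<in>T (Suc i). g x = 0" using ZT[OF _ g(1), of i] ZT[OF _ g(1), of "Suc i"] i eq by simp
      hence "\<forall>x\<in>T (Suc i). f x = 0" using gf by simp
      hence "f \<in> Q (Suc i)" using Q_eq[of "Suc i"] i fU by simp
      thus False using f(2) by blast
    qed
    ultimately show "Z i \<subset> Z (Suc i)" by blast
  qed
  hence J_dim: "card J \<le> zariski_dim W" by (rule zariski_dim_ge)
  have "hilb (proj_cone A) d \<le> K * (d + 1) ^ zariski_dim W" for d
    using hilb[of d] power_increasing[OF J_dim, of "d + 1"] mult_le_mono2 by (meson le_add2 order.trans)
  thus ?thesis using that by blast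
qed

section \<open>Hilbert functions of Hadamard products\<close>

definition hmul :: "complex^'n \<Rightarrow> complex^'n \<Rightarrow> complex^'n"
  where "hmul x y = (\<chi> i. x $ i * y $ i)"

definition vinv :: "complex^'n \<Rightarrow> complex^'n"
  where "vinv x = (\<chi> i. inverse (x $ i))"

lemma hmul_nth [simp]: "hmul x y $ i = x $ i * y $ i" by (simp add: hmul_def)

lemma vinv_nth [simp]: "vinv x $ i = inverse (x $ i)" by (simp add: vinv_def)

lemma monom_fun_hmul: "monom_fun m (hmul x y) = monom_fun m x * monom_fun m y"
  unfolding hmul_def by (rule monom_fun_times)

lemma form_hmul: "f \<in> form d \<Longrightarrow> (\<lambda>x. f (hmul x y)) \<in> form d"
proof (elim formE)
  fix c assume f: "f = (\<lambda>x. \<Sum>m\<in>mons d. c m * monom_fun m x)"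
  have "(\<lambda>x. \<Sum>m\<in>mons d. (c m * monom_fun m y) * monom_fun m x) \<in> form d"
    by (intro form_sum form_scale monom_fun_form)
  thus ?thesis by (simp add: f monom_fun_hmul mult_ac)
qed

lemma spanned_on_tensor:
  assumes "spanned_on V f I g" "spanned_on V' f' I' g'"
  shows "spanned_on (V \<times> V') (\<lambda>(i, i') (x, x'). f i x * f' i' x') (I \<times> I') (\<lambda>(x, x'). g x * g' x')"
proof -
  obtain c c' where c: "\<forall>x\<in>V. g x = (\<Sum>i\<in>I. c i * f i x)" "\<forall>x\<in>V'. g' x = (\<Sum>i\<in>I'. c' i * f' i x)"
    using assms unfolding spanned_on_def by blast
  show ?thesis unfolding spanned_on_def
  proof (intro exI[of _ "\<lambda>(i, i'). c i * c' i'"] ballI)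
    fix z assume "z \<in> V \<times> V'"
    then obtain x x' where z: "z = (x, x')" "x \<in> V" "x' \<in> V'" by blast
    have "g x * g' x' = (\<Sum>i\<in>I. \<Sum>i'\<in>I'. (c i * f i x) * (c' i' * f' i' x'))"
      using c z by (simp add: sum_product)
    also have "\<dots> = (\<Sum>p\<in>I \<times> I'. case p of (i, i') \<Rightarrow> (c i * f i x) * (c' i' * f' i' x'))"
      by (rule sum.cartesian_product)
    also have "\<dots> = (\<Sum>p\<in>I \<times> I'. (case p of (i, i') \<Rightarrow> c i * c' i') * (case p of (i, i') \<Rightarrow> \<lambda>(x, x'). f i x * f' i' x') z)"
      by (intro sum.cong) (auto simp: z)
    finally show "(case z of (x, x') \<Rightarrow> g x * g' x') =
      (\<Sum>p\<in>I \<times> I'. (case p of (i, i') \<Rightarrow> c i * c' i') * (case p of (i, i') \<Rightarrow> \<lambda>(x, x'). f i x * f' i' x') z)"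
      by (simp add: z)
  qed
qed

text \<open>The group \<open>K\<close> acts on \<open>U \<times> V\<close> by \<open>h \<cdot> (x, y) = (h x, h\<inverse> y)\<close>.  A form in \<open>x y\<close> is invariant and a
  monomial in \<open>x\<close> transforms by a character of \<open>K\<close>, so products of the former with monomials that are
  independent on \<open>K\<close> are independent on \<open>U \<times> V\<close>.\<close>

lemma hilb_hmul:
  fixes U V K :: "(complex^'n::finite) set"
  assumes U: "form_irred U" "u \<in> U" "\<And>i. u $ i \<noteq> 0"
    and K: "\<And>h i. h \<in> K \<Longrightarrow> h $ i \<noteq> 0"
    and act: "\<And>h x. h \<in> K \<Longrightarrow> x \<in> U \<Longrightarrow> hmul h x \<in> U" "\<And>h y. h \<in> K \<Longrightarrow> y \<in> V \<Longrightarrow> hmul (vinv h) y \<in> V"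
  shows "hilb {hmul x y | x y. x \<in> U \<and> y \<in> V} d * hilb K d \<le> hilb U (d + d) * hilb V d"
proof -
  let ?W = "{hmul x y | x y. x \<in> U \<and> y \<in> V}"
  obtain B where B: "B \<subseteq> mons d" "indep_on ?W monom_fun B" "card B = hilb ?W d" using hilb_basis .
  obtain C where C: "C \<subseteq> mons d" "indep_on K monom_fun C" "card C = hilb K d" using hilb_basis .
  obtain M where M: "M \<subseteq> mons (d + d)" "card M \<le> hilb U (d + d)"
    "\<And>f. f \<in> form (d + d) \<Longrightarrow> spanned_on U monom_fun M f" using hilb_spanning by blast
  obtain N where N: "N \<subseteq> mons d" "card N \<le> hilb V d"
    "\<And>f. f \<in> form d \<Longrightarrow> spanned_on V monom_fun N f" using hilb_spanning by blast
  have fin: "finite B" "finite C" "finite M" "finite N"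
    using B(1) C(1) M(1) N(1) finite_subset_mons by blast+
  \<comment> \<open>A degree \<open>d\<close> monomial \<open>m\<close> in \<open>x y\<close> times
    a degree \<open>d\<close> monomial \<open>k\<close> in \<open>x\<close>: degree
    \<open>d + d\<close> in \<open>x\<close> and \<open>d\<close> in \<open>y\<close>, which
    explains the arguments of \<open>hilb\<close> on the right-hand side.\<close>
  define f where "f = (\<lambda>(k, m :: 'n \<Rightarrow> nat). \<lambda>(x, y). (monom_fun m x * monom_fun k x) * monom_fun m y :: complex)"
  define g where "g = (\<lambda>(i, j :: 'n \<Rightarrow> nat). \<lambda>(x :: complex^'n, y). monom_fun i x * monom_fun j y :: complex)"
  have "indep_on (U \<times> V) f (C \<times> B)" unfolding indep_on_def
  proof (intro allI impI)
    fix c assume c: "\<forall>z\<in>U \<times> V. (\<Sum>i\<in>C \<times> B. c i * f i z) = 0"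
    define F where "F k z = (\<Sum>m\<in>B. c (k, m) * monom_fun m z)" for k z
    have F: "F k \<in> form d" for k unfolding F_def[abs_def] using B(1) by (intro form_sum form_scale monom_fun_form) auto
    have sum0: "(\<Sum>k\<in>C. monom_fun k x * F k (hmul x y)) = 0" if "x \<in> U" "y \<in> V" for x y
    proof -
      have "(\<Sum>k\<in>C. monom_fun k x * F k (hmul x y)) = (\<Sum>k\<in>C. \<Sum>m\<in>B. c (k, m) * f (k, m) (x, y))"
        by (simp add: F_def f_def sum_distrib_left monom_fun_hmul mult_ac)
      also have "\<dots> = (\<Sum>i\<in>C \<times> B. c i * f i (x, y))" by (simp add: sum.cartesian_product)
      finally show ?thesis using c that by simp
    qed
    \<comment> \<open>Applying the relation to \<open>(h x, h\<inverse> y)\<close> leaves the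
      product \<open>x y\<close> alone and multiplies the \<open>k\<close>-th term by
      \<open>monom_fun k h\<close>. Independence of these characters on \<open>K\<close> makes every
      term vanish separately.\<close>
    have "monom_fun k x * F k (hmul x y) = 0" if "x \<in> U" "y \<in> V" "k \<in> C" for x y k
    proof (rule indep_onD[OF C(2) _ that(3)])
      fix h assume h: "h \<in> K"
      have "hmul (hmul h x) (hmul (vinv h) y) = hmul x y"
        using K[OF h] by (simp add: vec_eq_iff)
      thus "(\<Sum>k\<in>C. monom_fun k x * F k (hmul x y) * monom_fun k h) = 0"
        using sum0[OF act(1)[OF h that(1)] act(2)[OF h that(2)]] by (simp add: monom_fun_hmul mult_ac)
    qed
    \<comment> \<open>The monomial factor is nonzero at \<open>u\<close>, so for fixed
      \<open>y\<close> irreducibility of \<open>U\<close> removes it.\<close>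
    hence "F k (hmul x y) = 0" if "x \<in> U" "y \<in> V" "k \<in> C" for x y k
      using form_irredD[OF U(1) monom_fun_form[of k d] form_hmul[OF F[of k], of y]] monom_fun_nz[OF U(3), of k] U(2) C(1) that
      by blast
    hence "\<forall>z\<in>?W. F k z = 0" if "k \<in> C" for k using that by blast
    hence "c (k, m) = 0" if "k \<in> C" "m \<in> B" for k m
      using B(2)[unfolded indep_on_def, rule_format, of "\<lambda>m. c (k, m)" m] that unfolding F_def by blast
    thus "\<forall>i\<in>C \<times> B. c i = 0" by auto
  qed
  moreover have "spanned_on (U \<times> V) g (M \<times> N) (f i)" if iCB: "i \<in> C \<times> B" for i
  proof -
    obtain k m where i: "i = (k, m)" "k \<in> C" "m \<in> B" using iCB by blast
    have "(\<lambda>x. monom_fun m x * monom_fun k x) \<in> form (d + d)" "monom_fun m \<in> form d"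
      using B(1) C(1) i by (auto intro!: form_mult monom_fun_form)
    from spanned_on_tensor[OF M(3)[OF this(1)] N(3)[OF this(2)]] show ?thesis
      by (simp add: i f_def g_def)
  qed
  ultimately have "card (C \<times> B) \<le> card (M \<times> N)"
    using fin by (intro indep_on_card_le[of _ _ "U \<times> V" f g]) auto
  also have "\<dots> \<le> hilb U (d + d) * hilb V d" unfolding card_cartesian_product using M(2) N(2) by (rule mult_le_mono)
  finally show ?thesis using B(3) C(3) by (simp add: card_cartesian_product mult.commute)
qed

lemma form_vanishes_hadamard_product:
  assumes f: "f \<in> form d" and van: "\<And>x y. x \<in> proj_cone X \<Longrightarrow> y \<in> proj_cone Y \<Longrightarrow> f (hmul x y) = 0"
    and x: "x \<in> proj_cone (X \<star> Y)"
  shows "f x = 0"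
proof (rule form_vanishes_closure[OF f _ x[unfolded hadamard_product_def]])
  have "f (coords r) = 0" if r: "r \<in> {hadamard p q |p q. p \<in> X \<and> q \<in> Y \<and> hadamard_defined p q}" for r
  proof -
    obtain p q where pq: "r = pt (hmul (coords p) (coords q))" "p \<in> X" "q \<in> Y" "hadamard_defined p q"
      using r by (auto simp: hadamard_def hmul_def)
    have "hmul (coords p) (coords q) \<noteq> 0" using pq(4) by (auto simp: hadamard_defined_def vec_eq_iff)
    thus ?thesis using form_coords_pt[OF f] van pq coords_in_cone by blast
  qed
  thus "f z = 0" if "z \<in> proj_cone {hadamard p q |p q. p \<in> X \<and> q \<in> Y \<and> hadamard_defined p q}" for z
    using form_vanishes_cone[OF f] that by blast
qed

text \<open>The product of all coordinates is a form that is nonzero at \<open>u\<close>;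
  multiplying by it and cancelling by irreducibility shows that the points without zero coordinate
  are dense in \<open>V\<close>.\<close>

lemma form_vanishes_dense:
  fixes V :: "(complex^'n::finite) set"
  assumes "form_irred V" "u \<in> V" "\<And>i. u $ i \<noteq> 0" "f \<in> form d"
    and "\<And>x. x \<in> V \<Longrightarrow> (\<And>i. x $ i \<noteq> 0) \<Longrightarrow> f x = 0" and "x \<in> V"
  shows "f x = 0"
proof -
  have "f x * (\<Prod>i\<in>UNIV. x $ i) = 0" if "x \<in> V" for x using assms(5) that by (cases "\<forall>i. x $ i \<noteq> 0") auto
  from form_irredD[OF assms(1,4) form_prod_coords this] show ?thesis
    using assms(2,3,6) by fastforce
qed

text \<open>Products of torus points of \<open>X\<close> and \<open>Y\<close> lie in a single coset
  of \<open>G\<close>. Translation rescales each monomial by a nonzero number, so a relation between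
  monomials on \<open>G\<close> becomes one on this coset, and by density one on all of
  \<open>X \<star> Y\<close>.\<close>

lemma hilb_hadamard_product_le_coset:
  fixes X Y :: "'n::finite proj set"
  assumes X: "form_irred (proj_cone X)" "\<not> X \<subseteq> \<Delta>" "has_coset_containing G X"
    and Y: "form_irred (proj_cone Y)" "\<not> Y \<subseteq> \<Delta>" "has_coset_containing G Y"
    and G: "subgroup G torus"
  shows "hilb (proj_cone (X \<star> Y)) d \<le> hilb (proj_cone G) d"
proof -
  interpret comm_group "torus :: 'n proj monoid" by (rule comm_group_torus)
  obtain s t where st: "s \<in> carrier torus" "X - \<Delta> \<subseteq> s <#\<^bsub>torus\<^esub> G" "t \<in> carrier torus" "Y - \<Delta> \<subseteq> t <#\<^bsub>torus\<^esub> G"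
    using X(3) Y(3) by (auto simp: has_coset_containing_def)
  define \<tau> where "\<tau> = coords (s \<otimes>\<^bsub>torus\<^esub> t)"
  have \<tau>: "\<tau> $ i \<noteq> 0" for i
    using torus_coord_nz[of \<tau> i] m_closed[OF st(1,3)] coords_nonzero[of "s \<otimes>\<^bsub>torus\<^esub> t"] by (auto simp: \<tau>_def)
  obtain u v where uv: "u \<in> proj_cone X" "\<And>i. u $ i \<noteq> 0" "v \<in> proj_cone Y" "\<And>i. v $ i \<noteq> 0"
    using X(2) Y(2) coords_in_cone unfolding coordinate_hyperplanes_def by blast
  obtain B where B: "B \<subseteq> mons d" "indep_on (proj_cone (X \<star> Y)) monom_fun B" "card B = hilb (proj_cone (X \<star> Y)) d"
    using hilb_basis .
  have "indep_on (proj_cone G) monom_fun B" unfolding indep_on_def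
  proof (intro allI impI ballI)
    fix c m assume c: "\<forall>x\<in>proj_cone G. (\<Sum>m\<in>B. c m * monom_fun m x) = 0" and m: "m \<in> B"
    \<comment> \<open>The relation on \<open>G\<close> transported by the translation with
      \<open>\<tau>\<close>, so that \<open>F\<close> at \<open>hmul \<tau> \<gamma>\<close> is the
      original relation at \<open>\<gamma>\<close>.\<close>
    define F where "F = (\<lambda>x. \<Sum>m\<in>B. (c m * monom_fun m (vinv \<tau>)) * monom_fun m x)"
    have F: "F \<in> form d" unfolding F_def using B(1) by (intro form_sum form_scale monom_fun_form) auto
    have F_dense: "F (hmul x y) = 0"
      if x: "x \<in> proj_cone X" "\<And>i. x $ i \<noteq> 0" and y: "y \<in> proj_cone Y" "\<And>i. y $ i \<noteq> 0" for x y
    proof -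
      have x0: "x \<noteq> 0" and y0: "y \<noteq> 0" and xy0: "hmul x y \<noteq> 0" using x(2) y(2) by (auto simp: vec_eq_iff)
      have "pt x \<in> X - \<Delta>" "pt y \<in> Y - \<Delta>"
        using x y x0 y0 mem_torus_pt[of x] mem_torus_pt[of y] by (auto simp: proj_cone_def torus_def)
      then obtain g g' where g: "g \<in> G" "pt x = s \<otimes>\<^bsub>torus\<^esub> g" "g' \<in> G" "pt y = t \<otimes>\<^bsub>torus\<^esub> g'"
        using st by (force simp: l_coset_def)
      define \<gamma> where "\<gamma> = coords (g \<otimes>\<^bsub>torus\<^esub> g')"
      have \<gamma>: "\<gamma> \<in> proj_cone G" unfolding \<gamma>_def using g G by (intro coords_in_cone subgroup.m_closed)
      have gT: "g \<in> carrier torus" "g' \<in> carrier torus" using subgroup.mem_carrier[OF G] g(1,3) by simp_all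
      have \<gamma>_nz: "\<gamma> $ i \<noteq> 0" for i
        using torus_coord_nz[of \<gamma> i] m_closed[OF gT] coords_nonzero[of "g \<otimes>\<^bsub>torus\<^esub> g'"] by (auto simp: \<gamma>_def)
      have "pt (hmul x y) = pt x \<otimes>\<^bsub>torus\<^esub> pt y" unfolding hmul_def using x(2) y(2) by (rule pt_mult_torus[symmetric])
      also have "\<dots> = (s \<otimes>\<^bsub>torus\<^esub> t) \<otimes>\<^bsub>torus\<^esub> (g \<otimes>\<^bsub>torus\<^esub> g')"
        unfolding g using st(1,3) gT by (simp add: m_ac)
      also have "\<dots> = pt \<tau> \<otimes>\<^bsub>torus\<^esub> pt \<gamma>" by (simp add: \<tau>_def \<gamma>_def)
      also have "\<dots> = pt (hmul \<tau> \<gamma>)" unfolding hmul_def using \<tau> \<gamma>_nz by (rule pt_mult_torus)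
      finally have eq: "pt (hmul x y) = pt (hmul \<tau> \<gamma>)" .
      have nz: "hmul \<tau> \<gamma> \<noteq> 0" using \<tau> \<gamma>_nz by (auto simp: vec_eq_iff)
      have "monom_fun k (vinv \<tau>) * monom_fun k (hmul \<tau> \<gamma>) = monom_fun k \<gamma>" for k
      proof -
        have "hmul (vinv \<tau>) (hmul \<tau> \<gamma>) = \<gamma>" using \<tau> by (simp add: vec_eq_iff)
        thus ?thesis by (metis monom_fun_hmul)
      qed
      hence "F (hmul \<tau> \<gamma>) = (\<Sum>m\<in>B. c m * monom_fun m \<gamma>)"
        by (simp add: F_def mult.assoc)
      hence "F (hmul \<tau> \<gamma>) = 0" using c \<gamma> by simp
      thus ?thesis using form_coords_pt[OF F xy0] form_coords_pt[OF F nz] eq by simp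
    qed
    \<comment> \<open>Density is used in one factor at a time: first \<open>x\<close> is freed with
      \<open>y\<close> over the torus, then \<open>y\<close> with \<open>x\<close>
      arbitrary.\<close>
    have F_dense': "F (hmul x y) = 0" if x: "x \<in> proj_cone X" and y: "y \<in> proj_cone Y" "\<And>i. y $ i \<noteq> 0" for x y
      using form_vanishes_dense[OF X(1) uv(1,2) form_hmul[OF F, of y] _ x] F_dense[OF _ _ y] by blast
    have "F (hmul x y) = 0" if x: "x \<in> proj_cone X" and y: "y \<in> proj_cone Y" for x y
    proof -
      have com: "hmul x z = hmul z x" for z by (simp add: vec_eq_iff mult.commute)
      have "F (hmul z x) = 0" if "z \<in> proj_cone Y" "\<And>i. z $ i \<noteq> 0" for z
        using F_dense'[OF x that] by (simp add: com)
      from form_vanishes_dense[OF Y(1) uv(3,4) form_hmul[OF F, of x] this y] show ?thesis by (simp add: com)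
    qed
    hence "\<forall>x\<in>proj_cone (X \<star> Y). F x = 0" using form_vanishes_hadamard_product[OF F] by blast
    hence "c m * monom_fun m (vinv \<tau>) = 0"
      using B(2)[unfolded indep_on_def, rule_format, of "\<lambda>m. c m * monom_fun m (vinv \<tau>)" m] m unfolding F_def by blast
    thus "c m = 0" using monom_fun_nz[of "vinv \<tau>" m] \<tau> by simp
  qed
  thus ?thesis using hilb_geI[OF B(1)] B(3) by metis
qed

section \<open>Subtori\<close>

lemma hmul_nz: "(\<And>i. a $ i \<noteq> 0) \<Longrightarrow> x \<noteq> 0 \<Longrightarrow> hmul a x \<noteq> 0"
  by (auto simp: vec_eq_iff)

lemma torus_coords_nz: "t \<in> carrier torus \<Longrightarrow> coords t $ i \<noteq> 0"
  by (auto simp: torus_def coordinate_hyperplanes_def)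

lemma hadamard_pt_hmul:
  assumes "\<And>i. a $ i \<noteq> 0" "x \<noteq> 0"
  shows "hadamard (pt a) (pt x) = pt (hmul a x)"
  unfolding hmul_def using assms by (intro hadamard_pt) (auto simp: vec_eq_iff)

lemma hadamard_torus: "t \<in> carrier torus \<Longrightarrow> hadamard t p = pt (hmul (coords t) (coords p))"
  using hadamard_pt_hmul[OF torus_coords_nz coords_nonzero, of t p] by simp

lemma torus_mult: "s \<otimes>\<^bsub>torus\<^esub> t = hadamard s t"
  by (simp add: torus_def)

lemma hadamard_assoc:
  assumes "s \<in> carrier torus" "t \<in> carrier torus"
  shows "hadamard s (hadamard t p) = hadamard (s \<otimes>\<^bsub>torus\<^esub> t) p"
proof -
  have st: "\<And>i. coords s $ i \<noteq> 0" "\<And>i. coords t $ i \<noteq> 0" using assms torus_coords_nz by blast+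
  have "s \<otimes>\<^bsub>torus\<^esub> t = pt (hmul (coords s) (coords t))"
    using assms by (simp add: torus_mult hadamard_torus)
  moreover have "hadamard s (hadamard t p) = pt (hmul (coords s) (hmul (coords t) (coords p)))"
    using hadamard_pt_hmul[OF st(1) hmul_nz[OF st(2) coords_nonzero[of p]]] assms by (simp add: hadamard_torus)
  moreover have "hadamard (pt (hmul (coords s) (coords t))) p = pt (hmul (hmul (coords s) (coords t)) (coords p))"
    using hadamard_pt_hmul[of "hmul (coords s) (coords t)" "coords p"] st by (simp add: coords_nonzero)
  moreover have "hmul (coords s) (hmul (coords t) (coords p)) = hmul (hmul (coords s) (coords t)) (coords p)"
    by (simp add: vec_eq_iff mult.assoc)
  ultimately show ?thesis by simp
qed

lemma hadamard_one: "hadamard \<one>\<^bsub>torus\<^esub> p = p" for p :: "'n::finite proj"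
proof -
  have "\<one>\<^bsub>torus\<^esub> = (pt (\<chi> i. 1) :: 'n proj)" by (simp add: torus_def)
  moreover have "hmul (\<chi> i. 1) (coords p) = coords p" by (simp add: vec_eq_iff)
  ultimately show ?thesis using hadamard_pt_hmul[of "\<chi> i. 1" "coords p"] by (simp add: coords_nonzero)
qed

lemma torus_group: "group (torus :: 'n::finite proj monoid)"
  using comm_group_torus by (rule comm_group.axioms)

lemma hadamard_inv:
  fixes t :: "'n::finite proj"
  assumes "t \<in> carrier torus"
  shows "hadamard (inv\<^bsub>torus\<^esub> t) (hadamard t p) = p" "hadamard t (hadamard (inv\<^bsub>torus\<^esub> t) p) = p"
  using assms group.inv_closed[OF torus_group assms] group.l_inv[OF torus_group assms] group.r_inv[OF torus_group assms]
  by (simp_all add: hadamard_assoc hadamard_one)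

text \<open>For fixed \<open>p\<close>, multiplication by \<open>t\<close> is linear in the
  coordinates of \<open>t\<close>, so forms pull back to forms. Off the torus the product vector may
  be zero, hence the restriction to torus elements.\<close>

lemma closedin_hadamard_orbit_map:
  assumes "closedin zariski C"
  obtains D where "closedin zariski D" "\<And>t. t \<in> carrier torus \<Longrightarrow> hadamard t p \<in> C \<longleftrightarrow> t \<in> D"
proof -
  obtain \<F> where F: "\<And>f. f \<in> \<F> \<Longrightarrow> \<exists>d. f \<in> form d" "C = {p. \<forall>f\<in>\<F>. f (coords p) = 0}"
    using assms by (auto simp: closedin_zariski_forms)
  define D where "D = {t. \<forall>f\<in>(\<lambda>f x. f (hmul x (coords p))) ` \<F>. f (coords t) = 0}"
  have "closedin zariski D" unfolding closedin_zariski_forms D_def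
    using F(1) form_hmul by (intro exI[of _ "(\<lambda>f x. f (hmul x (coords p))) ` \<F>"]) blast
  moreover have "hadamard t p \<in> C \<longleftrightarrow> t \<in> D" if t: "t \<in> carrier torus" for t
  proof -
    have nz: "hmul (coords t) (coords p) \<noteq> 0" using torus_coords_nz[OF t] coords_nonzero by (rule hmul_nz)
    have "f (coords (hadamard t p)) = 0 \<longleftrightarrow> f (hmul (coords t) (coords p)) = 0" if "f \<in> \<F>" for f
      unfolding hadamard_torus[OF t] using F(1)[OF that] form_coords_pt nz by blast
    thus ?thesis using F(2) by (simp add: D_def)
  qed
  ultimately show ?thesis using that by blast
qed

lemma continuous_map_hadamard:
  assumes t: "t \<in> carrier torus"
  shows "continuous_map zariski zariski (hadamard t)"
  unfolding continuous_map_closedin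
proof (intro conjI ballI allI impI)
  fix C :: "'a proj set" assume "closedin zariski C"
  then obtain \<F> where F: "\<And>f. f \<in> \<F> \<Longrightarrow> \<exists>d. f \<in> form d" "C = {p. \<forall>f\<in>\<F>. f (coords p) = 0}"
    by (auto simp: closedin_zariski_forms)
  define D where "D = {p. \<forall>f\<in>(\<lambda>f x. f (hmul x (coords t))) ` \<F>. f (coords p) = 0}"
  have "closedin zariski D" unfolding closedin_zariski_forms D_def
    using F(1) form_hmul by (intro exI[of _ "(\<lambda>f x. f (hmul x (coords t))) ` \<F>"]) blast
  moreover have "hadamard t p \<in> C \<longleftrightarrow> p \<in> D" for p
  proof -
    have com: "hmul (coords p) (coords t) = hmul (coords t) (coords p)" by (simp add: vec_eq_iff mult.commute)
    have nz: "hmul (coords t) (coords p) \<noteq> 0" using torus_coords_nz[OF t] coords_nonzero by (rule hmul_nz)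
    have "f (coords (hadamard t p)) = 0 \<longleftrightarrow> f (hmul (coords p) (coords t)) = 0" if "f \<in> \<F>" for f
      unfolding hadamard_torus[OF t] com using F(1)[OF that] form_coords_pt nz by blast
    thus ?thesis using F(2) by (simp add: D_def)
  qed
  ultimately show "closedin zariski {x \<in> topspace zariski. hadamard t x \<in> C}" by simp
qed simp

lemma irreducible_inD:
  "irreducible_in X S \<Longrightarrow> closedin X A \<Longrightarrow> closedin X B \<Longrightarrow> S \<subseteq> A \<union> B \<Longrightarrow> S \<subseteq> A \<or> S \<subseteq> B"
  unfolding irreducible_in_def by blast

lemma irreducible_in_hadamard_image:
  assumes t: "t \<in> carrier torus" and S: "irreducible_in zariski S"
  shows "irreducible_in zariski (hadamard t ` S)"
  unfolding irreducible_in_def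
proof (intro conjI allI impI)
  fix A B assume AB: "closedin zariski A" "closedin zariski B" "hadamard t ` S \<subseteq> A \<union> B"
  have "closedin zariski {p. hadamard t p \<in> C}" if "closedin zariski C" for C
    using continuous_map_hadamard[OF t] that by (simp add: continuous_map_closedin)
  hence "S \<subseteq> {p. hadamard t p \<in> A} \<or> S \<subseteq> {p. hadamard t p \<in> B}"
    using AB by (intro irreducible_inD[OF S]) auto
  thus "hadamard t ` S \<subseteq> A \<or> hadamard t ` S \<subseteq> B" by blast
qed (use S in \<open>auto simp: irreducible_in_def\<close>)

text \<open>Replaces irreducibility of a product variety: each translate of \<open>T\<close> lies in
  one of the two closed sets, and the \<open>s\<close> whose translate lies in a given closed set
  form a relatively closed subset of \<open>S\<close>, so irreducibility of \<open>S\<close>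
  decides.\<close>

lemma irreducible_in_hadamard_set:
  assumes S: "irreducible_in zariski S" "S \<subseteq> carrier torus" and T: "irreducible_in zariski T"
  shows "irreducible_in zariski (\<Union>s\<in>S. hadamard s ` T)"
  unfolding irreducible_in_def
proof (intro conjI allI impI)
  fix A B assume A: "closedin zariski A" and B: "closedin zariski B"
    and ST: "(\<Union>s\<in>S. hadamard s ` T) \<subseteq> A \<union> B"
  have closed: "\<exists>D. closedin zariski D \<and> (\<forall>s\<in>S. s \<in> D \<longleftrightarrow> hadamard s ` T \<subseteq> C)" if C: "closedin zariski C" for C
  proof -
    have "\<exists>D. closedin zariski D \<and> (\<forall>s\<in>carrier torus. hadamard s p \<in> C \<longleftrightarrow> s \<in> D)" for p
      using closedin_hadamard_orbit_map[OF C] by metis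
    then obtain D where D: "\<And>p. closedin zariski (D p)" "\<And>p s. s \<in> carrier torus \<Longrightarrow> hadamard s p \<in> C \<longleftrightarrow> s \<in> D p"
      by metis
    have "T \<noteq> {}" using T by (simp add: irreducible_in_def)
    hence "closedin zariski (\<Inter>p\<in>T. D p)" using D(1) by (intro closedin_Inter) auto
    moreover have "s \<in> (\<Inter>p\<in>T. D p) \<longleftrightarrow> hadamard s ` T \<subseteq> C" if "s \<in> S" for s
      using D(2)[of s] S(2) that by blast
    ultimately show ?thesis by (intro exI[of _ "\<Inter>p\<in>T. D p"] conjI ballI)
  qed
  obtain A' where A': "closedin zariski A'" "\<And>s. s \<in> S \<Longrightarrow> s \<in> A' \<longleftrightarrow> hadamard s ` T \<subseteq> A" using closed[OF A] by blast
  obtain B' where B': "closedin zariski B'" "\<And>s. s \<in> S \<Longrightarrow> s \<in> B' \<longleftrightarrow> hadamard s ` T \<subseteq> B" using closed[OF B] by blast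
  have "hadamard s ` T \<subseteq> A \<or> hadamard s ` T \<subseteq> B" if s: "s \<in> S" for s
  proof -
    have "irreducible_in zariski (hadamard s ` T)" using S(2) s T by (intro irreducible_in_hadamard_image) auto
    moreover have "hadamard s ` T \<subseteq> A \<union> B" using ST s by blast
    ultimately show ?thesis using A B by (intro irreducible_inD)
  qed
  hence "S \<subseteq> A' \<union> B'" using A'(2) B'(2) by blast
  hence "S \<subseteq> A' \<or> S \<subseteq> B'" using A'(1) B'(1) by (intro irreducible_inD[OF S(1)])
  thus "(\<Union>s\<in>S. hadamard s ` T) \<subseteq> A \<or> (\<Union>s\<in>S. hadamard s ` T) \<subseteq> B" using A'(2) B'(2) by blast
qed (use S T in \<open>auto simp: irreducible_in_def\<close>)

lemma irreducible_in_imp_connectedin: "irreducible_in X S \<Longrightarrow> connectedin X S"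
  unfolding irreducible_in_def connectedin_closedin by blast

lemma irreducible_in_between_closure:
  assumes "irreducible_in X S" "S \<subseteq> T" "T \<subseteq> X closure_of S"
  shows "irreducible_in X T"
  unfolding irreducible_in_def
proof (intro conjI allI impI)
  fix A B assume *: "closedin X A" "closedin X B" "T \<subseteq> A \<union> B"
  hence "S \<subseteq> A \<or> S \<subseteq> B" using assms(2) by (intro irreducible_inD[OF assms(1)]) auto
  hence "X closure_of S \<subseteq> A \<or> X closure_of S \<subseteq> B" using * closure_of_minimal by metis
  thus "T \<subseteq> A \<or> T \<subseteq> B" using assms(3) by blast
qed (use assms closure_of_subset_topspace[of X S] in \<open>auto simp: irreducible_in_def\<close>)

lemma irreducible_in_Union_chain:
  assumes "\<C> \<noteq> {}" "\<And>S. S \<in> \<C> \<Longrightarrow> irreducible_in X S" "\<And>S T. S \<in> \<C> \<Longrightarrow> T \<in> \<C> \<Longrightarrow> S \<subseteq> T \<or> T \<subseteq> S"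
  shows "irreducible_in X (\<Union>\<C>)"
  unfolding irreducible_in_def
proof (intro conjI allI impI)
  fix A B assume *: "closedin X A" "closedin X B" "\<Union>\<C> \<subseteq> A \<union> B"
  have irr: "S \<subseteq> A \<or> S \<subseteq> B" if "S \<in> \<C>" for S
    using * that by (intro irreducible_inD[OF assms(2)[OF that]]) auto
  show "\<Union>\<C> \<subseteq> A \<or> \<Union>\<C> \<subseteq> B"
  proof (rule ccontr)
    assume "\<not> ?thesis"
    then obtain S T where "S \<in> \<C>" "\<not> S \<subseteq> A" "T \<in> \<C>" "\<not> T \<subseteq> B" by blast
    thus False using irr assms(3)[of S T] by blast
  qed
qed (use assms in \<open>auto simp: irreducible_in_def\<close>)

lemma irreducible_in_singleton: "x \<in> topspace X \<Longrightarrow> irreducible_in X {x}"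
  by (auto simp: irreducible_in_def)

lemma closedin_hyperplanes: "closedin zariski (\<Delta> :: 'n::finite proj set)"
proof -
  have "\<Delta> = {p :: 'n proj. (\<Prod>i\<in>UNIV. coords p $ i) = 0}" by (simp add: coordinate_hyperplanes_def)
  thus ?thesis using closedin_form[OF form_prod_coords[where 'n = 'n]] by simp
qed

lemma irreducible_in_diff_hyperplanes:
  assumes "irreducible_in zariski X" "\<not> X \<subseteq> \<Delta>"
  shows "irreducible_in zariski (X - \<Delta>)"
  unfolding irreducible_in_def
proof (intro conjI allI impI)
  fix A B assume *: "closedin zariski A" "closedin zariski B" "X - \<Delta> \<subseteq> A \<union> B"
  hence "closedin zariski (A \<union> \<Delta>)" "closedin zariski (B \<union> \<Delta>)" "X \<subseteq> (A \<union> \<Delta>) \<union> (B \<union> \<Delta>)"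
    using closedin_hyperplanes by (auto intro: closedin_Un)
  hence "X \<subseteq> A \<union> \<Delta> \<or> X \<subseteq> B \<union> \<Delta>" by (rule irreducible_inD[OF assms(1)])
  thus "X - \<Delta> \<subseteq> A \<or> X - \<Delta> \<subseteq> B" by blast
qed (use assms in auto)

section \<open>Existence of the least and the greatest subtorus\<close>

lemma carrier_torus: "carrier torus = - \<Delta>" by (simp add: torus_def)

text \<open>A maximal irreducible subset containing the identity of a closed subgroup is itself a subgroup.\<close>

lemma smallest_closed_subgroup:
  fixes S T :: "'n::finite proj set"
  assumes S: "irreducible_in zariski S" "S \<subseteq> carrier torus" "\<one>\<^bsub>torus\<^esub> \<in> S"
    and T: "irreducible_in zariski T" "T \<subseteq> carrier torus" "\<one>\<^bsub>torus\<^esub> \<in> T"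
  obtains L where "subgroup L torus" "closedin (subtopology zariski (carrier torus)) L" "irreducible_in zariski L"
    "S \<subseteq> L" "T \<subseteq> L"
    "\<And>K. subgroup K torus \<Longrightarrow> closedin (subtopology zariski (carrier torus)) K \<Longrightarrow> S \<subseteq> K \<Longrightarrow> T \<subseteq> K \<Longrightarrow> L \<subseteq> K"
proof -
  interpret comm_group "torus :: 'n proj monoid" by (rule comm_group_torus)
  define \<G> where "\<G> = {K. subgroup K torus \<and> closedin (subtopology zariski (carrier torus)) K \<and> S \<subseteq> K \<and> T \<subseteq> K}"
  have "carrier torus \<in> \<G>" unfolding \<G>_def using subgroup_self S(2) T(2)
    by (auto intro: closedin_subtopology_refl[THEN iffD2])
  hence ne: "\<G> \<noteq> {}" by blast
  define L where "L = \<Inter>\<G>"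
  have L: "subgroup L torus" unfolding L_def using ne by (intro subgroups_Inter) (auto simp: \<G>_def)
  have L_cl: "closedin (subtopology zariski (carrier torus)) L"
    unfolding L_def using ne by (intro closedin_Inter) (auto simp: \<G>_def)
  have ST: "S \<subseteq> L" "T \<subseteq> L" by (auto simp: L_def \<G>_def)
  have LT: "L \<subseteq> carrier torus" using L subgroup.subset by blast
  have L1: "\<one>\<^bsub>torus\<^esub> \<in> L" using L by (rule subgroup.one_closed)
  have L_mult: "hadamard x y \<in> L" if "x \<in> L" "y \<in> L" for x y
    using subgroup.m_closed[OF L that] by (simp add: torus_mult)
  define \<I> where "\<I> = {Z. irreducible_in zariski Z \<and> \<one>\<^bsub>torus\<^esub> \<in> Z \<and> Z \<subseteq> L}"
  have "\<exists>C\<in>\<I>. \<forall>Z\<in>\<I>. C \<subseteq> Z \<longrightarrow> Z = C"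
  proof (rule subset_Zorn_nonempty)
    show "\<I> \<noteq> {}" using irreducible_in_singleton[of "\<one>\<^bsub>torus\<^esub>" zariski] L1 by (auto simp: \<I>_def)
    fix \<C> assume C: "\<C> \<noteq> {}" "subset.chain \<I> \<C>"
    have "irreducible_in zariski (\<Union>\<C>)"
      using C by (intro irreducible_in_Union_chain) (auto simp: subset_chain_def \<I>_def)
    thus "\<Union>\<C> \<in> \<I>" using C by (fastforce simp: subset_chain_def \<I>_def)
  qed
  then obtain C where C: "C \<in> \<I>" and max: "\<And>Z. Z \<in> \<I> \<Longrightarrow> C \<subseteq> Z \<Longrightarrow> Z = C" by blast
  have C': "irreducible_in zariski C" "\<one>\<^bsub>torus\<^esub> \<in> C" "C \<subseteq> L" using C by (auto simp: \<I>_def)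
  \<comment> \<open>The product set of \<open>Z\<close> and \<open>C\<close> is irreducible and, as
    both contain the identity, contains both. Maximality makes it equal to \<open>C\<close>, so
    \<open>C\<close> is the greatest irreducible subset of \<open>L\<close> through the
    identity.\<close>
  have absorb: "Z \<subseteq> C" if Z: "Z \<in> \<I>" for Z
  proof -
    have Z': "irreducible_in zariski Z" "\<one>\<^bsub>torus\<^esub> \<in> Z" "Z \<subseteq> L" using Z by (auto simp: \<I>_def)
    let ?U = "\<Union>z\<in>Z. hadamard z ` C"
    have "C = hadamard \<one>\<^bsub>torus\<^esub> ` C" by (simp add: hadamard_one)
    hence CU: "C \<subseteq> ?U" using Z'(2) by blast
    have ZU: "Z \<subseteq> ?U"
    proof
      fix z assume z: "z \<in> Z"
      hence "z = hadamard z \<one>\<^bsub>torus\<^esub>" using r_one[of z] Z'(3) LT by (auto simp: torus_mult)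
      thus "z \<in> ?U" using z C'(2) by blast
    qed
    have "?U \<subseteq> L" using Z'(3) C'(3) L_mult by blast
    moreover have "irreducible_in zariski ?U" using Z' LT C'(1) by (intro irreducible_in_hadamard_set) auto
    moreover have "\<one>\<^bsub>torus\<^esub> \<in> ?U" using CU C'(2) by (rule subsetD)
    ultimately have "?U \<in> \<I>" by (simp add: \<I>_def)
    thus ?thesis using max[OF _ CU] ZU by simp
  qed
  \<comment> \<open>The translate of \<open>C\<close> by the inverse of one of its elements again
    passes through the identity and is therefore absorbed. This yields closure under inverses and
    then under products.\<close>
  have inv_C: "hadamard (inv\<^bsub>torus\<^esub> c) ` C \<subseteq> C" if c: "c \<in> C" for c
  proof (rule absorb)
    have cL: "c \<in> L" "c \<in> carrier torus" using c C'(3) LT by blast+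
    have "inv\<^bsub>torus\<^esub> c \<in> L" using L cL(1) by (rule subgroup.m_inv_closed)
    moreover have "hadamard (inv\<^bsub>torus\<^esub> c) c = \<one>\<^bsub>torus\<^esub>" using l_inv[OF cL(2)] by (simp add: torus_mult)
    ultimately show "hadamard (inv\<^bsub>torus\<^esub> c) ` C \<in> \<I>"
      using irreducible_in_hadamard_image[OF inv_closed[OF cL(2)] C'(1)] c C'(3) L_mult
      unfolding \<I>_def by (auto intro: image_eqI[where x = c])
  qed
  have inv_mem: "inv\<^bsub>torus\<^esub> c \<in> C" if c: "c \<in> C" for c
  proof -
    have "hadamard (inv\<^bsub>torus\<^esub> c) \<one>\<^bsub>torus\<^esub> = inv\<^bsub>torus\<^esub> c"
      using r_one[of "inv\<^bsub>torus\<^esub> c"] c C'(3) LT by (auto simp: torus_mult)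
    thus ?thesis using inv_C[OF c] C'(2) by (metis imageI subsetD)
  qed
  have sC: "subgroup C torus"
  proof (rule subgroupI)
    show "C \<subseteq> carrier torus" "C \<noteq> {}" using C' LT by auto
    fix a b assume ab: "a \<in> C" "b \<in> C"
    show "inv\<^bsub>torus\<^esub> a \<in> C" using ab by (rule_tac inv_mem)
    have "inv\<^bsub>torus\<^esub> (inv\<^bsub>torus\<^esub> a) = a" using ab C'(3) LT by (intro inv_inv) auto
    thus "a \<otimes>\<^bsub>torus\<^esub> b \<in> C" using inv_C[OF inv_mem[OF ab(1)]] ab(2) by (auto simp: torus_mult)
  qed
  \<comment> \<open>Taking the closure keeps irreducibility, so maximality makes \<open>C\<close>
    closed in \<open>L\<close>, hence in the torus.\<close>
  have "zariski closure_of C \<inter> L \<subseteq> C"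
  proof (rule absorb)
    have "C \<subseteq> zariski closure_of C" by (rule closure_of_subset) simp
    thus "zariski closure_of C \<inter> L \<in> \<I>" unfolding \<I>_def
      using C' irreducible_in_between_closure[OF C'(1), of "zariski closure_of C \<inter> L"] by blast
  qed
  moreover have "C \<subseteq> zariski closure_of C" by (rule closure_of_subset) simp
  ultimately have C_eq: "C = zariski closure_of C \<inter> L" using C'(3) by blast
  have "closedin (subtopology zariski (carrier torus)) C"
  proof -
    obtain D where D: "closedin zariski D" "L = D \<inter> carrier torus"
      using L_cl by (auto simp: closedin_subtopology)
    have "C = (zariski closure_of C \<inter> D) \<inter> carrier torus" using C_eq D(2) by blast
    moreover have "closedin zariski (zariski closure_of C \<inter> D)" using D(1) by (intro closedin_Int) auto
    ultimately show ?thesis unfolding closedin_subtopology by blast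
  qed
  moreover have "S \<subseteq> C" "T \<subseteq> C" using S T ST by (auto intro!: absorb simp: \<I>_def)
  ultimately have "C \<in> \<G>" using sC by (simp add: \<G>_def)
  \<comment> \<open>\<open>C\<close> is itself a competitor in the intersection defining
    \<open>L\<close>. This is where the least closed subgroup turns out to be irreducible.\<close>
  hence "L = C" using C'(3) by (auto simp: L_def)
  thus ?thesis using that[OF L L_cl _ ST] C'(1) by (auto simp: L_def \<G>_def)
qed

text \<open>After translation by the inverse of a torus point of the set (\<open>tr\<close>), having
  a coset that contains the set means that the subgroup contains the translate. The least closed
  subgroup containing both translates is irreducible, hence connected, and so is the least
  subtorus.\<close>

lemma ex_least_subtorus:
  fixes X Y :: "'n::finite proj set"
  assumes X: "irreducible_in zariski X" "\<not> X \<subseteq> \<Delta>" and Y: "irreducible_in zariski Y" "\<not> Y \<subseteq> \<Delta>"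
  obtains L where "subtorus L" "has_coset_containing L X" "has_coset_containing L Y" "irreducible_in zariski L"
    "\<And>G. subtorus G \<Longrightarrow> has_coset_containing G X \<Longrightarrow> has_coset_containing G Y \<Longrightarrow> L \<subseteq> G"
proof -
  interpret comm_group "torus :: 'n proj monoid" by (rule comm_group_torus)
  define tr where "tr x A = hadamard (inv\<^bsub>torus\<^esub> x) ` A" for x and A :: "'n proj set"
  have tr: "irreducible_in zariski (tr x (A - \<Delta>))" "tr x (A - \<Delta>) \<subseteq> carrier torus" "\<one>\<^bsub>torus\<^esub> \<in> tr x (A - \<Delta>)"
    if "irreducible_in zariski A" "\<not> A \<subseteq> \<Delta>" "x \<in> A - \<Delta>" for x and A :: "'n proj set"
  proof -
    have x: "x \<in> carrier torus" using that(3) by (simp add: carrier_torus)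
    show "irreducible_in zariski (tr x (A - \<Delta>))" unfolding tr_def using that x
      by (intro irreducible_in_hadamard_image irreducible_in_diff_hyperplanes inv_closed)
    have "inv\<^bsub>torus\<^esub> x \<otimes>\<^bsub>torus\<^esub> y \<in> carrier torus" if "y \<in> A - \<Delta>" for y
      using that x by (intro m_closed inv_closed) (auto simp: carrier_torus)
    thus "tr x (A - \<Delta>) \<subseteq> carrier torus" by (auto simp: tr_def torus_mult)
    have "\<one>\<^bsub>torus\<^esub> = hadamard (inv\<^bsub>torus\<^esub> x) x" using l_inv[OF x] by (simp add: torus_mult)
    thus "\<one>\<^bsub>torus\<^esub> \<in> tr x (A - \<Delta>)" unfolding tr_def using that(3) by blast
  qed
  have tr_coset: "tr x (A - \<Delta>) \<subseteq> G" if "has_coset_containing G A" "subgroup G torus" "x \<in> A - \<Delta>" for x A and G :: "'n proj set"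
  proof -
    obtain t where t: "t \<in> carrier torus" "A - \<Delta> \<subseteq> t <#\<^bsub>torus\<^esub> G"
      using \<open>has_coset_containing G A\<close> by (auto simp: has_coset_containing_def)
    obtain g where g: "g \<in> G" "x = t \<otimes>\<^bsub>torus\<^esub> g" using t \<open>x \<in> A - \<Delta>\<close> by (auto simp: l_coset_def)
    have gT: "g \<in> carrier torus" using g that(2) subgroup.mem_carrier by metis
    have "hadamard (inv\<^bsub>torus\<^esub> x) y \<in> G" if "y \<in> A - \<Delta>" for y
    proof -
      obtain g' where g': "g' \<in> G" "y = t \<otimes>\<^bsub>torus\<^esub> g'" using t \<open>y \<in> A - \<Delta>\<close> by (auto simp: l_coset_def)
      have g'T: "g' \<in> carrier torus" using g' \<open>subgroup G torus\<close> subgroup.mem_carrier by metis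
      have "inv\<^bsub>torus\<^esub> x \<otimes>\<^bsub>torus\<^esub> y = (inv\<^bsub>torus\<^esub> g \<otimes>\<^bsub>torus\<^esub> inv\<^bsub>torus\<^esub> t) \<otimes>\<^bsub>torus\<^esub> (t \<otimes>\<^bsub>torus\<^esub> g')"
        using t(1) gT by (simp add: g g' inv_mult_group)
      also have "\<dots> = inv\<^bsub>torus\<^esub> g \<otimes>\<^bsub>torus\<^esub> g'"
        using t(1) gT g'T by (metis inv_closed inv_solve_left m_assoc m_closed)
      also have "\<dots> \<in> G" using g g' \<open>subgroup G torus\<close> by (intro subgroup.m_closed subgroup.m_inv_closed)
      finally show ?thesis by (simp add: torus_mult)
    qed
    thus ?thesis by (auto simp: tr_def)
  qed
  have coset_tr: "has_coset_containing G A" if "tr x (A - \<Delta>) \<subseteq> G" "x \<in> A - \<Delta>" for x A and G :: "'n proj set"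
    unfolding has_coset_containing_def
  proof (intro bexI subsetI)
    show x: "x \<in> carrier torus" using that by (simp add: carrier_torus)
    fix y assume y: "y \<in> A - \<Delta>"
    have "y = x \<otimes>\<^bsub>torus\<^esub> hadamard (inv\<^bsub>torus\<^esub> x) y" unfolding torus_mult using hadamard_inv(2)[OF x] by simp
    moreover have "hadamard (inv\<^bsub>torus\<^esub> x) y \<in> G" using that(1) y by (auto simp: tr_def)
    ultimately show "y \<in> x <#\<^bsub>torus\<^esub> G" unfolding l_coset_def by blast
  qed
  obtain x y where xy: "x \<in> X - \<Delta>" "y \<in> Y - \<Delta>" using X(2) Y(2) by blast
  obtain L where L: "subgroup L torus" "closedin (subtopology zariski (carrier torus)) L" "irreducible_in zariski L"
    "tr x (X - \<Delta>) \<subseteq> L" "tr y (Y - \<Delta>) \<subseteq> L"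
    "\<And>K. subgroup K torus \<Longrightarrow> closedin (subtopology zariski (carrier torus)) K \<Longrightarrow> tr x (X - \<Delta>) \<subseteq> K \<Longrightarrow>
      tr y (Y - \<Delta>) \<subseteq> K \<Longrightarrow> L \<subseteq> K"
    using smallest_closed_subgroup[OF tr[OF X xy(1)] tr[OF Y xy(2)]] by blast
  show ?thesis
  proof (rule that)
    show "subtorus L" using L irreducible_in_imp_connectedin by (simp add: subtorus_def)
    show "has_coset_containing L X" "has_coset_containing L Y" using coset_tr L(4,5) xy by blast+
    show "irreducible_in zariski L" by (rule L(3))
    show "L \<subseteq> G" if "subtorus G" "has_coset_containing G X" "has_coset_containing G Y" for G
      using that tr_coset xy by (intro L(6)) (auto simp: subtorus_def)
  qed
qed

lemma irreducible_in_zariski_cone: "irreducible_in zariski Z \<Longrightarrow> form_irred (proj_cone Z)"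
  using irreducible_in_cone[of UNIV Z] subtopology_topspace[of "zariski :: 'a proj topology"] by simp

lemma hilb_hmul_image:
  assumes "\<And>i. a $ i \<noteq> 0"
  shows "hilb V d \<le> hilb (hmul a ` V) d"
proof -
  obtain B where B: "B \<subseteq> mons d" "indep_on V monom_fun B" "card B = hilb V d" using hilb_basis .
  have "indep_on (hmul a ` V) monom_fun B" unfolding indep_on_def
  proof (intro allI impI ballI)
    fix c m assume c: "\<forall>x\<in>hmul a ` V. (\<Sum>m\<in>B. c m * monom_fun m x) = 0" and m: "m \<in> B"
    have "(\<Sum>m\<in>B. (c m * monom_fun m a) * monom_fun m x) = 0" if "x \<in> V" for x
      using c that by (simp add: monom_fun_hmul mult.assoc)
    from indep_onD[OF B(2) this m] show "c m = 0" using monom_fun_nz[OF assms] by simp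
  qed
  thus ?thesis using hilb_geI[OF B(1)] B(3) by metis
qed

text \<open>If \<open>hadamard t ` X\<close> were a proper subset of \<open>X\<close>, it would have a strictly smaller Hilbert function.\<close>

lemma hadamard_image_eq:
  fixes X :: "'n::finite proj set"
  assumes X: "irreducible_variety X" and t: "t \<in> carrier torus" and sub: "hadamard t ` X \<subseteq> X"
  shows "hadamard t ` X = X"
proof (rule ccontr)
  assume "hadamard t ` X \<noteq> X"
  then obtain p where p: "p \<in> X" "p \<notin> hadamard t ` X" using sub by blast
  have t': "inv\<^bsub>torus\<^esub> t \<in> carrier torus" using group.inv_closed[OF torus_group t] .
  have "hadamard t ` X = {q. hadamard (inv\<^bsub>torus\<^esub> t) q \<in> X}"
  proof (intro equalityI subsetI)
    fix q assume "q \<in> {q. hadamard (inv\<^bsub>torus\<^esub> t) q \<in> X}"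
    thus "q \<in> hadamard t ` X" using hadamard_inv(2)[OF t, of q] by (metis image_eqI mem_Collect_eq)
  qed (auto simp: hadamard_inv(1)[OF t])
  hence "closedin zariski (hadamard t ` X)"
    using continuous_map_hadamard[OF t'] X by (simp add: continuous_map_closedin irreducible_variety_def)
  then obtain e F where F: "F \<in> form e" "\<And>x. x \<in> proj_cone (hadamard t ` X) \<Longrightarrow> F x = 0" "F (coords p) \<noteq> 0"
    using closedin_separation p(2) by metis
  let ?U = "hmul (coords t) ` proj_cone X"
  have U: "?U \<subseteq> proj_cone (hadamard t ` X)"
  proof
    fix y assume "y \<in> ?U"
    then obtain x where x: "y = hmul (coords t) x" "x \<noteq> 0" "pt x \<in> X" by (auto simp: proj_cone_def)
    have "pt y = hadamard t (pt x)"
      using hadamard_pt_hmul[OF torus_coords_nz[OF t] x(2)] x(1) by simp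
    thus "y \<in> proj_cone (hadamard t ` X)"
      using x hmul_nz[OF torus_coords_nz[OF t] x(2)] by (simp add: proj_cone_def)
  qed
  hence "?U \<subseteq> proj_cone X" using proj_cone_mono[OF sub] by blast
  moreover have irr: "form_irred (proj_cone X)"
    using X by (intro irreducible_in_zariski_cone) (simp add: irreducible_variety_def)
  \<comment> \<open>Degree \<open>0\<close> is enough: the first summand is at least
    \<open>1\<close>, whereas a coordinate scaling does not lower the Hilbert function, so the
    remaining two terms contradict this inequality.\<close>
  ultimately have "hilb (proj_cone X) 0 + hilb ?U (0 + e) \<le> hilb (proj_cone X) (0 + e)"
    using F U coords_in_cone[OF p(1)] by (intro hilb_strict) auto
  moreover have "hilb (proj_cone X) 0 \<ge> 1" using irr by (intro hilb_pos) (auto simp: form_irred_def)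
  moreover have "hilb (proj_cone X) e \<le> hilb ?U e" using torus_coords_nz[OF t] by (rule hilb_hmul_image)
  ultimately show False by simp
qed

text \<open>The identity component of a closed subgroup. Translates by inverses of its elements are
  connected and contain the identity, so they stay inside; its closure in \<open>M\<close> is
  connected, so it is closed.\<close>

lemma connected_component_subtorus:
  fixes M :: "'n::finite proj set"
  assumes M: "subgroup M torus" "closedin (subtopology zariski (carrier torus)) M"
  obtains H where "subtorus H" "H \<subseteq> M" "\<And>S. connectedin zariski S \<Longrightarrow> \<one>\<^bsub>torus\<^esub> \<in> S \<Longrightarrow> S \<subseteq> M \<Longrightarrow> S \<subseteq> H"
proof -
  interpret comm_group "torus :: 'n proj monoid" by (rule comm_group_torus)
  define H where "H = \<Union>{S. connectedin zariski S \<and> \<one>\<^bsub>torus\<^esub> \<in> S \<and> S \<subseteq> M}"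
  have max: "S \<subseteq> H" if "connectedin zariski S" "\<one>\<^bsub>torus\<^esub> \<in> S" "S \<subseteq> M" for S
    using that by (auto simp: H_def)
  have HM: "H \<subseteq> M" by (auto simp: H_def)
  have MT: "M \<subseteq> carrier torus" using M(1) by (rule subgroup.subset)
  have "connectedin zariski {\<one>\<^bsub>torus\<^esub> :: 'n proj}" by (simp add: connectedin_sing)
  hence H1: "\<one>\<^bsub>torus\<^esub> \<in> H" using max subgroup.one_closed[OF M(1)] by blast
  have H_conn: "connectedin zariski H" unfolding H_def by (rule connectedin_Union) blast+
  have inv_H: "hadamard (inv\<^bsub>torus\<^esub> c) ` H \<subseteq> H" if c: "c \<in> H" for c
  proof (rule max)
    have cM: "c \<in> M" "c \<in> carrier torus" using c HM MT by blast+
    show "connectedin zariski (hadamard (inv\<^bsub>torus\<^esub> c) ` H)"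
      by (rule connectedin_continuous_map_image[OF continuous_map_hadamard[OF inv_closed[OF cM(2)]] H_conn])
    have "hadamard (inv\<^bsub>torus\<^esub> c) c = \<one>\<^bsub>torus\<^esub>" using l_inv[OF cM(2)] by (simp add: torus_mult)
    thus "\<one>\<^bsub>torus\<^esub> \<in> hadamard (inv\<^bsub>torus\<^esub> c) ` H" using c by (metis imageI)
    have "hadamard (inv\<^bsub>torus\<^esub> c) x \<in> M" if "x \<in> M" for x
      using subgroup.m_closed[OF M(1) subgroup.m_inv_closed[OF M(1) cM(1)] that] by (simp add: torus_mult)
    thus "hadamard (inv\<^bsub>torus\<^esub> c) ` H \<subseteq> M" using HM by blast
  qed
  have inv_mem: "inv\<^bsub>torus\<^esub> c \<in> H" if c: "c \<in> H" for c
  proof -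
    have "hadamard (inv\<^bsub>torus\<^esub> c) \<one>\<^bsub>torus\<^esub> = inv\<^bsub>torus\<^esub> c"
      using r_one[of "inv\<^bsub>torus\<^esub> c"] c HM MT by (auto simp: torus_mult)
    thus ?thesis using inv_H[OF c] H1 by (metis imageI subsetD)
  qed
  have sH: "subgroup H torus"
  proof (rule subgroupI)
    show "H \<subseteq> carrier torus" "H \<noteq> {}" using H1 HM MT by auto
    fix a b assume ab: "a \<in> H" "b \<in> H"
    show "inv\<^bsub>torus\<^esub> a \<in> H" using ab by (rule_tac inv_mem)
    have "inv\<^bsub>torus\<^esub> (inv\<^bsub>torus\<^esub> a) = a" using ab HM MT by (intro inv_inv) auto
    thus "a \<otimes>\<^bsub>torus\<^esub> b \<in> H" using inv_H[OF inv_mem[OF ab(1)]] ab(2) by (auto simp: torus_mult)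
  qed
  have HC: "H \<subseteq> zariski closure_of H" by (rule closure_of_subset) simp
  hence "connectedin zariski (zariski closure_of H \<inter> M)"
    using HM by (intro connectedin_intermediate_closure_of[OF H_conn]) auto
  hence "zariski closure_of H \<inter> M \<subseteq> H" using HC H1 HM by (intro max) auto
  hence H_eq: "H = zariski closure_of H \<inter> M" using HC HM by blast
  have "closedin (subtopology zariski (carrier torus)) H"
  proof -
    obtain D where D: "closedin zariski D" "M = D \<inter> carrier torus"
      using M(2) by (auto simp: closedin_subtopology)
    have "H = (zariski closure_of H \<inter> D) \<inter> carrier torus" using H_eq D(2) by blast
    moreover have "closedin zariski (zariski closure_of H \<inter> D)" using D(1) by (intro closedin_Int) auto
    ultimately show ?thesis unfolding closedin_subtopology by blast
  qed
  thus ?thesis using that[of H] sH H_conn HM max by (simp add: subtorus_def)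
qed

text \<open>The identity component of the joint stabiliser. The stabiliser is closed because, for a
  variety, mapping it into itself already means mapping it onto itself, and the inclusion is a
  closed condition on the group element.\<close>

lemma ex_greatest_subtorus:
  fixes X Y :: "'n::finite proj set"
  assumes X: "irreducible_variety X" and Y: "irreducible_variety Y"
  obtains H where "subtorus H" "acts_on H X" "acts_on H Y"
    "\<And>K. subtorus K \<Longrightarrow> acts_on K X \<Longrightarrow> acts_on K Y \<Longrightarrow> K \<subseteq> H"
proof -
  interpret comm_group "torus :: 'n proj monoid" by (rule comm_group_torus)
  define St where "St A = {t \<in> carrier torus. hadamard t ` A = A}" for A :: "'n proj set"
  have St_sub: "subgroup (St A) torus" for A
  proof (rule subgroupI)
    show "St A \<subseteq> carrier torus" by (auto simp: St_def)
    have "\<one>\<^bsub>torus\<^esub> \<in> St A" by (simp add: St_def hadamard_one)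
    thus "St A \<noteq> {}" by blast
    fix s t assume st: "s \<in> St A" "t \<in> St A"
    hence T: "s \<in> carrier torus" "t \<in> carrier torus" by (auto simp: St_def)
    have "hadamard (s \<otimes>\<^bsub>torus\<^esub> t) ` A = hadamard s ` (hadamard t ` A)"
      using hadamard_assoc[OF T] by (simp add: image_image)
    thus "s \<otimes>\<^bsub>torus\<^esub> t \<in> St A" using st T m_closed[OF T] by (simp add: St_def)
    have "hadamard (inv\<^bsub>torus\<^esub> s) ` (hadamard s ` A) = A"
      by (simp add: image_image hadamard_inv(1)[OF T(1)])
    thus "inv\<^bsub>torus\<^esub> s \<in> St A" using st inv_closed[OF T(1)] by (simp add: St_def)
  qed
  have St_closed: "closedin (subtopology zariski (carrier torus)) (St A)" if A: "irreducible_variety A" for A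
  proof -
    have "\<exists>D. closedin zariski D \<and> (\<forall>t\<in>carrier torus. hadamard t p \<in> A \<longleftrightarrow> t \<in> D)" for p
      using closedin_hadamard_orbit_map[of A] A unfolding irreducible_variety_def by metis
    then obtain D where D: "\<And>p. closedin zariski (D p)" "\<And>p t. t \<in> carrier torus \<Longrightarrow> hadamard t p \<in> A \<longleftrightarrow> t \<in> D p"
      by metis
    have "A \<noteq> {}" using A by (simp add: irreducible_variety_def irreducible_in_def)
    hence cl: "closedin zariski (\<Inter>p\<in>A. D p)" using D(1) by (intro closedin_Inter) auto
    have "t \<in> St A \<longleftrightarrow> t \<in> (\<Inter>p\<in>A. D p) \<inter> carrier torus" for t
    proof (cases "t \<in> carrier torus")
      case True
      have "t \<in> St A \<longleftrightarrow> hadamard t ` A \<subseteq> A"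
        using hadamard_image_eq[OF A True] True by (auto simp: St_def)
      thus ?thesis using D(2)[OF True] True by blast
    qed (simp add: St_def)
    hence "St A = (\<Inter>p\<in>A. D p) \<inter> carrier torus" by blast
    thus ?thesis unfolding closedin_subtopology using cl by blast
  qed
  have "subgroup (St X \<inter> St Y) torus" by (intro subgroups_Inter_pair St_sub)
  moreover have "closedin (subtopology zariski (carrier torus)) (St X \<inter> St Y)"
    by (intro closedin_Int St_closed X Y)
  ultimately obtain H where H: "subtorus H" "H \<subseteq> St X \<inter> St Y"
    "\<And>S. connectedin zariski S \<Longrightarrow> \<one>\<^bsub>torus\<^esub> \<in> S \<Longrightarrow> S \<subseteq> St X \<inter> St Y \<Longrightarrow> S \<subseteq> H"
    using connected_component_subtorus by metis
  show ?thesis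
  proof (rule that)
    show "subtorus H" by (rule H(1))
    show "acts_on H X" "acts_on H Y" using H(2) unfolding acts_on_def St_def by blast+
    fix K assume K: "subtorus K" "acts_on K X" "acts_on K Y"
    have sK: "subgroup K torus" using K(1) by (simp add: subtorus_def)
    show "K \<subseteq> H"
    proof (rule H(3))
      show "connectedin zariski K" using K(1) by (simp add: subtorus_def)
      show "\<one>\<^bsub>torus\<^esub> \<in> K" using sK by (rule subgroup.one_closed)
      show "K \<subseteq> St X \<inter> St Y" using K(2,3) subgroup.subset[OF sK] unfolding acts_on_def St_def by blast
    qed
  qed
qed

section \<open>The two dimension bounds\<close>

text \<open>The torus part is dense in \<open>X\<close>, so both have the same Hilbert function; the
  growth is measured on the torus part while the chain is closed up in \<open>X\<close>.\<close>

lemma hilb_variety_upper_bound: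
  fixes X :: "'n::finite proj set"
  assumes X: "irreducible_variety X" "\<not> X \<subseteq> \<Delta>"
  obtains K where "\<And>d. hilb (proj_cone X) d \<le> K * (d + 1) ^ zariski_dim X"
proof -
  have cl: "closedin zariski X" and irr: "irreducible_in zariski X" using X by (auto simp: irreducible_variety_def)
  let ?A = "X \<inter> carrier torus"
  have eq: "?A = X - \<Delta>" by (auto simp: carrier_torus)
  have irrA: "form_irred (proj_cone ?A)"
    unfolding eq by (intro irreducible_in_zariski_cone irreducible_in_diff_hyperplanes irr X(2))
  obtain K where K: "\<And>d. hilb (proj_cone ?A) d \<le> K * (d + 1) ^ zariski_dim X"
    using hilb_upper_bound[OF refl cl irrA] by blast
  obtain p where p: "p \<in> X" "p \<in> carrier torus" using X(2) by (auto simp: carrier_torus)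
  have "hilb (proj_cone X) d \<le> hilb (proj_cone ?A) d" for d
  proof (rule hilb_le_if_vanishing, rule ballI)
    fix f x assume f: "f \<in> form d" "\<forall>x\<in>proj_cone ?A. f x = 0" and x: "x \<in> proj_cone X"
    have "f y = 0" if "y \<in> proj_cone X" "\<And>i. y $ i \<noteq> 0" for y
      using f(2) that mem_torus_pt[of y] by (auto simp: proj_cone_def)
    from form_vanishes_dense[OF irreducible_in_zariski_cone[OF irr] coords_in_cone[OF p(1)] torus_coords_nz[OF p(2)] f(1) this x]
    show "f x = 0" .
  qed
  thus ?thesis using that K order.trans by blast
qed

text \<open>The product inequality for Hilbert functions becomes an inequality between dimensions by
  inserting lower bounds on the left and upper bounds on the right and comparing exponents.\<close>

lemma dim_hadamard_product_le_torus_action: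
  fixes X Y H :: "'n::finite proj set"
  assumes X: "irreducible_variety X" "\<not> X \<subseteq> \<Delta>" and Y: "irreducible_variety Y" "\<not> Y \<subseteq> \<Delta>"
    and H: "subgroup H torus" "acts_on H X" "acts_on H Y"
    and ne: "X \<star> Y \<noteq> {}"
  shows "zariski_dim (X \<star> Y) + zariski_dim H \<le> zariski_dim X + zariski_dim Y"
proof -
  have irr: "form_irred (proj_cone X)"
    using X by (intro irreducible_in_zariski_cone) (simp add: irreducible_variety_def)
  obtain p where p: "p \<in> X" "p \<in> carrier torus" using X(2) by (auto simp: carrier_torus)
  have HT: "H \<subseteq> carrier torus" using H(1) by (rule subgroup.subset)
  have K: "h $ i \<noteq> 0" if "h \<in> proj_cone H" for h i
    using that HT torus_coord_nz by (auto simp: proj_cone_def)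
  have act1: "hmul h x \<in> proj_cone X" if h: "h \<in> proj_cone H" and x: "x \<in> proj_cone X" for h x
  proof -
    have "hadamard (pt h) ` X = X" using h H(2) by (auto simp: proj_cone_def acts_on_def)
    hence "hadamard (pt h) (pt x) \<in> X" using x by (auto simp: proj_cone_def)
    thus ?thesis using hadamard_pt_hmul[OF K[OF h], of x] hmul_nz[OF K[OF h], of x] x by (simp add: proj_cone_def)
  qed
  have act2: "hmul (vinv h) y \<in> proj_cone Y" if h: "h \<in> proj_cone H" and y: "y \<in> proj_cone Y" for h y
  proof -
    have vn: "vinv h $ i \<noteq> 0" for i using K[OF h] by simp
    have yz: "y \<noteq> 0" "pt y \<in> Y" using y by (auto simp: proj_cone_def)
    have "hadamard (pt h) ` Y = Y" using h H(3) by (auto simp: proj_cone_def acts_on_def)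
    then obtain q where q: "q \<in> Y" "pt y = hadamard (pt h) q" using yz(2) by blast
    have z: "coords q \<noteq> 0" by (rule coords_nonzero)
    have "pt y = pt (hmul h (coords q))" using hadamard_pt_hmul[OF K[OF h] z] q(2) by simp
    hence "pt (hmul (vinv h) y) = pt (hmul (vinv h) (hmul h (coords q)))"
      using hadamard_pt_hmul[OF vn yz(1)] hadamard_pt_hmul[OF vn hmul_nz[OF K[OF h] z]] by simp
    also have "hmul (vinv h) (hmul h (coords q)) = coords q" using K[OF h] by (simp add: vec_eq_iff)
    finally show ?thesis using q(1) hmul_nz[OF vn yz(1)] by (simp add: proj_cone_def)
  qed
  let ?W = "{hmul x y | x y. x \<in> proj_cone X \<and> y \<in> proj_cone Y}"
  have le: "hilb (proj_cone (X \<star> Y)) d * hilb (proj_cone H) d \<le> hilb (proj_cone X) (d + d) * hilb (proj_cone Y) d" for d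
  proof -
    have "hilb (proj_cone (X \<star> Y)) d \<le> hilb ?W d"
    proof (rule hilb_le_if_vanishing, rule ballI)
      fix f x assume f: "f \<in> form d" "\<forall>x\<in>?W. f x = 0" and x: "x \<in> proj_cone (X \<star> Y)"
      show "f x = 0" by (rule form_vanishes_hadamard_product[OF f(1) _ x]) (use f(2) in blast)
    qed
    hence "hilb (proj_cone (X \<star> Y)) d * hilb (proj_cone H) d \<le> hilb ?W d * hilb (proj_cone H) d" by simp
    also have "\<dots> \<le> hilb (proj_cone X) (d + d) * hilb (proj_cone Y) d"
      using irr coords_in_cone[OF p(1)] torus_coords_nz[OF p(2)] K act1 act2 by (rule hilb_hmul)
    finally show ?thesis .
  qed
  obtain K1 where K1: "\<And>d. hilb (proj_cone X) d \<le> K1 * (d + 1) ^ zariski_dim X"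
    using hilb_variety_upper_bound[OF X] by blast
  obtain K2 where K2: "\<And>d. hilb (proj_cone Y) d \<le> K2 * (d + 1) ^ zariski_dim Y"
    using hilb_variety_upper_bound[OF Y] by blast
  obtain c where c: "c > 0" "\<And>d. c * real d ^ zariski_dim (X \<star> Y) \<le> hilb (proj_cone (X \<star> Y)) d"
    using zariski_dim_growth[OF ne] by blast
  have "H \<noteq> {}" using subgroup.one_closed[OF H(1)] by blast
  then obtain c' where c': "c' > 0" "\<And>d. c' * real d ^ zariski_dim H \<le> hilb (proj_cone H) d"
    using zariski_dim_growth by blast
  have "(c * c') * real d ^ (zariski_dim (X \<star> Y) + zariski_dim H) \<le>
    real (K1 * 2 ^ zariski_dim X * K2) * real (d + 1) ^ (zariski_dim X + zariski_dim Y)" for d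
  proof -
    have "(c * c') * real d ^ (zariski_dim (X \<star> Y) + zariski_dim H) =
      (c * real d ^ zariski_dim (X \<star> Y)) * (c' * real d ^ zariski_dim H)" by (simp add: power_add)
    also have "\<dots> \<le> real (hilb (proj_cone (X \<star> Y)) d) * real (hilb (proj_cone H) d)"
      using c c' by (intro mult_mono) auto
    also have "\<dots> = real (hilb (proj_cone (X \<star> Y)) d * hilb (proj_cone H) d)" by simp
    also have "\<dots> \<le> real ((K1 * 2 ^ zariski_dim X * K2) * (d + 1) ^ (zariski_dim X + zariski_dim Y))"
    proof -
      \<comment> \<open>Doubling the degree only contributes the constant
        \<open>2 ^ zariski_dim X\<close>.\<close>
      have "K1 * (d + d + 1) ^ zariski_dim X \<le> K1 * (2 * (d + 1)) ^ zariski_dim X"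
        by (intro mult_le_mono2 power_mono) auto
      from mult_le_mono[OF order.trans[OF K1[of "d + d"] this] K2[of d]]
      have "hilb (proj_cone X) (d + d) * hilb (proj_cone Y) d \<le>
        (K1 * (2 * (d + 1)) ^ zariski_dim X) * (K2 * (d + 1) ^ zariski_dim Y)" .
      also have "\<dots> = (K1 * 2 ^ zariski_dim X * K2) * (d + 1) ^ (zariski_dim X + zariski_dim Y)"
        unfolding power_mult_distrib power_add by (simp only: mult_ac)
      finally show ?thesis using le[of d] by (simp only: of_nat_le_iff order.trans)
    qed
    finally show ?thesis by (simp only: of_nat_mult of_nat_power)
  qed
  thus ?thesis using c(1) c'(1) by (intro power_growth_le[of "c * c'"]) auto
qed

lemma dim_hadamard_product_le_coset:
  fixes X Y G :: "'n::finite proj set"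
  assumes X: "irreducible_variety X" "\<not> X \<subseteq> \<Delta>" "has_coset_containing G X"
    and Y: "irreducible_variety Y" "\<not> Y \<subseteq> \<Delta>" "has_coset_containing G Y"
    and G: "subtorus G" "irreducible_in zariski G" and ne: "X \<star> Y \<noteq> {}"
  shows "zariski_dim (X \<star> Y) \<le> zariski_dim G"
proof -
  have sG: "subgroup G torus" using G(1) by (simp add: subtorus_def)
  obtain D where D: "closedin zariski D" "G = D \<inter> carrier torus"
    using G(1) by (auto simp: subtorus_def closedin_subtopology)
  obtain K where K: "\<And>d. hilb (proj_cone G) d \<le> K * (d + 1) ^ zariski_dim G"
    using hilb_upper_bound[OF D(2,1) irreducible_in_zariski_cone[OF G(2)]] by blast
  obtain c where c: "c > 0" "\<And>d. c * real d ^ zariski_dim (X \<star> Y) \<le> hilb (proj_cone (X \<star> Y)) d"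
    using zariski_dim_growth[OF ne] by blast
  have "c * real d ^ zariski_dim (X \<star> Y) \<le> real K * real (d + 1) ^ zariski_dim G" for d
  proof -
    have "hilb (proj_cone (X \<star> Y)) d \<le> hilb (proj_cone G) d"
      using X Y sG by (intro hilb_hadamard_product_le_coset irreducible_in_zariski_cone)
        (auto simp: irreducible_variety_def)
    also have "\<dots> \<le> K * (d + 1) ^ zariski_dim G" by (rule K)
    finally have "real (hilb (proj_cone (X \<star> Y)) d) \<le> real (K * (d + 1) ^ zariski_dim G)"
      by (simp only: of_nat_le_iff)
    with c(2)[of d] have "c * real d ^ zariski_dim (X \<star> Y) \<le> real (K * (d + 1) ^ zariski_dim G)"
      by (rule order.trans)
    thus ?thesis by (simp only: of_nat_mult of_nat_power)
  qed
  thus ?thesis using c(1) by (rule power_growth_le[rotated])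
qed

theorem proposition5p4:
  fixes X Y H G :: "'n::finite proj set"
  assumes "irreducible_variety X" and "irreducible_variety Y"
    and "\<not> X \<subseteq> \<Delta>" and "\<not> Y \<subseteq> \<Delta>"
    and "H = (GREATEST H. subtorus H \<and> acts_on H X \<and> acts_on H Y)"
    and "G = (LEAST G. subtorus G \<and> has_coset_containing G X \<and> has_coset_containing G Y)"
  shows "int (zariski_dim (X \<star> Y))
    \<le> min (int (zariski_dim X) + int (zariski_dim Y) - int (zariski_dim H)) (int (zariski_dim G))"
proof -
  \<comment> \<open>\<open>GREATEST\<close> and \<open>LEAST\<close> are informative only once a
    greatest and a least element exist; these are constructed and then identified with
    \<open>H\<close> and \<open>G\<close>.\<close>
  obtain H' where H': "subtorus H'" "acts_on H' X" "acts_on H' Y"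
    "\<And>K. subtorus K \<Longrightarrow> acts_on K X \<Longrightarrow> acts_on K Y \<Longrightarrow> K \<subseteq> H'"
    using ex_greatest_subtorus[OF assms(1,2)] by blast
  have H: "H = H'" unfolding assms(5) using H' by (intro Greatest_equality) auto
  have irr: "irreducible_in zariski X" "irreducible_in zariski Y"
    using assms(1,2) by (auto simp: irreducible_variety_def)
  obtain G' where G': "subtorus G'" "has_coset_containing G' X" "has_coset_containing G' Y" "irreducible_in zariski G'"
    "\<And>K. subtorus K \<Longrightarrow> has_coset_containing K X \<Longrightarrow> has_coset_containing K Y \<Longrightarrow> G' \<subseteq> K"
    using ex_least_subtorus[OF irr(1) assms(3) irr(2) assms(4)] by blast
  have G: "G = G'" unfolding assms(6) using G' by (intro Least_equality) auto
  \<comment> \<open>The lower growth bound needs a nonempty set: a torus point of \<open>X\<close>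
    has a defined product with every point of \<open>Y\<close>.\<close>
  have ne: "X \<star> Y \<noteq> {}"
  proof -
    obtain p q where pq: "p \<in> X" "p \<in> carrier torus" "q \<in> Y" using assms(3) irr(2)
      by (auto simp: carrier_torus irreducible_in_def)
    obtain i where "coords q $ i \<noteq> 0" using coords_nonzero[of q] by (auto simp: vec_eq_iff)
    hence "hadamard_defined p q" using torus_coords_nz[OF pq(2)] by (auto simp: hadamard_defined_def)
    hence "hadamard p q \<in> {hadamard p q |p q. p \<in> X \<and> q \<in> Y \<and> hadamard_defined p q}" using pq by blast
    thus ?thesis unfolding hadamard_product_def
      using closure_of_subset[of "{hadamard p q |p q. p \<in> X \<and> q \<in> Y \<and> hadamard_defined p q}" zariski] by auto
  qed
  have "zariski_dim (X \<star> Y) + zariski_dim H \<le> zariski_dim X + zariski_dim Y"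
    unfolding H using H' assms ne by (intro dim_hadamard_product_le_torus_action) (auto simp: subtorus_def)
  moreover have "zariski_dim (X \<star> Y) \<le> zariski_dim G"
    unfolding G using G' assms ne by (intro dim_hadamard_product_le_coset)
  ultimately show ?thesis by simp
qed

end
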